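(* Let $\mu,\nu\in\mathcal M$ with $\mu(\mathbb R)\le\nu(\mathbb R)$. The shadow measure $S^\nu(\mu)$ of $\mu$ in $\nu$ is the unique element of $\mathcal T_{\mu,\nu}$ satisfying (1) $S^\nu(\mu)\in\operatorname{argmin}_{\theta\in\mathcal T_{\mu,\nu}}V(\mu,\theta)$, and (2) $S^\nu(\mu)\le_c\theta^*$ for all $\theta^*\in\operatorname{argmin}_{\theta\in\mathcal T_{\mu,\nu}}V(\mu,\theta)$.
   Context: $\mathcal M$ is the set of Borel measures $\eta$ on $\mathbb R$ with $\eta(\mathbb R)<\infty$ and $\int|x|\,\eta(dx)<\infty$. For $\eta\in\mathcal M$: $P_\eta(k)=\int(k-x)^+\eta(dx)$. $\eta\le_c\chi$ means $\int f\,d\eta\le\int f\,d\chi$ for all convex $f:\mathbb R\to\mathbb R$. $\mathcal T_{\mu,\nu}=\{\theta\in\mathcal M:\theta(\mathbb R)=\mu(\mathbb R),\ \theta\le\nu\}$, where $\theta\le\nu$ means $\theta(A)\le\nu(A)$ for all Borel $A$. For $\theta\in\mathcal T_{\mu,\nu}$, $\Pi(\mu,\theta)$ is the set of measures on $\mathbb R^2$ with first marginal $\mu$ and second marginal $\theta$, disintegrated as $\pi(dx,dy)=\pi_x(dy)\mu(dx)$ with probability measures $\pi_x$, and $$V(\mu,\theta)=\inf_{\pi\in\Pi(\mu,\theta)}\int_{\mathbb R}\Big|x-\int_{\mathbb R}y\,\pi_x(dy)\Big|\,\mu(dx).$$ For $f:\mathbb R\to\mathbb R$, $f^c$ is the largest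 convex minorant of $f$, and $p_{\mu,\nu}=\sup_k\{P_\mu(k)-P_\nu(k)\}\in[0,\infty)$. The shadow measure $S^\nu(\mu)$ is the unique measure in $\mathcal T_{\mu,\nu}$ with $$P_{S^\nu(\mu)}(k)=P_\nu(k)-(P_\nu-P_\mu)^c(k)-p_{\mu,\nu},\quad k\in\mathbb R$$ (such a measure exists). *)

theory Defs
  imports "HOL-Probability.Probability"
begin

definition meas1 :: "real measure set" where
  "meas1 = {\<eta>. sets \<eta> = sets borel \<and> emeasure \<eta> UNIV < \<infinity>
                 \<and> (\<integral>\<^sup>+ x. ennreal \<bar>x\<bar> \<partial>\<eta>) < \<infinity>}"

definition put_fun :: "real measure \<Rightarrow> real \<Rightarrow> real" where
  "put_fun \<eta> k = (\<integral> x. max 0 (k - x) \<partial>\<eta>)"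

text \<open>A convex function is bounded below by an affine one, so its negative part is integrable
  with respect to every measure in \<^const>\<open>meas1\<close>, but its positive part need not be; hence the
  integral is taken in the extended reals. Note that \<^const>\<open>ennreal\<close> truncates negative
  arguments to 0, and that the junk value of \<open>\<infinity> - \<infinity>\<close> is never met here.\<close>

definition ext_integral :: "real measure \<Rightarrow> (real \<Rightarrow> real) \<Rightarrow> ereal" where
  "ext_integral \<eta> f =
     enn2ereal (\<integral>\<^sup>+ x. ennreal (f x) \<partial>\<eta>) - enn2ereal (\<integral>\<^sup>+ x. ennreal (- f x) \<partial>\<eta>)"

definition convex_le :: "real measure \<Rightarrow> real measure \<Rightarrow> bool"  (infix "\<le>\<^sub>c" 50) where
  "\<eta> \<le>\<^sub>c \<zeta> \<longleftrightarrow> (\<forall>f. convex_on UNIV f \<longrightarrow> ext_integral \<eta> f \<le> ext_integral \<zeta> f)"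

definition submeasures :: "real measure \<Rightarrow> real measure \<Rightarrow> real measure set" where
  "submeasures \<mu> \<nu> = {\<theta> \<in> meas1. emeasure \<theta> UNIV = emeasure \<mu> UNIV
                           \<and> (\<forall>A \<in> sets borel. emeasure \<theta> A \<le> emeasure \<nu> A)}"

definition couplings :: "real measure \<Rightarrow> real measure \<Rightarrow> (real \<times> real) measure set" where
  "couplings \<mu> \<theta> = {\<pi>. sets \<pi> = sets (borel \<Otimes>\<^sub>M borel)
                        \<and> distr \<pi> borel fst = \<mu> \<and> distr \<pi> borel snd = \<theta>}"

definition disintegration ::
    "real measure \<Rightarrow> (real \<times> real) measure \<Rightarrow> (real \<Rightarrow> real measure) \<Rightarrow> bool" where
  "disintegration \<mu> \<pi> K \<longleftrightarrow> K \<in> borel \<rightarrow>\<^sub>M prob_algebra borel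
     \<and> (\<forall>A \<in> sets borel. \<forall>B \<in> sets borel.
          emeasure \<pi> (A \<times> B) = (\<integral>\<^sup>+ x \<in> A. emeasure (K x) B \<partial>\<mu>))"

text \<open>Every coupling has a disintegration, and it is unique up to a \<open>\<mu>\<close>-null set, so letting
  the infimum also range over the disintegrations \<open>K\<close> of \<open>\<pi>\<close> does not change it. The inner
  Bochner integral exists for \<open>\<mu>\<close>-almost every \<open>x\<close> when \<open>\<theta>\<close> has a finite first moment.\<close>

definition weak_cost :: "real measure \<Rightarrow> real measure \<Rightarrow> ennreal" where
  "weak_cost \<mu> \<theta> =
     Inf {\<integral>\<^sup>+ x. ennreal \<bar>x - (\<integral> y. y \<partial>(K x))\<bar> \<partial>\<mu> | \<pi> K.
            \<pi> \<in> couplings \<mu> \<theta> \<and> disintegration \<mu> \<pi> K}"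

definition cost_argmin :: "real measure \<Rightarrow> real measure \<Rightarrow> real measure set" where
  "cost_argmin \<mu> \<nu> =
     {\<theta>. is_arg_min (weak_cost \<mu>) (\<lambda>\<theta>'. \<theta>' \<in> submeasures \<mu> \<nu>) \<theta>}"

text \<open>The order on functions is pointwise.\<close>

definition convex_minorant :: "(real \<Rightarrow> real) \<Rightarrow> real \<Rightarrow> real" where
  "convex_minorant f = (GREATEST g. convex_on UNIV g \<and> g \<le> f)"

definition put_gap :: "real measure \<Rightarrow> real measure \<Rightarrow> real" where
  "put_gap \<mu> \<nu> = (SUP k. put_fun \<mu> k - put_fun \<nu> k)"

definition shadow :: "real measure \<Rightarrow> real measure \<Rightarrow> real measure" where
  "shadow \<nu> \<mu> = (THE \<theta>. \<theta> \<in> submeasures \<mu> \<nu> \<and>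
     (\<forall>k. put_fun \<theta> k =
        put_fun \<nu> k - convex_minorant (\<lambda>x. put_fun \<nu> x - put_fun \<mu> x) k - put_gap \<mu> \<nu>))"

end

theory Submission
  imports Defs
begin

text \<open>Write \<open>p\<close> for the largest value of \<open>P\<^sub>\<mu> - P\<^sub>\<nu>\<close> and \<open>c\<close> for the largest value of \<open>C\<^sub>\<mu> - C\<^sub>\<nu>\<close>, where
\<open>C\<^sub>\<eta>(k) = \<integral>(x - k)\<^sup>+ \<eta>(dx)\<close> is the call function (suprema, to be precise).  The cost of a coupling
with conditional means \<open>b(x)\<close> splits into the amount \<open>\<integral>(b(x) - x)\<^sup>+ \<mu>(dx)\<close> by which mass is moved up and
the amount \<open>\<integral>(x - b(x))\<^sup>+ \<mu>(dx)\<close> by which it is moved down.  By Jensen, the law of \<open>b\<close> has a smaller put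
function than the second marginal \<open>\<theta>\<close>, so the first amount is at least \<open>P\<^sub>\<mu>(k) - P\<^sub>\<theta>(k)\<close>, hence at
least \<open>p\<close> when \<open>\<theta> \<le> \<nu>\<close>; likewise the second is at least \<open>c\<close>.  So every target \<open>\<theta>\<close> costs at least
\<open>p + c\<close> (\<open>weak_cost_ge_gaps\<close>).

Conversely, if \<open>P\<^sub>\<mu> - P\<^sub>\<theta> \<le> p\<close> and \<open>C\<^sub>\<mu> - C\<^sub>\<theta> \<le> c\<close>, then \<open>\<theta>\<close> costs at most \<open>p + c\<close>
(\<open>weak_cost_le_put_call_gaps\<close>).  The levels of the two quantile functions are cut into \<open>N\<close> cells of
equal mass, and cells are paired by a doubly stochastic matrix.  For cell averages the optimal matrix can
be written down: start from the monotone coupling, in which level \<open>u\<close> is displaced by \<open>x(u) - y(u)\<close>, and let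
cells that are displaced downwards exchange some of their targets with higher cells that are displaced
upwards.  What cannot be cancelled is bounded by a tail sum of \<open>x - y\<close> and an initial sum of \<open>y - x\<close>, that is, by
\<open>c\<close> and \<open>p\<close>.  The error from averaging tends to \<open>0\<close> as \<open>N\<close> grows, and because the cost is an infimum,
almost optimal couplings suffice.

The shadow satisfies both hypotheses and therefore is a minimiser.  For any minimiser \<open>\<theta>\<close>, almost optimal
couplings move mass up by almost exactly \<open>p\<close> and down by almost exactly \<open>c\<close>.  This fixes the mean of \<open>\<theta>\<close>
and gives \<open>P\<^sub>\<mu> - P\<^sub>\<theta> \<le> p\<close>.  Hence \<open>P\<^sub>\<nu> - P\<^sub>\<theta> - p\<close>, which is convex because \<open>\<theta> \<le> \<nu>\<close>, lies below
\<open>P\<^sub>\<nu> - P\<^sub>\<mu>\<close> and so below its convex minorant; this says exactly that the put function of the shadow is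
below that of \<open>\<theta>\<close> (\<open>put_fun_shadow_le\<close>).  With equal masses and means that is the convex order
(\<open>convex_le_if_put_fun_le\<close>): by the upper bound, the weak cost between the two measures is \<open>0\<close>, so there are
couplings that are almost martingale couplings, and Jensen with Fatou concludes.  Uniqueness holds because the
put function determines the measure.

That the shadow exists at all rests on the fact that \<open>g - (g - h)\<^sup>c\<close> is convex for convex \<open>g\<close> and \<open>h\<close>
(\<open>convex_on_minus_convex_minorant\<close>).  It splits \<open>P\<^sub>\<nu>\<close> into two convex functions, whose right derivatives
are the distribution functions of the shadow and of the remainder of \<open>\<nu>\<close>.\<close>

section \<open>Convex functions on the line\<close>

lemma convex_on_three_pointD:
  fixes f :: "real \<Rightarrow> real"
  assumes "convex_on UNIV f" "a \<le> b" "b \<le> c"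
  shows "(c - a) * f b \<le> (c - b) * f a + (b - a) * f c"
proof (cases "a = c")
  case False
  then have ac: "0 < c - a" using assms by simp
  define t where "t = (b - a) / (c - a)"
  have t: "0 \<le> t" "t \<le> 1" "1 - t = (c - b) / (c - a)"
    using ac assms by (auto simp: t_def field_simps)
  have "t * (c - a) = b - a" using ac by (simp add: t_def)
  then have b: "b = (1 - t) * a + t * c" by (simp add: algebra_simps)
  have "f b \<le> (1 - t) * f a + t * f c"
    using convex_onD[OF assms(1) t(1,2), of a c] b by simp
  also have "\<dots> = ((c - b) * f a + (b - a) * f c) / (c - a)"
    by (simp only: t(3)) (simp add: t_def add_divide_distrib)
  finally show ?thesis using ac by (simp add: pos_le_divide_eq mult.commute)
qed (use assms in auto)

lemma convex_on_three_pointI: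
  fixes f :: "real \<Rightarrow> real"
  assumes "\<And>a b c. a < b \<Longrightarrow> b < c \<Longrightarrow> (c - a) * f b \<le> (c - b) * f a + (b - a) * f c"
  shows "convex_on UNIV f"
proof (rule convex_on_linorderI)
  fix t x y :: real
  assume t: "0 < t" "t < 1" and xy: "x < y"
  define b where "b = (1 - t) * x + t * y"
  have b: "b - x = t * (y - x)" "y - b = (1 - t) * (y - x)"
    by (auto simp: b_def algebra_simps)
  then have "x < b" "b < y"
    using t xy mult_pos_pos[of t "y - x"] mult_pos_pos[of "1 - t" "y - x"] by linarith+
  from assms[OF this] have "(y - x) * f b \<le> (y - x) * ((1 - t) * f x + t * f y)"
    unfolding b by (simp add: algebra_simps)
  then have "f b \<le> (1 - t) * f x + t * f y" using xy by simp
  then show "f ((1 - t) *\<^sub>R x + t *\<^sub>R y) \<le> (1 - t) * f x + t * f y" by (simp add: b_def)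
qed auto

lemma slope_le_slope_iff:
  fixes a b c a' c' :: real
  shows "a < b \<Longrightarrow> b < c \<Longrightarrow> (fb - fa) / (b - a) \<le> (fc - fb) / (c - b)
      \<longleftrightarrow> (c - a) * fb \<le> (c - b) * fa + (b - a) * fc"
    and "a < b \<Longrightarrow> a' < b \<Longrightarrow> (fb - fa) / (b - a) \<le> (fb - fa') / (b - a')
      \<longleftrightarrow> (b - a) * fa' \<le> (b - a') * fa + (a' - a) * fb"
    and "b < c' \<Longrightarrow> b < c \<Longrightarrow> (fc' - fb) / (c' - b) \<le> (fc - fb) / (c - b)
      \<longleftrightarrow> (c - b) * fc' \<le> (c - c') * fb + (c' - b) * fc"
proof -
  have cross: "x / d \<le> y / e \<longleftrightarrow> x * e \<le> y * d" if "0 < d" "0 < e" for x y d e :: real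
    using that by (simp add: field_simps)
  show "a < b \<Longrightarrow> b < c \<Longrightarrow> (fb - fa) / (b - a) \<le> (fc - fb) / (c - b)
      \<longleftrightarrow> (c - a) * fb \<le> (c - b) * fa + (b - a) * fc"
    by (subst cross) (simp_all add: algebra_simps)
  show "a < b \<Longrightarrow> a' < b \<Longrightarrow> (fb - fa) / (b - a) \<le> (fb - fa') / (b - a')
      \<longleftrightarrow> (b - a) * fa' \<le> (b - a') * fa + (a' - a) * fb"
    by (subst cross) (simp_all add: algebra_simps)
  show "b < c' \<Longrightarrow> b < c \<Longrightarrow> (fc' - fb) / (c' - b) \<le> (fc - fb) / (c - b)
      \<longleftrightarrow> (c - b) * fc' \<le> (c - c') * fb + (c' - b) * fc"
    by (subst cross) (simp_all add: algebra_simps)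
qed

text \<open>A convex function may be raised on an interval to another function that is convex there and agrees with it at
the two ends: at an end point the graph lies above the old one on the inner side and is unchanged on the outer
side, so the slope can only jump upwards.\<close>

lemma convex_on_glue:
  fixes f \<phi> :: "real \<Rightarrow> real"
  assumes f: "convex_on UNIV f"
    and outside: "\<And>u. u \<le> y \<or> z \<le> u \<Longrightarrow> \<phi> u = f u"
    and above: "\<And>u. f u \<le> \<phi> u"
    and inside: "\<And>a b c. y \<le> a \<Longrightarrow> a < b \<Longrightarrow> b < c \<Longrightarrow> c \<le> z \<Longrightarrow>
       (c - a) * \<phi> b \<le> (c - b) * \<phi> a + (b - a) * \<phi> c"
  shows "convex_on UNIV \<phi>"
proof (rule convex_on_three_pointI)
  fix a b c :: real
  assume ab: "a < b" and bc: "b < c"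
  have at_contact: "(c - a) * \<phi> b \<le> (c - b) * \<phi> a + (b - a) * \<phi> c"
    if "a < b" "b < c" "\<phi> b = f b" for a b c
  proof -
    have "(c - a) * \<phi> b \<le> (c - b) * f a + (b - a) * f c"
      using convex_on_three_pointD[OF f, of a b c] that by simp
    also have "\<dots> \<le> (c - b) * \<phi> a + (b - a) * \<phi> c"
      using that above by (intro add_mono mult_left_mono) auto
    finally show ?thesis .
  qed
  show "(c - a) * \<phi> b \<le> (c - b) * \<phi> a + (b - a) * \<phi> c"
  proof (cases "y < b \<and> b < z")
    case False
    then show ?thesis using at_contact[OF ab bc] outside[of b] by (simp add: not_less)
  next
    case True
    \<comment> \<open>Only the part of \<open>[a, c]\<close> inside \<open>[y, z]\<close> is covered by the convexity of the raised function;
      the slopes to its end points compare with those to \<open>a\<close> and \<open>c\<close> by convexity at the contact points.\<close>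
    define a' c' where "a' = max a y" and "c' = min c z"
    have a': "a \<le> a'" "a' < b" and c': "b < c'" "c' \<le> c"
      using True ab bc by (auto simp: a'_def c'_def)
    have "(b - a) * \<phi> a' \<le> (b - a') * \<phi> a + (a' - a) * \<phi> b"
    proof (cases "a = a'")
      case False
      then have "a < a'" "\<phi> a' = f a'" using a' outside[of a'] by (auto simp: a'_def max_def)
      then show ?thesis using at_contact[of a a' b] a' by blast
    qed simp
    then have left: "(\<phi> b - \<phi> a) / (b - a) \<le> (\<phi> b - \<phi> a') / (b - a')"
      by (subst slope_le_slope_iff(2)[OF ab a'(2)])
    have "(c - b) * \<phi> c' \<le> (c - c') * \<phi> b + (c' - b) * \<phi> c"
    proof (cases "c = c'")
      case False
      then have "c' < c" "\<phi> c' = f c'" using c' outside[of c'] by (auto simp: c'_def min_def)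
      then show ?thesis using at_contact[of b c' c] c' by blast
    qed simp
    then have right: "(\<phi> c' - \<phi> b) / (c' - b) \<le> (\<phi> c - \<phi> b) / (c - b)"
      by (subst slope_le_slope_iff(3)[OF c'(1) bc])
    have "(c' - a') * \<phi> b \<le> (c' - b) * \<phi> a' + (b - a') * \<phi> c'"
      by (rule inside) (use a' c' in \<open>auto simp: a'_def c'_def\<close>)
    then have "(\<phi> b - \<phi> a') / (b - a') \<le> (\<phi> c' - \<phi> b) / (c' - b)"
      by (subst slope_le_slope_iff(1)[OF a'(2) c'(1)])
    with left right have "(\<phi> b - \<phi> a) / (b - a) \<le> (\<phi> c - \<phi> b) / (c - b)" by linarith
    then show ?thesis by (subst (asm) slope_le_slope_iff(1)[OF ab bc])
  qed
qed

text \<open>The set whose greatest element defines \<^const>\<open>convex_minorant\<close>.\<close>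

definition is_convex_minorant :: "(real \<Rightarrow> real) \<Rightarrow> (real \<Rightarrow> real) \<Rightarrow> bool" where
  "is_convex_minorant f g \<longleftrightarrow> convex_on UNIV g \<and> g \<le> f"

text \<open>The pointwise supremum of all convex minorants is again one; a single minorant is enough to make the supremum,
and with it the greatest element, exist.\<close>

lemma convex_minorant_greatest:
  assumes "is_convex_minorant f g\<^sub>0"
  shows "is_convex_minorant f (convex_minorant f)"
    and "is_convex_minorant f g \<Longrightarrow> g x \<le> convex_minorant f x"
proof -
  define M where "M = Collect (is_convex_minorant f)"
  define s where "s x = (SUP g\<in>M. g x)" for x
  have ne: "M \<noteq> {}" using assms by (auto simp: M_def)
  have bdd: "bdd_above ((\<lambda>g. g x) ` M)" for x
    by (rule bdd_aboveI[of _ "f x"]) (auto simp: M_def is_convex_minorant_def le_fun_def)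
  have upper: "g x \<le> s x" if "is_convex_minorant f g" for g x
    unfolding s_def by (rule cSUP_upper[OF _ bdd]) (use that in \<open>simp add: M_def\<close>)
  have "convex_on UNIV s"
  proof (rule convex_on_three_pointI)
    fix a b c :: real assume ab: "a < b" and bc: "b < c"
    have "g b \<le> ((c - b) * s a + (b - a) * s c) / (c - a)" if "g \<in> M" for g
    proof -
      have g: "is_convex_minorant f g" using that by (simp add: M_def)
      have "(c - a) * g b \<le> (c - b) * g a + (b - a) * g c"
        using g ab bc by (intro convex_on_three_pointD) (auto simp: is_convex_minorant_def)
      also have "\<dots> \<le> (c - b) * s a + (b - a) * s c"
        using upper[OF g] ab bc by (intro add_mono mult_left_mono) auto
      finally show ?thesis using ab bc by (simp add: pos_le_divide_eq mult.commute)
    qed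
    then have "s b \<le> ((c - b) * s a + (b - a) * s c) / (c - a)"
      unfolding s_def[of b] by (intro cSUP_least[OF ne])
    then show "(c - a) * s b \<le> (c - b) * s a + (b - a) * s c"
      using ab bc by (simp add: pos_le_divide_eq mult.commute)
  qed
  moreover have "s x \<le> f x" for x
    unfolding s_def by (intro cSUP_least[OF ne]) (auto simp: M_def is_convex_minorant_def le_fun_def)
  ultimately have s: "is_convex_minorant f s"
    by (simp add: is_convex_minorant_def le_fun_def)
  have "convex_minorant f = s"
    unfolding convex_minorant_def
    by (rule Greatest_equality) (use s upper in \<open>auto simp: is_convex_minorant_def le_fun_def\<close>)
  with s upper show "is_convex_minorant f (convex_minorant f)"
    and "is_convex_minorant f g \<Longrightarrow> g x \<le> convex_minorant f x" by auto
qed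

text \<open>Let \<open>F = g - (g - h)\<^sup>c\<close>, so that \<open>h \<le> F\<close>, and let \<open>l\<close> be the chord of \<open>F\<close> over \<open>[y, z]\<close>.  On this
interval \<open>h \<le> l\<close> by convexity, so that \<open>g - l \<le> g - h\<close>; at the ends \<open>g - l\<close> equals the minorant.  Hence
raising the minorant to \<open>g - l\<close> on the interval produces another convex minorant of \<open>g - h\<close>.  By maximality
\<open>g - l\<close> lies below the minorant, that is, \<open>F\<close> lies below its chord.\<close>

lemma convex_on_minus_convex_minorant:
  fixes g h :: "real \<Rightarrow> real"
  assumes g: "convex_on UNIV g" and h: "convex_on UNIV h"
    and ex: "is_convex_minorant (\<lambda>x. g x - h x) g\<^sub>0"
  defines "fc \<equiv> convex_minorant (\<lambda>x. g x - h x)"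
  shows "convex_on UNIV (\<lambda>x. g x - fc x)"
proof (rule convex_on_three_pointI)
  fix y x z :: real assume yx: "y < x" and xz: "x < z"
  have fc: "convex_on UNIV fc" and fc_le: "fc u \<le> g u - h u" for u
    using convex_minorant_greatest(1)[OF ex] by (auto simp: fc_def is_convex_minorant_def le_fun_def)
  have fc_greatest: "\<psi> u \<le> fc u" if "convex_on UNIV \<psi>" "\<And>u. \<psi> u \<le> g u - h u" for \<psi> u
    using convex_minorant_greatest(2)[OF ex, of \<psi> u] that
    by (simp add: fc_def is_convex_minorant_def le_fun_def)
  define F where "F u = g u - fc u" for u
  define l where "l u = ((z - u) * F y + (u - y) * F z) / (z - y)" for u
  have zy: "0 < z - y" using yx xz by simp
  have l_eq: "(z - y) * l u = (z - u) * F y + (u - y) * F z" for u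
    using zy by (simp add: l_def)
  have l_ends: "l y = F y" "l z = F z" using zy by (auto simp: l_def)
  have l_affine: "(c - a) * l b = (c - b) * l a + (b - a) * l c" for a b c
  proof -
    have "(z - y) * ((c - a) * l b) = (c - a) * ((z - y) * l b)" by simp
    also have "\<dots> = (c - b) * ((z - y) * l a) + (b - a) * ((z - y) * l c)"
      unfolding l_eq by (simp add: algebra_simps)
    also have "\<dots> = (z - y) * ((c - b) * l a + (b - a) * l c)" by (simp add: algebra_simps)
    finally show ?thesis using zy by simp
  qed
  define \<phi> where "\<phi> u = (if y \<le> u \<and> u \<le> z then max (fc u) (g u - l u) else fc u)" for u
  have \<phi>_ge: "fc u \<le> \<phi> u" "y \<le> u \<Longrightarrow> u \<le> z \<Longrightarrow> g u - l u \<le> \<phi> u" for u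
    by (auto simp: \<phi>_def)
  have "convex_on UNIV \<phi>"
  proof (rule convex_on_glue[OF fc])
    show "\<phi> u = fc u" if "u \<le> y \<or> z \<le> u" for u
    proof (cases "u = y \<or> u = z")
      case True
      then show ?thesis using l_ends by (auto simp: \<phi>_def F_def)
    next
      case False
      then show ?thesis using that by (auto simp: \<phi>_def)
    qed
  next
    fix a b c assume abc: "y \<le> a" "a < b" "b < c" "c \<le> z"
    have "(c - a) * fc b \<le> (c - b) * fc a + (b - a) * fc c"
      using convex_on_three_pointD[OF fc, of a b c] abc by simp
    also have "\<dots> \<le> (c - b) * \<phi> a + (b - a) * \<phi> c"
      using abc \<phi>_ge(1) by (intro add_mono mult_left_mono) auto
    finally have 1: "(c - a) * fc b \<le> (c - b) * \<phi> a + (b - a) * \<phi> c" .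
    have "(c - a) * (g b - l b) \<le> (c - b) * (g a - l a) + (b - a) * (g c - l c)"
      using convex_on_three_pointD[OF g, of a b c] l_affine[of c a b] abc by (simp add: right_diff_distrib)
    also have "\<dots> \<le> (c - b) * \<phi> a + (b - a) * \<phi> c"
      using abc \<phi>_ge(2) by (intro add_mono mult_left_mono) auto
    finally have "(c - a) * (g b - l b) \<le> (c - b) * \<phi> a + (b - a) * \<phi> c" .
    with 1 show "(c - a) * \<phi> b \<le> (c - b) * \<phi> a + (b - a) * \<phi> c"
      using abc by (auto simp: \<phi>_def[of b] max_def)
  qed (rule \<phi>_ge)
  moreover have "\<phi> u \<le> g u - h u" for u
  proof (cases "y \<le> u \<and> u \<le> z")
    case True
    have "(z - y) * h u \<le> (z - u) * h y + (u - y) * h z"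
      using convex_on_three_pointD[OF h] True by blast
    also have "\<dots> \<le> (z - u) * F y + (u - y) * F z"
      using True fc_le[of y] fc_le[of z] by (intro add_mono mult_left_mono) (auto simp: F_def)
    also have "\<dots> = (z - y) * l u" by (simp add: l_eq)
    finally have "h u \<le> l u" using zy by simp
    then show ?thesis using True fc_le[of u] by (simp add: \<phi>_def)
  qed (auto simp: \<phi>_def fc_le)
  ultimately have "g x - l x \<le> fc x"
    using fc_greatest[of \<phi> x] \<phi>_ge(2)[of x] yx xz by simp
  then have "(z - y) * (g x - fc x) \<le> (z - y) * l x"
    using zy by (intro mult_left_mono) auto
  then show "(z - y) * (g x - fc x) \<le> (z - x) * (g y - fc y) + (x - y) * (g z - fc z)"
    by (simp add: l_eq F_def)
qed

lemma convex_on_positive_part: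
  fixes s t :: real
  shows "convex_on UNIV (\<lambda>y. max 0 (s * y + t))"
proof (rule convex_on_three_pointI)
  fix a b c :: real assume ab: "a < b" and bc: "b < c"
  have "(c - a) * (s * b + t) = (c - b) * (s * a + t) + (b - a) * (s * c + t)" by (simp add: algebra_simps)
  also have "\<dots> \<le> (c - b) * max 0 (s * a + t) + (b - a) * max 0 (s * c + t)"
    using ab bc by (intro add_mono mult_left_mono) auto
  finally have "(c - a) * (s * b + t) \<le> (c - b) * max 0 (s * a + t) + (b - a) * max 0 (s * c + t)" .
  moreover have "0 \<le> (c - b) * max 0 (s * a + t) + (b - a) * max 0 (s * c + t)"
    using ab bc by simp
  ultimately show "(c - a) * max 0 (s * b + t) \<le> (c - b) * max 0 (s * a + t) + (b - a) * max 0 (s * c + t)"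
    by (simp add: max_def)
qed

text \<open>For convex \<open>G\<close> the difference quotients decrease to the right derivative, so the infimum is the limit.\<close>

definition right_deriv :: "(real \<Rightarrow> real) \<Rightarrow> real \<Rightarrow> real" where
  "right_deriv G k = (INF t\<in>{k<..}. (G k - G t) / (k - t))"

lemma right_deriv_subgradient:
  assumes "convex_on UNIV G"
  shows "G x + right_deriv G x * (y - x) \<le> G y"
  using convex_le_Inf_differential[OF assms, of x y] by (simp add: right_deriv_def)

lemma right_deriv_slope:
  assumes "convex_on UNIV G" "a < b"
  shows "right_deriv G a \<le> (G b - G a) / (b - a)" "(G b - G a) / (b - a) \<le> right_deriv G b"
  using right_deriv_subgradient[OF assms(1), of a b] right_deriv_subgradient[OF assms(1), of b a] assms(2)
  by (auto simp: field_simps)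

lemma right_deriv_mono:
  assumes "convex_on UNIV G" "a \<le> b"
  shows "right_deriv G a \<le> right_deriv G b"
  using right_deriv_slope[OF assms(1), of a b] assms(2) by (cases "a = b") auto

lemma convex_on_UNIV_continuous:
  fixes G :: "real \<Rightarrow> real"
  assumes "convex_on UNIV G"
  shows "continuous_on A G"
  using convex_on_continuous[OF open_UNIV assms] by (rule continuous_on_subset) simp

lemma slope_commute: "(G k - G t) / (k - t) = (G t - G k) / (t - (k :: real))" for G :: "real \<Rightarrow> real"
  by (metis minus_diff_eq minus_divide_divide)

lemma right_deriv_right_continuous:
  assumes G: "convex_on UNIV G"
  shows "continuous (at_right k) (right_deriv G)"
  unfolding continuous_within
proof (rule order_tendstoI)
  fix e assume e: "e < right_deriv G k"
  have "eventually (\<lambda>x. k < x) (at_right k)" by (simp add: eventually_at_filter)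
  then show "\<forall>\<^sub>F x in at_right k. e < right_deriv G x"
    by eventually_elim (use e right_deriv_mono[OF G] in \<open>force intro: less_le_trans\<close>)
next
  fix e assume e: "right_deriv G k < e"
  have bdd: "bdd_below ((\<lambda>t. (G k - G t) / (k - t)) ` {k<..})"
    by (rule bdd_belowI2[of _ "right_deriv G k"])
       (use right_deriv_slope(1)[OF G, of k] in \<open>simp add: slope_commute[of G k]\<close>)
  obtain t where t: "k < t" "(G k - G t) / (k - t) < e"
    using e cINF_less_iff[OF _ bdd, of e] by (auto simp: right_deriv_def)
  have "isCont G k"
    using convex_on_UNIV_continuous[OF G, of UNIV] by (simp add: continuous_on_eq_continuous_at)
  then have "((\<lambda>x. (G x - G t) / (x - t)) \<longlongrightarrow> (G k - G t) / (k - t)) (at_right k)"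
    using t by (intro tendsto_intros) (auto simp: isCont_def intro: tendsto_mono at_le)
  then have "\<forall>\<^sub>F x in at_right k. (G x - G t) / (x - t) < e"
    using t by (auto dest: order_tendstoD)
  moreover have "eventually (\<lambda>x. x < t) (at_right k)"
    using t by (auto simp: eventually_at_right)
  ultimately show "\<forall>\<^sub>F x in at_right k. right_deriv G x < e"
  proof eventually_elim
    case (elim x)
    then show ?case using right_deriv_slope(1)[OF G, of x t] by (simp add: slope_commute[of G x])
  qed
qed

lemma right_deriv_at_bot:
  assumes G: "convex_on UNIV G" and lim: "(G \<longlongrightarrow> 0) at_bot"
  shows "(right_deriv G \<longlongrightarrow> 0) at_bot"
proof -
  have far: "((\<lambda>a. (G b - G a) / (b - a)) \<longlongrightarrow> 0) at_bot" for b
  proof -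
    have "filterlim (\<lambda>a. b + - a) at_top at_bot"
      by (intro filterlim_tendsto_add_at_top[OF tendsto_const] filterlim_uminus_at_top_at_bot)
    then have "((\<lambda>a. inverse (b - a)) \<longlongrightarrow> 0) at_bot"
      by (simp add: tendsto_inverse_0_at_top)
    then have "((\<lambda>a. (G b - G a) * inverse (b - a)) \<longlongrightarrow> (G b - 0) * 0) at_bot"
      by (intro tendsto_mult tendsto_diff tendsto_const lim)
    then show ?thesis by (simp add: divide_inverse)
  qed
  have "0 \<le> right_deriv G b" for b
  proof (rule tendsto_upperbound[OF far])
    show "\<forall>\<^sub>F a in at_bot. (G b - G a) / (b - a) \<le> right_deriv G b"
      using eventually_gt_at_bot[of b] by eventually_elim (rule right_deriv_slope(2)[OF G])
  qed simp
  moreover have "\<forall>\<^sub>F a in at_bot. right_deriv G a \<le> (G 0 - G a) / (0 - a)"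
    using eventually_gt_at_bot[of 0] by eventually_elim (rule right_deriv_slope(1)[OF G])
  ultimately show ?thesis
    by (intro tendsto_sandwich[OF _ _ tendsto_const far[of 0]]) auto
qed

lemma right_deriv_at_top:
  assumes G: "convex_on UNIV G" and bnd: "\<And>k. 0 \<le> k \<Longrightarrow> \<bar>G k - m * k\<bar> \<le> B"
  shows "(right_deriv G \<longlongrightarrow> m) at_top"
proof -
  have inv: "((\<lambda>c. 2 * B / (c - b)) \<longlongrightarrow> 0) at_top" for b :: real
    by (intro tendsto_divide_0[OF tendsto_const] filterlim_at_top_imp_at_infinity)
       (use filterlim_tendsto_add_at_top[OF tendsto_const[of "- b"] filterlim_ident] in simp)
  have slope: "\<bar>(G c - G b) / (c - b) - m\<bar> \<le> 2 * B / (c - b)" if "0 \<le> b" "b < c" for b c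
  proof -
    have "\<bar>(G c - m * c) - (G b - m * b)\<bar> \<le> 2 * B" using bnd[of b] bnd[of c] that by linarith
    moreover have "(G c - G b) / (c - b) - m = ((G c - m * c) - (G b - m * b)) / (c - b)"
      using that by (simp add: field_simps)
    ultimately show ?thesis using that by (simp add: abs_divide divide_right_mono)
  qed
  have "right_deriv G b \<le> m" if "0 \<le> b" for b
  proof -
    have "((\<lambda>c. m + 2 * B / (c - b)) \<longlongrightarrow> m + 0) at_top"
      by (intro tendsto_intros inv)
    moreover have "\<forall>\<^sub>F c in at_top. right_deriv G b \<le> m + 2 * B / (c - b)"
      using eventually_gt_at_top[of b]
    proof eventually_elim
      case (elim c)
      then show ?case using slope[OF that elim] right_deriv_slope(1)[OF G elim] by linarith
    qed
    ultimately show ?thesis by (auto dest: tendsto_lowerbound)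
  qed
  then have upper: "\<forall>\<^sub>F b in at_top. right_deriv G b \<le> m"
    by (rule eventually_at_top_linorderI)
  have lower: "\<forall>\<^sub>F b in at_top. m - 2 * B / (b - 0) \<le> right_deriv G b"
    using eventually_gt_at_top[of 0]
  proof eventually_elim
    case (elim b)
    then show ?case using slope[of 0 b] right_deriv_slope(2)[OF G elim] by (simp add: abs_le_iff)
  qed
  have "((\<lambda>b. m - 2 * B / (b - 0)) \<longlongrightarrow> m - 0) at_top" by (intro tendsto_intros inv)
  then show ?thesis
    by (intro tendsto_sandwich[OF lower upper]) auto
qed

text \<open>A negative slope anywhere would force a convex function to infinity on the left.\<close>

lemma convex_nondecreasing:
  fixes G :: "real \<Rightarrow> real"
  assumes G: "convex_on UNIV G" and bnd: "\<And>k. k \<le> 0 \<Longrightarrow> G k \<le> B" and ab: "a \<le> b"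
  shows "G a \<le> G b"
proof (cases "a = b")
  case False
  with ab have ab: "a < b" by simp
  have slopes: "(G a - G t) / (a - t) \<le> (G b - G a) / (b - a)" if "t < a" for t
    using convex_on_three_pointD[OF G, of t a b] that ab by (subst slope_le_slope_iff(1)) auto
  have far: "(G a - B) / (a - t) \<le> (G b - G a) / (b - a)" if t: "t < min 0 a" for t
  proof -
    have "(G a - B) / (a - t) \<le> (G a - G t) / (a - t)"
      using t bnd[of t] by (intro divide_right_mono) auto
    also have "\<dots> \<le> (G b - G a) / (b - a)" using slopes[of t] t by simp
    finally show ?thesis .
  qed
  have "\<forall>\<^sub>F t in at_bot. (G a - B) / (a - t) \<le> (G b - G a) / (b - a)"
    using eventually_gt_at_bot[of "min 0 a"] by eventually_elim (rule far)
  moreover have "((\<lambda>t. (G a - B) / (a - t)) \<longlongrightarrow> 0) at_bot"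
  proof -
    have "filterlim (\<lambda>t. a + - t) at_top at_bot"
      by (intro filterlim_tendsto_add_at_top[OF tendsto_const] filterlim_uminus_at_top_at_bot)
    then have "((\<lambda>t. inverse (a - t)) \<longlongrightarrow> 0) at_bot" by (simp add: tendsto_inverse_0_at_top)
    then have "((\<lambda>t. (G a - B) * inverse (a - t)) \<longlongrightarrow> (G a - B) * 0) at_bot"
      by (intro tendsto_mult tendsto_const)
    then show ?thesis by (simp add: divide_inverse)
  qed
  ultimately have "0 \<le> (G b - G a) / (b - a)"
    using tendsto_upperbound trivial_limit_at_bot_linorder by blast
  then show ?thesis using ab by (simp add: zero_le_divide_iff)
qed simp

text \<open>A version of the fundamental theorem of calculus for \<open>D\<close> that need not be continuous.  Over an interval of
length \<open>d\<close> the difference \<open>P - G\<close> changes by at most \<open>d\<close> times the increase of \<open>D\<close>; over \<open>n\<close> equal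
pieces these bounds add up to \<open>1/n\<close> of the bound for the whole interval.\<close>

lemma constant_difference_if_common_slope_bounds:
  fixes P G D :: "real \<Rightarrow> real"
  assumes P: "\<And>a b. a < b \<Longrightarrow> D a \<le> (P b - P a) / (b - a) \<and> (P b - P a) / (b - a) \<le> D b"
    and G: "\<And>a b. a < b \<Longrightarrow> D a \<le> (G b - G a) / (b - a) \<and> (G b - G a) / (b - a) \<le> D b"
  shows "P a - G a = P b - G b"
proof -
  define \<Phi> where "\<Phi> k = P k - G k" for k
  have step: "\<bar>\<Phi> b - \<Phi> a\<bar> \<le> (D b - D a) * (b - a)" if "a < b" for a b
  proof -
    have "\<bar>(P b - P a) / (b - a) - (G b - G a) / (b - a)\<bar> \<le> D b - D a"
      using P[OF that] G[OF that] by linarith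
    moreover have "(P b - P a) / (b - a) - (G b - G a) / (b - a) = (\<Phi> b - \<Phi> a) / (b - a)"
      by (simp add: \<Phi>_def diff_divide_distrib)
    ultimately show ?thesis using that by (simp add: abs_divide field_simps)
  qed
  have "\<Phi> a = \<Phi> b" if ab: "a < b" for a b
  proof -
    have bound: "\<bar>\<Phi> b - \<Phi> a\<bar> \<le> (D b - D a) * (b - a) * inverse (real (Suc n))" for n
    proof -
      define t where "t i = a + real i * ((b - a) / real (Suc n))" for i
      have t0: "t 0 = a" and tn: "t (Suc n) = b" by (auto simp: t_def)
      have ts: "t (Suc i) - t i = (b - a) / real (Suc n)" for i
        unfolding t_def by (simp only: of_nat_Suc distrib_right)
      have t_less: "t i < t (Suc i)" for i
      proof -
        have "0 < (b - a) / real (Suc n)" using ab by simp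
        then show ?thesis using ts[of i] by linarith
      qed
      have "\<Phi> b - \<Phi> a = (\<Sum>i<Suc n. \<Phi> (t (Suc i)) - \<Phi> (t i))"
        by (simp only: sum_lessThan_telescope[of "\<lambda>i. \<Phi> (t i)"] t0 tn)
      also have "\<bar>\<dots>\<bar> \<le> (\<Sum>i<Suc n. \<bar>\<Phi> (t (Suc i)) - \<Phi> (t i)\<bar>)" by (rule sum_abs)
      also have "\<dots> \<le> (\<Sum>i<Suc n. (D (t (Suc i)) - D (t i)) * ((b - a) / real (Suc n)))"
        using step[OF t_less] unfolding ts by (rule sum_mono)
      also have "\<dots> = (D b - D a) * ((b - a) / real (Suc n))"
        by (simp only: sum_lessThan_telescope[of "\<lambda>i. D (t i)"] t0 tn flip: sum_distrib_right)
      finally show ?thesis by (simp add: divide_inverse)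
    qed
    have "(\<lambda>n. (D b - D a) * (b - a) * inverse (real (Suc n))) \<longlonglongrightarrow> (D b - D a) * (b - a) * 0"
      by (intro tendsto_intros LIMSEQ_inverse_real_of_nat)
    then have "\<bar>\<Phi> b - \<Phi> a\<bar> \<le> 0"
      using bound by (intro LIMSEQ_le_const[of _ 0]) auto
    then show ?thesis by simp
  qed
  then have "\<Phi> a = \<Phi> b" by (metis linorder_neqE)
  then show ?thesis by (simp add: \<Phi>_def)
qed

section \<open>Put and call functions\<close>

definition mean :: "real measure \<Rightarrow> real" where
  "mean \<eta> = (\<integral>x. x \<partial>\<eta>)"

definition call_fun :: "real measure \<Rightarrow> real \<Rightarrow> real" where
  "call_fun \<eta> k = (\<integral>x. max 0 (x - k) \<partial>\<eta>)"

lemma meas1_finite_measure: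
  assumes "\<eta> \<in> meas1"
  shows "finite_measure \<eta>" "sets \<eta> = sets borel" "space \<eta> = UNIV" "finite_borel_measure \<eta>"
proof -
  show s: "sets \<eta> = sets borel" using assms by (simp add: meas1_def)
  show sp: "space \<eta> = UNIV" using sets_eq_imp_space_eq[OF s] by simp
  show f: "finite_measure \<eta>"
    by (rule finite_measureI) (use assms in \<open>simp add: meas1_def sp less_top\<close>)
  show "finite_borel_measure \<eta>"
    using f s by (simp add: finite_borel_measure_def finite_borel_measure_axioms_def)
qed

lemma meas1_integrable_id:
  assumes "\<eta> \<in> meas1"
  shows "integrable \<eta> (\<lambda>x. x)"
proof (rule integrableI_bounded)
  show "(\<lambda>x. x) \<in> borel_measurable \<eta>"
    using meas1_finite_measure(2)[OF assms] by (simp cong: measurable_cong_sets)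
  show "(\<integral>\<^sup>+ x. ennreal (norm x) \<partial>\<eta>) < \<infinity>" using assms by (simp add: meas1_def)
qed

lemma meas1_integrable:
  assumes \<eta>: "\<eta> \<in> meas1" and [measurable]: "g \<in> borel_measurable borel"
    and bound: "\<And>x. \<bar>g x\<bar> \<le> A + B * \<bar>x\<bar>"
  shows "integrable \<eta> g"
proof -
  interpret finite_measure \<eta> by (rule meas1_finite_measure[OF \<eta>])
  have "integrable \<eta> (\<lambda>x. A + B * \<bar>x\<bar>)"
    using integrable_abs[OF meas1_integrable_id[OF \<eta>]] by simp
  then show ?thesis
  proof (rule Bochner_Integration.integrable_bound)
    show "g \<in> borel_measurable \<eta>"
      using meas1_finite_measure(2)[OF \<eta>] by (simp cong: measurable_cong_sets)
    show "AE x in \<eta>. norm (g x) \<le> norm (A + B * \<bar>x\<bar>)"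
      using bound by (intro always_eventually) (fastforce intro: order_trans[OF _ abs_ge_self])
  qed
qed

lemma integrable_put: "\<eta> \<in> meas1 \<Longrightarrow> integrable \<eta> (\<lambda>x. max 0 (k - x))"
  by (rule meas1_integrable[of _ _ "\<bar>k\<bar>" 1]) auto

lemma integrable_call: "\<eta> \<in> meas1 \<Longrightarrow> integrable \<eta> (\<lambda>x. max 0 (x - k))"
  by (rule meas1_integrable[of _ _ "\<bar>k\<bar>" 1]) auto

lemma integrable_abs_meas1: "\<eta> \<in> meas1 \<Longrightarrow> integrable \<eta> (\<lambda>x. \<bar>x\<bar>)"
  by (rule meas1_integrable[of _ _ 0 1]) auto

lemma meas1_integrable_const:
  "\<eta> \<in> meas1 \<Longrightarrow> integrable \<eta> (\<lambda>x. c)" for c :: real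
  by (rule meas1_integrable[of _ _ "\<bar>c\<bar>" 0]) auto

lemma put_fun_nonneg: "0 \<le> put_fun \<eta> k"
  by (simp add: put_fun_def)

lemma put_call_parity:
  assumes "\<eta> \<in> meas1"
  shows "call_fun \<eta> k = put_fun \<eta> k + mean \<eta> - k * measure \<eta> UNIV"
proof -
  note [simp] = meas1_finite_measure(3)[OF assms]
  have "call_fun \<eta> k = (\<integral>x. max 0 (k - x) + (x - k) \<partial>\<eta>)"
    unfolding call_fun_def by (rule Bochner_Integration.integral_cong) auto
  also have "\<dots> = put_fun \<eta> k + (mean \<eta> - (\<integral>x. k \<partial>\<eta>))"
    using integrable_put[OF assms] meas1_integrable_id[OF assms] meas1_integrable_const[OF assms, of k]
    by (simp add: put_fun_def mean_def)
  finally show ?thesis by simp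
qed

text \<open>These bounds, with right continuity, say that the distribution function is the right derivative of the put
function.\<close>

lemma put_fun_slope:
  assumes \<eta>: "\<eta> \<in> meas1" and ab: "a < b"
  shows "cdf \<eta> a \<le> (put_fun \<eta> b - put_fun \<eta> a) / (b - a)"
    and "(put_fun \<eta> b - put_fun \<eta> a) / (b - a) \<le> cdf \<eta> b"
proof -
  interpret finite_measure \<eta> by (rule meas1_finite_measure[OF \<eta>])
  have sets: "{..k} \<in> sets \<eta>" for k using meas1_finite_measure(2)[OF \<eta>] by simp
  have ind: "integrable \<eta> (\<lambda>x. (b - a) * indicator {..k} x)" for k :: real
    using sets by (intro integrable_mult_right) (simp add: integrable_indicator_iff less_top[symmetric])
  have ind_eq: "(\<integral>x. (b - a) * indicator {..k} x \<partial>\<eta>) = (b - a) * cdf \<eta> k" for k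
    using sets meas1_finite_measure(3)[OF \<eta>] by (simp add: cdf_def)
  have diff: "put_fun \<eta> b - put_fun \<eta> a = (\<integral>x. max 0 (b - x) - max 0 (a - x) \<partial>\<eta>)"
    using integrable_put[OF \<eta>] by (simp add: put_fun_def)
  have "(b - a) * cdf \<eta> a \<le> put_fun \<eta> b - put_fun \<eta> a"
    unfolding diff ind_eq[symmetric] using ab integrable_put[OF \<eta>] ind
    by (intro integral_mono Bochner_Integration.integrable_diff) (auto split: split_indicator)
  then show "cdf \<eta> a \<le> (put_fun \<eta> b - put_fun \<eta> a) / (b - a)"
    using ab by (simp add: pos_le_divide_eq mult.commute)
  have "put_fun \<eta> b - put_fun \<eta> a \<le> (b - a) * cdf \<eta> b"
    unfolding diff ind_eq[symmetric] using ab integrable_put[OF \<eta>] ind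
    by (intro integral_mono Bochner_Integration.integrable_diff) (auto split: split_indicator)
  then show "(put_fun \<eta> b - put_fun \<eta> a) / (b - a) \<le> cdf \<eta> b"
    using ab by (simp add: pos_divide_le_eq mult.commute)
qed

lemma right_continuous_le_if_le_right:
  fixes F :: "real \<Rightarrow> real"
  assumes F: "continuous (at_right a) F" and le: "\<And>b. a < b \<Longrightarrow> c \<le> F b"
  shows "c \<le> F a"
proof (rule tendsto_lowerbound)
  show "(F \<longlongrightarrow> F a) (at_right a)" using F by (simp add: continuous_within)
  show "\<forall>\<^sub>F x in at_right a. c \<le> F x"
    using le by (auto simp: eventually_at_filter)
qed simp

text \<open>By the slope bounds each distribution function at \<open>a\<close> is below the other one at every \<open>b > a\<close>; let \<open>b\<close>
decrease to \<open>a\<close>.\<close>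

lemma put_fun_inject:
  assumes \<eta>: "\<eta> \<in> meas1" and \<zeta>: "\<zeta> \<in> meas1" and eq: "\<And>k. put_fun \<eta> k = put_fun \<zeta> k"
  shows "\<eta> = \<zeta>"
proof (rule cdf_unique')
  show fin: "finite_borel_measure \<eta>" "finite_borel_measure \<zeta>"
    using meas1_finite_measure[OF \<eta>] meas1_finite_measure[OF \<zeta>] by auto
  show "cdf \<eta> = cdf \<zeta>"
  proof (rule ext, rule antisym)
    fix a
    have "cdf \<eta> a \<le> cdf \<zeta> b" "cdf \<zeta> a \<le> cdf \<eta> b" if "a < b" for b
      using put_fun_slope[OF \<eta> that] put_fun_slope[OF \<zeta> that] by (auto simp: eq)
    then show "cdf \<eta> a \<le> cdf \<zeta> a" "cdf \<zeta> a \<le> cdf \<eta> a"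
      using right_continuous_le_if_le_right finite_borel_measure.cdf_is_right_cont fin by blast+
  qed
qed

text \<open>The difference is the put function of the positive measure \<open>\<eta> - \<theta>\<close>.  In place of that measure,
the convexity defect is written as the integral of a nonnegative function \<open>g\<close>, which is monotone in the measure.\<close>

lemma convex_on_put_fun_diff:
  assumes \<eta>: "\<eta> \<in> meas1" and \<theta>: "\<theta> \<in> meas1"
    and le: "\<And>A. A \<in> sets borel \<Longrightarrow> emeasure \<theta> A \<le> emeasure \<eta> A"
  shows "convex_on UNIV (\<lambda>k. put_fun \<eta> k - put_fun \<theta> k)"
proof (rule convex_on_three_pointI)
  fix a b c :: real assume ab: "a < b" and bc: "b < c"
  define g where "g x = (c - b) * max 0 (a - x) + (b - a) * max 0 (c - x) - (c - a) * max 0 (b - x)" for x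
  have g_nonneg: "0 \<le> g x" for x
  proof -
    have "(b - a) * (c - x) - (c - a) * (b - x) = (c - b) * (x - a)" by (simp add: algebra_simps)
    moreover have "(c - b) * (a - x) + (b - a) * (c - x) = (c - a) * (b - x)" by (simp add: algebra_simps)
    moreover have "0 \<le> (c - b) * (x - a)" if "a \<le> x" using bc that by simp
    moreover have "0 \<le> (b - a) * (c - x)" if "x \<le> c" using ab that by simp
    ultimately show ?thesis using ab bc unfolding g_def max_def by (auto simp del: mult_nonneg_nonneg)
  qed
  have int: "integrable \<zeta> g" and int_eq: "(\<integral>x. g x \<partial>\<zeta>)
      = (c - b) * put_fun \<zeta> a + (b - a) * put_fun \<zeta> c - (c - a) * put_fun \<zeta> b" if "\<zeta> \<in> meas1" for \<zeta>
    unfolding g_def put_fun_def using integrable_put[OF that] by simp_all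
  have "\<theta> \<le> \<eta>"
    using le meas1_finite_measure[OF \<eta>] meas1_finite_measure[OF \<theta>]
    by (simp add: le_measure)
  then have "(\<integral>\<^sup>+x. g x \<partial>\<theta>) \<le> (\<integral>\<^sup>+x. g x \<partial>\<eta>)"
    using meas1_finite_measure[OF \<eta>] meas1_finite_measure[OF \<theta>] by (intro nn_integral_mono_measure) auto
  then have "(\<integral>x. g x \<partial>\<theta>) \<le> (\<integral>x. g x \<partial>\<eta>)"
    using int[OF \<eta>] int[OF \<theta>] g_nonneg by (simp add: nn_integral_eq_integral integral_nonneg)
  then show "(c - a) * (put_fun \<eta> b - put_fun \<theta> b)
      \<le> (c - b) * (put_fun \<eta> a - put_fun \<theta> a) + (b - a) * (put_fun \<eta> c - put_fun \<theta> c)"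
    unfolding int_eq[OF \<eta>] int_eq[OF \<theta>] by (simp add: algebra_simps)
qed

lemma null_measure_meas1: "null_measure borel \<in> meas1"
  by (simp add: meas1_def)

lemma convex_on_put_fun:
  assumes "\<eta> \<in> meas1"
  shows "convex_on UNIV (put_fun \<eta>)"
  using convex_on_put_fun_diff[OF assms null_measure_meas1]
  by (simp add: put_fun_def[of "null_measure borel"])

lemma put_fun_at_bot:
  assumes \<eta>: "\<eta> \<in> meas1"
  shows "(put_fun \<eta> \<longlongrightarrow> 0) at_bot"
proof -
  note [measurable_cong] = meas1_finite_measure(2)[OF \<eta>]
  have "((\<lambda>t. put_fun \<eta> (- t)) \<longlongrightarrow> (\<integral>x. 0 \<partial>\<eta>)) at_top"
    unfolding put_fun_def
  proof (rule integral_dominated_convergence_at_top)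
    show "integrable \<eta> (\<lambda>x. \<bar>x\<bar>)" by (rule integrable_abs_meas1[OF \<eta>])
    show "\<forall>\<^sub>F t in at_top. AE x in \<eta>. norm (max 0 (- t - x)) \<le> \<bar>x\<bar>"
      using eventually_ge_at_top[of 0] by eventually_elim (auto intro!: always_eventually)
    show "AE x in \<eta>. ((\<lambda>t. max 0 (- t - x)) \<longlongrightarrow> 0) at_top"
    proof (rule always_eventually, rule allI, rule tendsto_eventually)
      fix x :: real
      show "\<forall>\<^sub>F t in at_top. max 0 (- t - x) = 0"
        using eventually_ge_at_top[of "- x"] by eventually_elim auto
    qed
  qed measurable
  then show ?thesis by (simp add: filterlim_at_bot_mirror)
qed

lemma call_fun_at_top:
  assumes \<eta>: "\<eta> \<in> meas1"
  shows "(call_fun \<eta> \<longlongrightarrow> 0) at_top"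
proof -
  note [measurable_cong] = meas1_finite_measure(2)[OF \<eta>]
  have "((\<lambda>t. call_fun \<eta> t) \<longlongrightarrow> (\<integral>x. 0 \<partial>\<eta>)) at_top"
    unfolding call_fun_def
  proof (rule integral_dominated_convergence_at_top)
    show "integrable \<eta> (\<lambda>x. \<bar>x\<bar>)" by (rule integrable_abs_meas1[OF \<eta>])
    show "\<forall>\<^sub>F t in at_top. AE x in \<eta>. norm (max 0 (x - t)) \<le> \<bar>x\<bar>"
      using eventually_ge_at_top[of 0] by eventually_elim (auto intro!: always_eventually)
    show "AE x in \<eta>. ((\<lambda>t. max 0 (x - t)) \<longlongrightarrow> 0) at_top"
    proof (rule always_eventually, rule allI, rule tendsto_eventually)
      fix x :: real
      show "\<forall>\<^sub>F t in at_top. max 0 (x - t) = 0"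
        using eventually_ge_at_top[of x] by eventually_elim auto
    qed
  qed measurable
  then show ?thesis by simp
qed

lemma put_fun_bounds:
  assumes \<eta>: "\<eta> \<in> meas1"
  defines "B \<equiv> \<integral>x. \<bar>x\<bar> \<partial>\<eta>"
  shows "0 \<le> B" "\<bar>mean \<eta>\<bar> \<le> B" "k * measure \<eta> UNIV - mean \<eta> \<le> put_fun \<eta> k"
    "k \<le> 0 \<Longrightarrow> put_fun \<eta> k \<le> B" "0 \<le> k \<Longrightarrow> put_fun \<eta> k \<le> k * measure \<eta> UNIV + B"
proof -
  note abs = integrable_abs_meas1[OF \<eta>] and const = meas1_integrable_const[OF \<eta>]
  show "0 \<le> B" by (simp add: B_def)
  show "\<bar>mean \<eta>\<bar> \<le> B" using integral_norm_bound[of \<eta> "\<lambda>x. x"] by (simp add: B_def mean_def)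
  have "0 \<le> call_fun \<eta> k" by (simp add: call_fun_def)
  then show "k * measure \<eta> UNIV - mean \<eta> \<le> put_fun \<eta> k"
    using put_call_parity[OF \<eta>, of k] by simp
  show "put_fun \<eta> k \<le> B" if "k \<le> 0"
    unfolding put_fun_def B_def using that by (intro integral_mono integrable_put \<eta> abs) auto
  show "put_fun \<eta> k \<le> k * measure \<eta> UNIV + B" if "0 \<le> k"
  proof -
    have "put_fun \<eta> k \<le> (\<integral>x. k + \<bar>x\<bar> \<partial>\<eta>)"
      unfolding put_fun_def using that
      by (intro integral_mono integrable_put \<eta> Bochner_Integration.integrable_add abs const) auto
    then show ?thesis
      using abs const[of k] meas1_finite_measure(3)[OF \<eta>] by (simp add: B_def mult.commute)
  qed
qed

section \<open>Existence of the shadow\<close>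

lemma sum_of_measures:
  fixes M N :: "real measure"
  assumes "sets M = sets borel" "sets N = sets borel"
  obtains S where "sets S = sets borel" "\<And>A. A \<in> sets borel \<Longrightarrow> emeasure S A = emeasure M A + emeasure N A"
proof -
  define S where "S = measure_of UNIV (sets borel) (\<lambda>A. emeasure M A + emeasure N A)"
  have sets: "sets S = sets borel"
    unfolding S_def using sets.sets_measure_of_eq[of "borel :: real measure"] by simp
  have "emeasure S A = emeasure M A + emeasure N A" if A: "A \<in> sets borel" for A
    unfolding S_def
  proof (rule emeasure_measure_of_sigma[OF _ _ _ A])
    show "sigma_algebra UNIV (sets (borel :: real measure))"
      using sets.sigma_algebra_axioms[of "borel :: real measure"] by simp
    show "positive (sets (borel :: real measure)) (\<lambda>A. emeasure M A + emeasure N A)"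
      by (simp add: positive_def)
    show "countably_additive (sets (borel :: real measure)) (\<lambda>A. emeasure M A + emeasure N A)"
    proof (rule countably_additiveI)
      fix F :: "nat \<Rightarrow> real set"
      assume F: "range F \<subseteq> sets borel" "disjoint_family F"
      have "(\<Sum>i. emeasure M (F i) + emeasure N (F i)) = (\<Sum>i. emeasure M (F i)) + (\<Sum>i. emeasure N (F i))"
        by (intro suminf_add[symmetric]) auto
      also have "\<dots> = emeasure M (\<Union> (range F)) + emeasure N (\<Union> (range F))"
        using F assms by (simp add: suminf_emeasure)
      finally show "(\<Sum>i. emeasure M (F i) + emeasure N (F i))
          = emeasure M (\<Union> (range F)) + emeasure N (\<Union> (range F))" .
    qed
  qed
  with sets show ?thesis by (rule that)
qed

text \<open>The right derivatives of \<open>G\<close> and \<open>H\<close> are distribution functions of finite measures \<open>\<theta>\<close> and \<open>\<rho>\<close>.  Their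
sum has the distribution function of \<open>\<nu>\<close>, since both are squeezed between the difference quotients of
\<open>P\<^sub>\<nu>\<close>.  So \<open>\<theta> \<le> \<nu>\<close>, from which \<open>\<theta>\<close> inherits a finite first moment, and only then does it make sense to
compare its put function with \<open>G\<close>.\<close>

lemma submeasure_of_put_decomposition:
  fixes G H :: "real \<Rightarrow> real"
  assumes \<nu>: "\<nu> \<in> meas1"
    and G: "convex_on UNIV G" "(G \<longlongrightarrow> 0) at_bot" "\<And>k. 0 \<le> k \<Longrightarrow> \<bar>G k - m * k\<bar> \<le> A"
    and H: "convex_on UNIV H" "(H \<longlongrightarrow> 0) at_bot" "\<And>k. 0 \<le> k \<Longrightarrow> \<bar>H k - l * k\<bar> \<le> B"
    and sum: "\<And>k. put_fun \<nu> k = G k + H k" and m: "0 \<le> m" and l: "0 \<le> l"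
  obtains \<theta> where "\<theta> \<in> meas1" "emeasure \<theta> UNIV = ennreal m" "\<And>k. put_fun \<theta> k = G k"
    "\<And>A. A \<in> sets borel \<Longrightarrow> emeasure \<theta> A \<le> emeasure \<nu> A"
proof -
  define \<theta> \<rho> where "\<theta> = interval_measure (right_deriv G)" and "\<rho> = interval_measure (right_deriv H)"
  note G' = right_deriv_mono[OF G(1)] right_deriv_right_continuous[OF G(1)] right_deriv_at_bot[OF G(1,2)]
  note H' = right_deriv_mono[OF H(1)] right_deriv_right_continuous[OF H(1)] right_deriv_at_bot[OF H(1,2)]
  have G_top: "(right_deriv G \<longlongrightarrow> m) at_top" by (rule right_deriv_at_top[OF G(1,3)])
  have H_top: "(right_deriv H \<longlongrightarrow> l) at_top" by (rule right_deriv_at_top[OF H(1,3)])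
  have cdf_\<theta>: "cdf \<theta> = right_deriv G" unfolding \<theta>_def by (rule cdf_interval_measure[OF G'])
  have cdf_\<rho>: "cdf \<rho> = right_deriv H" unfolding \<rho>_def by (rule cdf_interval_measure[OF H'])
  have fin_\<theta>: "finite_borel_measure \<theta>" and mass: "emeasure \<theta> UNIV = ennreal m"
    unfolding \<theta>_def using finite_borel_measure_interval_measure[OF G' G_top m] interval_measure_UNIV[OF G' G_top m] by auto
  have fin_\<rho>: "finite_borel_measure \<rho>" and mass_\<rho>: "emeasure \<rho> UNIV = ennreal l"
    unfolding \<rho>_def using finite_borel_measure_interval_measure[OF H' H_top l] interval_measure_UNIV[OF H' H_top l] by auto
  have sets: "sets \<theta> = sets borel" "sets \<rho> = sets borel" by (auto simp: \<theta>_def \<rho>_def)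
  obtain S where S: "sets S = sets borel"
    "\<And>A. A \<in> sets borel \<Longrightarrow> emeasure S A = emeasure \<theta> A + emeasure \<rho> A"
    using sum_of_measures[OF sets] by blast
  have spS: "space S = UNIV" using sets_eq_imp_space_eq[OF S(1)] by simp
  have fin_S: "finite_borel_measure S"
    unfolding finite_borel_measure_def finite_borel_measure_axioms_def
    by (auto intro!: finite_measureI simp: S spS mass mass_\<rho>)
  interpret \<theta>: finite_borel_measure \<theta> by (rule fin_\<theta>)
  interpret \<rho>: finite_borel_measure \<rho> by (rule fin_\<rho>)
  have cdf_S: "cdf S k = right_deriv G k + right_deriv H k" for k
    by (simp add: cdf_\<theta>[symmetric] cdf_\<rho>[symmetric] cdf_def measure_def[of S] S(2)
        \<theta>.emeasure_eq_measure \<rho>.emeasure_eq_measure flip: ennreal_plus)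
  \<comment> \<open>Both distribution functions at \<open>a\<close> are below a difference quotient of \<open>P\<^sub>\<nu>\<close> over \<open>[a, b]\<close>
    that is below the other distribution function at \<open>b\<close>.\<close>
  have "S = \<nu>"
  proof (rule cdf_unique'[OF fin_S])
    show fin_\<nu>: "finite_borel_measure \<nu>" by (rule meas1_finite_measure[OF \<nu>])
    show "cdf S = cdf \<nu>"
    proof (rule ext, rule antisym)
      fix a
      have slopes: "cdf S a \<le> (put_fun \<nu> b - put_fun \<nu> a) / (b - a)"
        "(put_fun \<nu> b - put_fun \<nu> a) / (b - a) \<le> cdf S b" if "a < b" for b
      proof -
        have "(put_fun \<nu> b - put_fun \<nu> a) / (b - a) = (G b - G a) / (b - a) + (H b - H a) / (b - a)"
          by (simp add: sum add_divide_distrib[symmetric])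
        then show "cdf S a \<le> (put_fun \<nu> b - put_fun \<nu> a) / (b - a)"
          "(put_fun \<nu> b - put_fun \<nu> a) / (b - a) \<le> cdf S b"
          using right_deriv_slope[OF G(1) that] right_deriv_slope[OF H(1) that] by (auto simp: cdf_S)
      qed
      have "cdf S a \<le> cdf \<nu> b" "cdf \<nu> a \<le> cdf S b" if "a < b" for b
        using put_fun_slope[OF \<nu> that] slopes[OF that] by linarith+
      then show "cdf S a \<le> cdf \<nu> a" "cdf \<nu> a \<le> cdf S a"
        using right_continuous_le_if_le_right finite_borel_measure.cdf_is_right_cont fin_S fin_\<nu> by blast+
    qed
  qed
  then have le: "emeasure \<theta> A \<le> emeasure \<nu> A" if "A \<in> sets borel" for A
    using S(2)[OF that] by simp
  have "\<theta> \<le> \<nu>" using le sets meas1_finite_measure(2)[OF \<nu>] by (simp add: le_measure)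
  then have "(\<integral>\<^sup>+ x. ennreal \<bar>x\<bar> \<partial>\<theta>) \<le> (\<integral>\<^sup>+ x. ennreal \<bar>x\<bar> \<partial>\<nu>)"
    using sets meas1_finite_measure(2)[OF \<nu>] by (intro nn_integral_mono_measure) auto
  also have "\<dots> < \<infinity>" using \<nu> by (simp add: meas1_def)
  finally have \<theta>: "\<theta> \<in> meas1" using sets mass by (simp add: meas1_def)
  have "put_fun \<theta> k = G k" for k
  proof -
    have const: "put_fun \<theta> a - G a = put_fun \<theta> b - G b" for a b
      by (rule constant_difference_if_common_slope_bounds[where D = "right_deriv G"])
         (use right_deriv_slope[OF G(1)] put_fun_slope[OF \<theta>] in \<open>auto simp: cdf_\<theta>\<close>)
    have "((\<lambda>b. put_fun \<theta> b - G b) \<longlongrightarrow> 0 - 0) at_bot"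
      by (intro tendsto_diff put_fun_at_bot \<theta> G(2))
    moreover have "(\<lambda>b. put_fun \<theta> b - G b) = (\<lambda>b. put_fun \<theta> k - G k)" using const by blast
    ultimately show ?thesis by (simp add: tendsto_const_iff)
  qed
  with \<theta> mass le show ?thesis by (intro that) auto
qed

lemma measure_meas1:
  assumes "\<eta> \<in> meas1"
  shows "emeasure \<eta> UNIV = ennreal (measure \<eta> UNIV)"
  using meas1_finite_measure(1)[OF assms] by (simp add: finite_measure.emeasure_eq_measure)

context
  fixes \<mu> \<nu> :: "real measure"
  assumes \<mu>: "\<mu> \<in> meas1" and \<nu>: "\<nu> \<in> meas1" and mass_le: "emeasure \<mu> UNIV \<le> emeasure \<nu> UNIV"
begin

lemma measure_le: "measure \<mu> UNIV \<le> measure \<nu> UNIV"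
  using mass_le by (simp add: measure_meas1 \<mu> \<nu>)

lemma put_diff_bounded:
  "\<exists>B. \<forall>k. put_fun \<mu> k - put_fun \<nu> k \<le> B"
proof (intro exI allI)
  fix k
  define A B where "A = (\<integral>x. \<bar>x\<bar> \<partial>\<mu>)" and "B = (\<integral>x. \<bar>x\<bar> \<partial>\<nu>)"
  note bA = put_fun_bounds[OF \<mu>, folded A_def] and bB = put_fun_bounds[OF \<nu>, folded B_def]
  show "put_fun \<mu> k - put_fun \<nu> k \<le> A + B"
  proof (cases "0 \<le> k")
    case True
    have "k * measure \<mu> UNIV \<le> k * measure \<nu> UNIV" using measure_le True by (rule mult_left_mono)
    then show ?thesis using bA(5)[OF True] bB(2) bB(3)[of k] by linarith
  next
    case False
    then show ?thesis using bA(4)[of k] bB(1) put_fun_nonneg[of \<nu> k] by linarith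
  qed
qed

lemma put_gap_upper: "put_fun \<mu> k - put_fun \<nu> k \<le> put_gap \<mu> \<nu>"
  unfolding put_gap_def using put_diff_bounded by (intro cSUP_upper) (auto simp: bdd_above_def)

lemma put_gap_least: "(\<And>k. put_fun \<mu> k - put_fun \<nu> k \<le> c) \<Longrightarrow> put_gap \<mu> \<nu> \<le> c"
  unfolding put_gap_def by (rule cSUP_least) auto

lemma put_gap_nonneg: "0 \<le> put_gap \<mu> \<nu>"
proof -
  have "((\<lambda>k. put_fun \<mu> k - put_fun \<nu> k) \<longlongrightarrow> 0 - 0) at_bot"
    by (intro tendsto_diff put_fun_at_bot \<mu> \<nu>)
  then show ?thesis
    using put_gap_upper by (auto intro!: tendsto_upperbound)
qed

definition gap_minorant :: "real \<Rightarrow> real" where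
  "gap_minorant = convex_minorant (\<lambda>x. put_fun \<nu> x - put_fun \<mu> x)"

lemma gap_minorant_exists: "is_convex_minorant (\<lambda>x. put_fun \<nu> x - put_fun \<mu> x) (\<lambda>_. - put_gap \<mu> \<nu>)"
  using put_gap_upper by (auto simp: is_convex_minorant_def le_fun_def convex_on_const algebra_simps)

lemma gap_minorant_convex: "convex_on UNIV gap_minorant"
  and gap_minorant_le: "gap_minorant k \<le> put_fun \<nu> k - put_fun \<mu> k"
  using convex_minorant_greatest(1)[OF gap_minorant_exists]
  by (auto simp: gap_minorant_def is_convex_minorant_def le_fun_def)

lemma gap_minorant_greatest:
  "convex_on UNIV g \<Longrightarrow> (\<And>u. g u \<le> put_fun \<nu> u - put_fun \<mu> u) \<Longrightarrow> g k \<le> gap_minorant k"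
  using convex_minorant_greatest(2)[OF gap_minorant_exists, of g k]
  by (auto simp: gap_minorant_def is_convex_minorant_def le_fun_def)

lemma gap_minorant_ge: "- put_gap \<mu> \<nu> \<le> gap_minorant k"
  by (rule gap_minorant_greatest) (use put_gap_upper in \<open>auto simp: convex_on_const algebra_simps\<close>)

text \<open>The minorant comes arbitrarily close to \<open>-p\<close>, the infimum of \<open>P\<^sub>\<nu> - P\<^sub>\<mu>\<close>, at some point, and being
nondecreasing it stays as close further left.\<close>

lemma gap_minorant_at_bot: "((\<lambda>k. gap_minorant k + put_gap \<mu> \<nu>) \<longlongrightarrow> 0) at_bot"
proof (rule order_tendstoI)
  fix e :: real assume e: "e < 0"
  show "\<forall>\<^sub>F k in at_bot. e < gap_minorant k + put_gap \<mu> \<nu>"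
    using gap_minorant_ge e by (intro always_eventually allI) (smt (verit))
next
  fix e :: real assume e: "0 < e"
  then obtain k where k: "put_gap \<mu> \<nu> - e < put_fun \<mu> k - put_fun \<nu> k"
    using put_gap_least[of "put_gap \<mu> \<nu> - e"] by (smt (verit))
  show "\<forall>\<^sub>F t in at_bot. gap_minorant t + put_gap \<mu> \<nu> < e"
    using eventually_le_at_bot[of k]
  proof eventually_elim
    case (elim t)
    have "gap_minorant t \<le> gap_minorant k"
    proof (rule convex_nondecreasing[OF gap_minorant_convex _ elim])
      show "gap_minorant s \<le> (\<integral>x. \<bar>x\<bar> \<partial>\<nu>)" if "s \<le> 0" for s
        using gap_minorant_le[of s] put_fun_nonneg[of \<mu> s] put_fun_bounds(4)[OF \<nu> that] by linarith
    qed
    then show ?case using gap_minorant_le[of k] k by linarith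
  qed
qed

text \<open>In terms of put functions the bound on the call functions says that this affine function is a minorant.  It
controls the minorant near \<open>\<infinity>\<close>, hence the mass and the mean of the shadow.\<close>

lemma gap_minorant_affine_lower:
  assumes "\<And>k. call_fun \<mu> k - call_fun \<nu> k \<le> c"
  shows "(measure \<nu> UNIV - measure \<mu> UNIV) * k - (mean \<nu> - mean \<mu> + c) \<le> gap_minorant k"
proof (rule gap_minorant_greatest)
  show "convex_on UNIV (\<lambda>k. (measure \<nu> UNIV - measure \<mu> UNIV) * k - (mean \<nu> - mean \<mu> + c))"
    by (rule convex_on_three_pointI) (simp add: algebra_simps)
  show "(measure \<nu> UNIV - measure \<mu> UNIV) * k - (mean \<nu> - mean \<mu> + c) \<le> put_fun \<nu> k - put_fun \<mu> k" for k
    using assms[of k] put_call_parity[OF \<mu>, of k] put_call_parity[OF \<nu>, of k] by (simp add: algebra_simps)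
qed

lemma call_diff_bounded: "\<exists>c. \<forall>k. call_fun \<mu> k - call_fun \<nu> k \<le> c"
proof (intro exI allI)
  fix k
  define A B where "A = (\<integral>x. \<bar>x\<bar> \<partial>\<mu>)" and "B = (\<integral>x. \<bar>x\<bar> \<partial>\<nu>)"
  note bA = put_fun_bounds[OF \<mu>, folded A_def] and bB = put_fun_bounds[OF \<nu>, folded B_def]
  have call_nonneg: "0 \<le> call_fun \<nu> k" by (simp add: call_fun_def)
  show "call_fun \<mu> k - call_fun \<nu> k \<le> 2 * A + B + put_gap \<mu> \<nu>"
  proof (cases "0 \<le> k")
    case True
    then show ?thesis
      using bA(1,2) bA(5)[OF True] bB(1) call_nonneg put_call_parity[OF \<mu>, of k] put_gap_nonneg by (auto simp: algebra_simps)
  next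
    case False
    have "k * (measure \<nu> UNIV - measure \<mu> UNIV) \<le> 0"
      using False measure_le by (simp add: mult_le_0_iff)
    then show ?thesis
      using bA(1,2) bB(2) put_gap_upper[of k] put_call_parity[OF \<mu>, of k] put_call_parity[OF \<nu>, of k]
      by (auto simp: algebra_simps)
  qed
qed

lemma shadow_properties:
  shows "shadow \<nu> \<mu> \<in> submeasures \<mu> \<nu>"
    and "put_fun (shadow \<nu> \<mu>) k = put_fun \<nu> k - gap_minorant k - put_gap \<mu> \<nu>"
proof -
  define p where "p = put_gap \<mu> \<nu>"
  define m n where "m = measure \<mu> UNIV" and "n = measure \<nu> UNIV"
  define G where "G k = put_fun \<nu> k - gap_minorant k - p" for k
  define H where "H k = gap_minorant k + p" for k
  obtain c where c: "\<And>k. call_fun \<mu> k - call_fun \<nu> k \<le> c" using call_diff_bounded by blast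
  define A B where "A = (\<integral>x. \<bar>x\<bar> \<partial>\<mu>)" and "B = (\<integral>x. \<bar>x\<bar> \<partial>\<nu>)"
  note bA = put_fun_bounds[OF \<mu>, folded A_def m_def] and bB = put_fun_bounds[OF \<nu>, folded B_def n_def]
  have convex_G: "convex_on UNIV G"
  proof (rule convex_on_three_pointI)
    have F: "convex_on UNIV (\<lambda>x. put_fun \<nu> x - gap_minorant x)"
      unfolding gap_minorant_def
      by (rule convex_on_minus_convex_minorant[OF convex_on_put_fun[OF \<nu>] convex_on_put_fun[OF \<mu>] gap_minorant_exists])
    fix a b c :: real assume "a < b" "b < c"
    then show "(c - a) * G b \<le> (c - b) * G a + (b - a) * G c"
      using convex_on_three_pointD[OF F, of a b c] by (simp add: G_def algebra_simps)
  qed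
  have convex_H: "convex_on UNIV H"
  proof (rule convex_on_three_pointI)
    fix a b c :: real assume "a < b" "b < c"
    then show "(c - a) * H b \<le> (c - b) * H a + (b - a) * H c"
      using convex_on_three_pointD[OF gap_minorant_convex, of a b c] by (simp add: H_def algebra_simps)
  qed
  have H_bot: "(H \<longlongrightarrow> 0) at_bot"
    using gap_minorant_at_bot by (simp add: H_def[abs_def] p_def)
  have G_bot: "(G \<longlongrightarrow> 0) at_bot"
    using tendsto_diff[OF put_fun_at_bot[OF \<nu>] H_bot] by (simp add: G_def[abs_def] H_def diff_diff_eq)
  have H_upper: "H k - (n - m) * k \<le> B + A + p" if "0 \<le> k" for k
    using gap_minorant_le[of k] bA(2) bA(3)[of k] bB(5)[OF that] by (auto simp: H_def algebra_simps)
  have H_lower: "- (\<bar>mean \<nu>\<bar> + \<bar>mean \<mu>\<bar> + \<bar>c\<bar> + p) \<le> H k - (n - m) * k" for k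
    using gap_minorant_affine_lower[OF c, of k] put_gap_nonneg by (simp add: H_def m_def n_def p_def)
  define C where "C = B + A + p + (\<bar>mean \<nu>\<bar> + \<bar>mean \<mu>\<bar> + \<bar>c\<bar> + p)"
  have H_asymp: "\<bar>H k - (n - m) * k\<bar> \<le> C" if "0 \<le> k" for k
    using H_upper[OF that] H_lower[of k] bA(1) bB(1) put_gap_nonneg by (auto simp: C_def p_def)
  have G_asymp: "\<bar>G k - m * k\<bar> \<le> C + B" if "0 \<le> k" for k
  proof -
    have "\<bar>put_fun \<nu> k - n * k\<bar> \<le> B" using bB(2) bB(3)[of k] bB(5)[OF that] by (auto simp: mult.commute)
    moreover have "G k - m * k = (put_fun \<nu> k - n * k) - (H k - (n - m) * k)"
      by (simp add: G_def H_def algebra_simps)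
    ultimately show ?thesis using H_asymp[OF that] by linarith
  qed
  obtain \<theta> where \<theta>: "\<theta> \<in> meas1" "emeasure \<theta> UNIV = ennreal m" "\<And>k. put_fun \<theta> k = G k"
    "\<And>A. A \<in> sets borel \<Longrightarrow> emeasure \<theta> A \<le> emeasure \<nu> A"
    using submeasure_of_put_decomposition[OF \<nu> convex_G G_bot G_asymp convex_H H_bot H_asymp] measure_le
    by (auto simp: G_def H_def m_def n_def)
  have sub: "\<theta> \<in> submeasures \<mu> \<nu>"
    using \<theta> measure_meas1[OF \<mu>] by (simp add: submeasures_def m_def)
  have "shadow \<nu> \<mu> = \<theta>"
    unfolding shadow_def
  proof (rule the_equality)
    show "\<theta> \<in> submeasures \<mu> \<nu> \<and> (\<forall>k. put_fun \<theta> k =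
        put_fun \<nu> k - convex_minorant (\<lambda>x. put_fun \<nu> x - put_fun \<mu> x) k - put_gap \<mu> \<nu>)"
      using sub \<theta>(3) by (simp add: G_def gap_minorant_def p_def)
  next
    fix \<eta> assume "\<eta> \<in> submeasures \<mu> \<nu> \<and> (\<forall>k. put_fun \<eta> k =
        put_fun \<nu> k - convex_minorant (\<lambda>x. put_fun \<nu> x - put_fun \<mu> x) k - put_gap \<mu> \<nu>)"
    then show "\<eta> = \<theta>"
      using \<theta> by (intro put_fun_inject) (auto simp: submeasures_def G_def gap_minorant_def p_def)
  qed
  then show "shadow \<nu> \<mu> \<in> submeasures \<mu> \<nu>"
    "put_fun (shadow \<nu> \<mu>) k = put_fun \<nu> k - gap_minorant k - put_gap \<mu> \<nu>"
    using sub \<theta>(3) by (auto simp: G_def p_def)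
qed

end

section \<open>Jensen bounds for the kernel of a coupling\<close>

context
  fixes \<mu> \<theta> :: "real measure" and \<pi> :: "(real \<times> real) measure" and K :: "real \<Rightarrow> real measure"
  assumes \<mu>: "\<mu> \<in> meas1" and \<theta>: "\<theta> \<in> meas1"
    and coupling: "\<pi> \<in> couplings \<mu> \<theta>" and disint: "disintegration \<mu> \<pi> K"
begin

lemma kernel_prob: "K x \<in> space (prob_algebra borel)"
  using disint measurable_space[of K borel "prob_algebra borel" x] by (simp add: disintegration_def)

lemma kernel_prob_space: "prob_space (K x)" "sets (K x) = sets borel" "space (K x) = UNIV"
proof -
  show "prob_space (K x)" and s: "sets (K x) = sets borel"
    using kernel_prob[of x] by (auto simp: space_prob_algebra)
  show "space (K x) = UNIV" using sets_eq_imp_space_eq[OF s] by simp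
qed

lemma kernel_measurable: "K \<in> \<mu> \<rightarrow>\<^sub>M subprob_algebra borel"
  using disint meas1_finite_measure(2)[OF \<mu>]
  by (auto simp: disintegration_def intro!: measurable_prob_algebraD cong: measurable_cong_sets)

lemma kernel_measurable_borel: "K \<in> borel \<rightarrow>\<^sub>M subprob_algebra borel"
  using disint by (auto simp: disintegration_def intro!: measurable_prob_algebraD)

lemma second_marginal_eq_bind: "\<theta> = \<mu> \<bind> K"
proof (rule measure_eqI)
  note sp = meas1_finite_measure(3)[OF \<mu>]
  show "sets \<theta> = sets (\<mu> \<bind> K)"
    using meas1_finite_measure(2)[OF \<theta>] by (simp add: sets_bind[OF kernel_prob_space(2)] sp)
  fix B assume "B \<in> sets \<theta>"
  then have B: "B \<in> sets borel" using meas1_finite_measure(2)[OF \<theta>] by simp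
  have sets_\<pi>: "sets \<pi> = sets (borel \<Otimes>\<^sub>M borel)" and snd_\<pi>: "distr \<pi> borel snd = \<theta>"
    using coupling by (auto simp: couplings_def)
  have "emeasure \<theta> B = emeasure \<pi> (snd -` B \<inter> space \<pi>)"
    unfolding snd_\<pi>[symmetric] using B
    by (intro emeasure_distr) (simp_all add: measurable_cong_sets[OF sets_\<pi> refl])
  also have "snd -` B \<inter> space \<pi> = UNIV \<times> B"
    using sets_eq_imp_space_eq[OF sets_\<pi>] by (auto simp: space_pair_measure)
  also have "emeasure \<pi> (UNIV \<times> B) = (\<integral>\<^sup>+ x \<in> UNIV. emeasure (K x) B \<partial>\<mu>)"
    using disint B by (simp add: disintegration_def)
  also have "\<dots> = (\<integral>\<^sup>+ x. emeasure (K x) B \<partial>\<mu>)" by simp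
  also have "\<dots> = emeasure (\<mu> \<bind> K) B"
    using B by (simp add: emeasure_bind[OF _ kernel_measurable] sp)
  finally show "emeasure \<theta> B = emeasure (\<mu> \<bind> K) B" .
qed

lemma nn_integral_second_marginal:
  assumes [measurable]: "g \<in> borel_measurable borel"
  shows "(\<integral>\<^sup>+ y. g y \<partial>\<theta>) = (\<integral>\<^sup>+ x. \<integral>\<^sup>+ y. g y \<partial>K x \<partial>\<mu>)"
  by (subst second_marginal_eq_bind, rule nn_integral_bind[OF assms kernel_measurable])

lemma mean_kernel_measurable: "(\<lambda>x. mean (K x)) \<in> borel_measurable borel"
  unfolding mean_def using kernel_measurable_borel by measurable

lemma kernel_integrable: "AE x in \<mu>. integrable (K x) (\<lambda>y. y)"
proof -
  note [measurable] = kernel_measurable kernel_measurable_borel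
  have "(\<integral>\<^sup>+ x. \<integral>\<^sup>+ y. ennreal \<bar>y\<bar> \<partial>K x \<partial>\<mu>) \<noteq> \<infinity>"
    using \<theta> by (subst nn_integral_second_marginal[symmetric]) (auto simp: meas1_def)
  then have "AE x in \<mu>. (\<integral>\<^sup>+ y. ennreal \<bar>y\<bar> \<partial>K x) \<noteq> \<infinity>"
    by (intro nn_integral_PInf_AE) auto
  then show ?thesis
  proof eventually_elim
    case (elim x)
    show ?case
    proof (rule integrableI_bounded)
      show "(\<lambda>y. y) \<in> borel_measurable (K x)"
        using kernel_prob_space(2)[of x] by (simp cong: measurable_cong_sets)
    qed (use elim in \<open>simp add: less_top\<close>)
  qed
qed

text \<open>Jensen for the probability measures \<open>K x\<close>, integrated over \<open>x\<close>.  Stated for nonnegative integrals, it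
also covers functions that are not integrable.\<close>

lemma jensen_kernel:
  fixes f :: "real \<Rightarrow> real"
  assumes f: "convex_on UNIV f" and nonneg: "\<And>x. 0 \<le> f x"
  shows "(\<integral>\<^sup>+ x. ennreal (f (mean (K x))) \<partial>\<mu>) \<le> (\<integral>\<^sup>+ y. ennreal (f y) \<partial>\<theta>)"
proof -
  note [measurable] = kernel_measurable kernel_measurable_borel mean_kernel_measurable
  have [measurable]: "f \<in> borel_measurable borel"
    by (intro borel_measurable_continuous_onI convex_on_UNIV_continuous f)
  have "AE x in \<mu>. ennreal (f (mean (K x))) \<le> (\<integral>\<^sup>+ y. ennreal (f y) \<partial>K x)"
    using kernel_integrable
  proof eventually_elim
    case (elim x)
    interpret K: prob_space "K x" by (rule kernel_prob_space)
    have meas: "f \<in> borel_measurable (K x)"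
      using kernel_prob_space(2)[of x] by (simp cong: measurable_cong_sets)
    show ?case
    proof (cases "integrable (K x) f")
      case True
      define s b where "s = right_deriv f (mean (K x))" and "b = mean (K x)"
      have "f b = (\<integral>y. f b + s * (y - b) \<partial>K x)"
        using elim by (simp add: b_def mean_def K.prob_space)
      also have "\<dots> \<le> (\<integral>y. f y \<partial>K x)"
        using right_deriv_subgradient[OF f, of b] elim True
        by (intro integral_mono) (auto simp: s_def b_def)
      finally show ?thesis
        using True nonneg by (simp add: nn_integral_eq_integral b_def ennreal_leI)
    next
      case False
      then have "(\<integral>\<^sup>+ y. ennreal (f y) \<partial>K x) = \<infinity>"
        using meas nonneg by (simp add: integrable_iff_bounded less_top[symmetric])
      then show ?thesis by simp
    qed
  qed
  then have "(\<integral>\<^sup>+ x. ennreal (f (mean (K x))) \<partial>\<mu>) \<le> (\<integral>\<^sup>+ x. \<integral>\<^sup>+ y. ennreal (f y) \<partial>K x \<partial>\<mu>)"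
    by (rule nn_integral_mono_AE)
  then show ?thesis by (subst nn_integral_second_marginal) auto
qed

lemma mean_kernel_integrable: "integrable \<mu> (\<lambda>x. mean (K x))"
proof (rule integrableI_bounded)
  show "(\<lambda>x. mean (K x)) \<in> borel_measurable \<mu>"
    using mean_kernel_measurable meas1_finite_measure(2)[OF \<mu>] by (simp cong: measurable_cong_sets)
  have "AE x in \<mu>. ennreal \<bar>mean (K x)\<bar> \<le> (\<integral>\<^sup>+ y. ennreal \<bar>y\<bar> \<partial>K x)"
    using kernel_integrable
  proof eventually_elim
    case (elim x)
    then show ?case
      using integral_norm_bound_ennreal[of "K x" "\<lambda>y. y"] by (simp add: mean_def)
  qed
  then have "(\<integral>\<^sup>+ x. ennreal \<bar>mean (K x)\<bar> \<partial>\<mu>) \<le> (\<integral>\<^sup>+ y. ennreal \<bar>y\<bar> \<partial>\<theta>)"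
    by (subst nn_integral_second_marginal) (auto intro: nn_integral_mono_AE)
  also have "\<dots> < \<infinity>" using \<theta> by (simp add: meas1_def)
  finally show "(\<integral>\<^sup>+ x. ennreal (norm (mean (K x))) \<partial>\<mu>) < \<infinity>" by simp
qed

text \<open>Nonnegative integrands suffice here: the identity function is split into its positive and negative parts.\<close>

lemma integral_second_marginal:
  fixes g :: "real \<Rightarrow> real"
  assumes [measurable]: "g \<in> borel_measurable borel" and nonneg: "\<And>y. 0 \<le> g y" and int: "integrable \<theta> g"
  shows "AE x in \<mu>. integrable (K x) g" "integrable \<mu> (\<lambda>x. \<integral>y. g y \<partial>K x)"
    "(\<integral>x. (\<integral>y. g y \<partial>K x) \<partial>\<mu>) = (\<integral>y. g y \<partial>\<theta>)"
proof -
  note [measurable] = kernel_measurable kernel_measurable_borel mean_kernel_measurable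
  have fin: "(\<integral>\<^sup>+ x. \<integral>\<^sup>+ y. ennreal (g y) \<partial>K x \<partial>\<mu>) = ennreal (\<integral>y. g y \<partial>\<theta>)"
    using int nonneg by (subst nn_integral_second_marginal[symmetric]) (auto simp: nn_integral_eq_integral)
  then have "AE x in \<mu>. (\<integral>\<^sup>+ y. ennreal (g y) \<partial>K x) \<noteq> \<infinity>"
    by (intro nn_integral_PInf_AE) auto
  then show AE_int: "AE x in \<mu>. integrable (K x) g"
  proof eventually_elim
    case (elim x)
    have "g \<in> borel_measurable (K x)"
      using kernel_prob_space(2)[of x] by (simp cong: measurable_cong_sets)
    then show ?case using elim nonneg by (simp add: integrable_iff_bounded less_top)
  qed
  then have "AE x in \<mu>. ennreal (\<integral>y. g y \<partial>K x) = (\<integral>\<^sup>+ y. ennreal (g y) \<partial>K x)"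
    by eventually_elim (use nonneg in \<open>simp add: nn_integral_eq_integral\<close>)
  then have eq: "(\<integral>\<^sup>+ x. ennreal (\<integral>y. g y \<partial>K x) \<partial>\<mu>) = ennreal (\<integral>y. g y \<partial>\<theta>)"
    unfolding fin[symmetric] by (rule nn_integral_cong_AE)
  have meas: "(\<lambda>x. \<integral>y. g y \<partial>K x) \<in> borel_measurable \<mu>" by measurable
  show "integrable \<mu> (\<lambda>x. \<integral>y. g y \<partial>K x)" "(\<integral>x. (\<integral>y. g y \<partial>K x) \<partial>\<mu>) = (\<integral>y. g y \<partial>\<theta>)"
    using nn_integral_eq_integrable[OF meas, of "\<integral>y. g y \<partial>\<theta>"] eq nonneg by auto
qed

lemma integral_mean_kernel: "(\<integral>x. mean (K x) \<partial>\<mu>) = mean \<theta>"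
proof -
  have pos: "integrable \<theta> (\<lambda>y. max 0 y)" and neg: "integrable \<theta> (\<lambda>y. max 0 (- y))"
    using integrable_call[OF \<theta>, of 0] integrable_put[OF \<theta>, of 0] by auto
  note [measurable] = kernel_measurable kernel_measurable_borel mean_kernel_measurable
  note P = integral_second_marginal[OF _ _ pos] and N = integral_second_marginal[OF _ _ neg]
  note [measurable_cong] = meas1_finite_measure(2)[OF \<mu>]
  have split: "(\<integral>y. y \<partial>M) = (\<integral>y. max 0 y - max 0 (- y) \<partial>M)" for M :: "real measure"
    by (rule Bochner_Integration.integral_cong) auto
  have "AE x in \<mu>. mean (K x) = (\<integral>y. max 0 y \<partial>K x) - (\<integral>y. max 0 (- y) \<partial>K x)"
    using P(1)[simplified] N(1)[simplified]
    by eventually_elim (simp add: mean_def split)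
  then have "(\<integral>x. mean (K x) \<partial>\<mu>) = (\<integral>x. (\<integral>y. max 0 y \<partial>K x) - (\<integral>y. max 0 (- y) \<partial>K x) \<partial>\<mu>)"
    by (intro integral_cong_AE) measurable
  also have "\<dots> = (\<integral>y. max 0 y \<partial>\<theta>) - (\<integral>y. max 0 (- y) \<partial>\<theta>)"
    using P(2,3) N(2,3) by simp
  also have "\<dots> = mean \<theta>"
    unfolding mean_def split using pos neg by simp
  finally show ?thesis .
qed

definition up_cost :: real where "up_cost = (\<integral>x. max 0 (mean (K x) - x) \<partial>\<mu>)"
definition down_cost :: real where "down_cost = (\<integral>x. max 0 (x - mean (K x)) \<partial>\<mu>)"

lemma cost_integrable:
  "integrable \<mu> (\<lambda>x. max 0 (mean (K x) - x))"
  "integrable \<mu> (\<lambda>x. max 0 (x - mean (K x)))"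
  using mean_kernel_integrable meas1_integrable_id[OF \<mu>] by (auto intro!: integrable_max)

lemma cost_eq:
  "(\<integral>\<^sup>+ x. ennreal \<bar>x - (\<integral> y. y \<partial>(K x))\<bar> \<partial>\<mu>) = ennreal (up_cost + down_cost)"
proof -
  have abs: "\<bar>x - (\<integral> y. y \<partial>(K x))\<bar> = max 0 (mean (K x) - x) + max 0 (x - mean (K x))" for x
    by (simp add: mean_def)
  show ?thesis unfolding abs up_cost_def down_cost_def
    using cost_integrable by (subst nn_integral_eq_integral) auto
qed

lemma mean_diff_eq: "mean \<theta> - mean \<mu> = up_cost - down_cost"
proof -
  have "mean \<theta> - mean \<mu> = (\<integral>x. mean (K x) - x \<partial>\<mu>)"
    using mean_kernel_integrable meas1_integrable_id[OF \<mu>] by (simp add: integral_mean_kernel mean_def[of \<mu>])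
  also have "\<dots> = (\<integral>x. max 0 (mean (K x) - x) - max 0 (x - mean (K x)) \<partial>\<mu>)"
    by (rule Bochner_Integration.integral_cong) auto
  finally show ?thesis using cost_integrable by (simp add: up_cost_def down_cost_def)
qed

text \<open>By Jensen the conditional means have a smaller put function than \<open>\<theta>\<close>, and passing from \<open>x\<close> to its
conditional mean lowers the put payoff by at most the distance moved to the right.\<close>

lemma put_diff_le_up_cost: "put_fun \<mu> k - put_fun \<theta> k \<le> up_cost"
proof -
  have "convex_on UNIV (\<lambda>y :: real. max 0 (k - y))"
    using convex_on_positive_part[of "- 1" k] by simp
  then have le: "(\<integral>\<^sup>+ x. ennreal (max 0 (k - mean (K x))) \<partial>\<mu>) \<le> (\<integral>\<^sup>+ y. ennreal (max 0 (k - y)) \<partial>\<theta>)"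
    by (rule jensen_kernel) simp
  have int: "integrable \<mu> (\<lambda>x. max 0 (k - mean (K x)))"
    using mean_kernel_integrable meas1_integrable_const[OF \<mu>] by (auto intro!: integrable_max)
  have "(\<integral>x. max 0 (k - mean (K x)) \<partial>\<mu>) \<le> put_fun \<theta> k"
    using le int integrable_put[OF \<theta>, of k]
    by (simp add: nn_integral_eq_integral put_fun_def del: ennreal_max_0 ennreal_max_0')
  moreover have "put_fun \<mu> k \<le> (\<integral>x. max 0 (k - mean (K x)) + max 0 (mean (K x) - x) \<partial>\<mu>)"
    unfolding put_fun_def using int cost_integrable integrable_put[OF \<mu>]
    by (intro integral_mono) auto
  ultimately show ?thesis using int cost_integrable by (simp add: up_cost_def)
qed

lemma call_diff_le_down_cost: "call_fun \<mu> k - call_fun \<theta> k \<le> down_cost"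
proof -
  have "convex_on UNIV (\<lambda>y :: real. max 0 (y - k))"
    using convex_on_positive_part[of 1 "- k"] by simp
  then have le: "(\<integral>\<^sup>+ x. ennreal (max 0 (mean (K x) - k)) \<partial>\<mu>) \<le> (\<integral>\<^sup>+ y. ennreal (max 0 (y - k)) \<partial>\<theta>)"
    by (rule jensen_kernel) simp
  have int: "integrable \<mu> (\<lambda>x. max 0 (mean (K x) - k))"
    using mean_kernel_integrable meas1_integrable_const[OF \<mu>] by (auto intro!: integrable_max)
  have "(\<integral>x. max 0 (mean (K x) - k) \<partial>\<mu>) \<le> call_fun \<theta> k"
    using le int integrable_call[OF \<theta>, of k]
    by (simp add: nn_integral_eq_integral call_fun_def del: ennreal_max_0 ennreal_max_0')
  moreover have "call_fun \<mu> k \<le> (\<integral>x. max 0 (mean (K x) - k) + max 0 (x - mean (K x)) \<partial>\<mu>)"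
    unfolding call_fun_def using int cost_integrable integrable_call[OF \<mu>]
    by (intro integral_mono) auto
  ultimately show ?thesis using int cost_integrable by (simp add: down_cost_def)
qed

end

section \<open>Averaging a sequence by a doubly stochastic matrix\<close>

text \<open>Positive entries of \<open>a\<close> are units of supply, negative ones are units of demand, and supply may only serve
later demand.  Scanning from left to right and serving each demand from the supply that is left, the unserved
supply evolves like a queue, \<open>r \<mapsto> max 0 (r + a\<^sub>N)\<close>; so its final value is the sum of \<open>a\<close> since the last
time the queue was empty.  Unserved demand is then determined by the total sum.\<close>

lemma greedy_matching:
  fixes a :: "nat \<Rightarrow> real"
  shows "\<exists>Q :: nat \<Rightarrow> nat \<Rightarrow> real. \<exists>k\<le>N.
     (\<forall>u w. 0 \<le> Q u w) \<and>
     (\<forall>u w. Q u w \<noteq> 0 \<longrightarrow> u < w \<and> w < N \<and> 0 < a u \<and> a w < 0) \<and>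
     (\<forall>u<N. (\<Sum>w<N. Q u w) \<le> max 0 (a u)) \<and>
     (\<forall>w<N. (\<Sum>u<N. Q u w) \<le> max 0 (- a w)) \<and>
     (\<Sum>u<N. max 0 (a u) - (\<Sum>w<N. Q u w)) = (\<Sum>j=k..<N. a j)"
proof (induction N)
  case 0
  show ?case by (rule exI[of _ "\<lambda>_ _. 0"]) auto
next
  case (Suc N)
  then obtain Q k where k: "k \<le> N" and nonneg: "\<And>u w. 0 \<le> Q u w"
    and supp: "\<And>u w. Q u w \<noteq> 0 \<Longrightarrow> u < w \<and> w < N \<and> 0 < a u \<and> a w < 0"
    and rows: "\<And>u. u < N \<Longrightarrow> (\<Sum>w<N. Q u w) \<le> max 0 (a u)"
    and cols: "\<And>w. w < N \<Longrightarrow> (\<Sum>u<N. Q u w) \<le> max 0 (- a w)"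
    and res: "(\<Sum>u<N. max 0 (a u) - (\<Sum>w<N. Q u w)) = (\<Sum>j=k..<N. a j)"
    by auto
  define r where "r u = max 0 (a u) - (\<Sum>w<N. Q u w)" for u
  define R where "R = (\<Sum>u<N. r u)"
  have r_nonneg: "0 \<le> r u" if "u < N" for u
    using rows[OF that] by (simp add: r_def)
  have R_nonneg: "0 \<le> R" unfolding R_def by (intro sum_nonneg) (auto simp: r_nonneg)
  have R_tail: "R = (\<Sum>j=k..<N. a j)" using res by (simp add: R_def r_def)
  have zero: "Q u w = 0" if "N \<le> w \<or> N \<le> u" for u w
    using supp[of u w] that by force
  \<comment> \<open>The new entry absorbs a fraction \<open>t\<close> of every residual.\<close>
  define t where "t = (if a N < 0 \<and> 0 < R then min 1 (- a N / R) else 0)"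
  have t: "0 \<le> t" "t \<le> 1" by (auto simp: t_def divide_nonneg_pos intro: divide_nonpos_pos)
  have tR: "t * R \<le> max 0 (- a N)"
    using R_nonneg by (auto simp: t_def min_def field_simps)
  have tR_eq: "R - t * R + max 0 (a N) = max 0 (R + a N)"
    using R_nonneg by (auto simp: t_def min_def field_simps)
  define Q' where "Q' u w = (if w = N \<and> u < N then t * r u else Q u w)" for u w
  have nonneg': "0 \<le> Q' u w" for u w
    using t nonneg r_nonneg by (auto simp: Q'_def)
  have supp': "u < w \<and> w < Suc N \<and> 0 < a u \<and> a w < 0" if "Q' u w \<noteq> 0" for u w
  proof (cases "w = N \<and> u < N")
    case True
    with that have "t \<noteq> 0" "r u \<noteq> 0" by (auto simp: Q'_def)
    moreover have "0 \<le> (\<Sum>w<N. Q u w)" by (intro sum_nonneg nonneg)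
    ultimately show ?thesis using True r_nonneg[of u]
      by (auto simp: t_def r_def max_def split: if_splits)
  next
    case False
    with that have "Q u w \<noteq> 0" by (auto simp: Q'_def)
    from supp[OF this] show ?thesis by auto
  qed
  have row': "(\<Sum>w<Suc N. Q' u w) = (\<Sum>w<N. Q u w) + t * r u" if "u < N" for u
    using that by (simp add: Q'_def)
  have rowN: "(\<Sum>w<Suc N. Q' N w) = 0"
    by (intro sum.neutral) (auto simp: Q'_def zero)
  have rows': "(\<Sum>w<Suc N. Q' u w) \<le> max 0 (a u)" if "u < Suc N" for u
  proof (cases "u = N")
    case True then show ?thesis using rowN by simp
  next
    case False
    then have u: "u < N" using that by simp
    have "t * r u \<le> 1 * r u" using t r_nonneg[OF u] by (intro mult_right_mono) auto
    then show ?thesis using row'[OF u] by (simp add: r_def)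
  qed
  have cols': "(\<Sum>u<Suc N. Q' u w) \<le> max 0 (- a w)" if "w < Suc N" for w
  proof (cases "w = N")
    case True
    have "(\<Sum>u<Suc N. Q' u N) = t * R"
      by (simp add: Q'_def zero R_def sum_distrib_left)
    then show ?thesis using True tR by simp
  next
    case False
    then show ?thesis using that cols[of w] by (simp add: Q'_def zero)
  qed
  have "(\<Sum>u<Suc N. max 0 (a u) - (\<Sum>w<Suc N. Q' u w))
      = (\<Sum>u<N. max 0 (a u) - (\<Sum>w<Suc N. Q' u w)) + max 0 (a N)"
    using rowN by simp
  also have "(\<Sum>u<N. max 0 (a u) - (\<Sum>w<Suc N. Q' u w)) = (\<Sum>u<N. r u - t * r u)"
    by (intro sum.cong refl) (simp add: row' r_def del: sum.lessThan_Suc)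
  also have "\<dots> = R - t * R" by (simp add: R_def sum_subtractf sum_distrib_left)
  finally have res': "(\<Sum>u<Suc N. max 0 (a u) - (\<Sum>w<Suc N. Q' u w)) = max 0 (R + a N)"
    using tR_eq by simp
  define k' where "k' = (if 0 \<le> R + a N then k else Suc N)"
  have "max 0 (R + a N) = (\<Sum>j=k'..<Suc N. a j)"
    using k R_tail by (auto simp: k'_def)
  moreover have "k' \<le> Suc N" using k by (simp add: k'_def)
  ultimately show ?case
    using nonneg' supp' rows' cols' res'
    by (intro exI[of _ Q'] exI[of _ k'] conjI allI impI) metis+
qed

text \<open>Take the matching \<open>Q\<close> for \<open>a = x - y\<close>.  If \<open>u < w\<close> are matched then
\<open>y\<^sub>u < x\<^sub>u \<le> x\<^sub>w < y\<^sub>w\<close>, so exchanging the fraction \<open>Q\<^sub>u\<^sub>w / (y\<^sub>w - y\<^sub>u)\<close> of the targets of \<open>u\<close> and \<open>w\<close>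
raises the mean target of \<open>u\<close> and lowers that of \<open>w\<close> by \<open>Q\<^sub>u\<^sub>w\<close>.  Since \<open>y\<^sub>w - y\<^sub>u\<close> is at least
\<open>\<bar>a\<^sub>u\<bar>\<close> and \<open>\<bar>a\<^sub>w\<bar>\<close>, no cell gives away more than it has, and the matrix of exchanges is doubly
stochastic.  The cost that remains is the unmatched supply and demand.\<close>

lemma doubly_stochastic_approximation:
  fixes x y :: "nat \<Rightarrow> real"
  assumes mono: "\<And>i j. i < j \<Longrightarrow> j < N \<Longrightarrow> x i \<le> x j"
  obtains D k where "k \<le> N" "\<And>j i. j < N \<Longrightarrow> i < N \<Longrightarrow> (0 :: real) \<le> D j i"
    "\<And>j. j < N \<Longrightarrow> (\<Sum>i<N. D j i) = 1" "\<And>i. i < N \<Longrightarrow> (\<Sum>j<N. D j i) = 1"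
    "(\<Sum>j<N. \<bar>x j - (\<Sum>i<N. D j i * y i)\<bar>) = (\<Sum>j=k..<N. x j - y j) + (\<Sum>j<k. y j - x j)"
proof -
  define a where "a j = x j - y j" for j
  obtain Q k where k: "k \<le> N" and nonneg: "\<And>u w. 0 \<le> Q u w"
    and supp: "\<And>u w. Q u w \<noteq> 0 \<Longrightarrow> u < w \<and> w < N \<and> 0 < a u \<and> a w < 0"
    and rows: "\<And>u. u < N \<Longrightarrow> (\<Sum>w<N. Q u w) \<le> max 0 (a u)"
    and cols: "\<And>w. w < N \<Longrightarrow> (\<Sum>u<N. Q u w) \<le> max 0 (- a w)"
    and res: "(\<Sum>u<N. max 0 (a u) - (\<Sum>w<N. Q u w)) = (\<Sum>j=k..<N. a j)"
    using greedy_matching[of N a] by auto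
  define R where "R u w = Q u w / (y w - y u)" for u w
  have gap: "y w - y u \<ge> a u" "y w - y u \<ge> - a w" "y w - y u > 0" if "Q u w \<noteq> 0" for u w
    using supp[OF that] mono[of u w] by (auto simp: a_def)
  have R_nonneg: "0 \<le> R u w" for u w
    using nonneg[of u w] gap(3)[of u w] by (cases "Q u w = 0") (auto simp: R_def)
  have R_gap: "R u w * (y w - y u) = Q u w" for u w
    using gap(3)[of u w] by (cases "Q u w = 0") (auto simp: R_def)
  define s where "s j = (\<Sum>l<N. R j l + R l j)" for j
  have s_le: "s j \<le> 1" if j: "j < N" for j
  proof -
    consider "a j > 0" | "a j < 0" | "a j = 0" by linarith
    then show ?thesis
    proof cases
      case 1
      have "R l j = 0" for l using supp[of l j] 1 by (force simp: R_def)
      moreover have "R j l \<le> Q j l / a j" for l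
        unfolding R_def using gap(1)[of j l] 1 nonneg[of j l]
        by (cases "Q j l = 0") (auto intro!: divide_left_mono)
      ultimately have "s j \<le> (\<Sum>l<N. Q j l / a j)"
        unfolding s_def by (intro sum_mono) simp
      also have "\<dots> = (\<Sum>l<N. Q j l) / a j" by (simp add: sum_divide_distrib)
      also have "\<dots> \<le> 1" using rows[OF j] 1 by (simp add: divide_le_eq)
      finally show ?thesis .
    next
      case 2
      have "R j l = 0" for l using supp[of j l] 2 by (force simp: R_def)
      moreover have "R l j \<le> Q l j / (- a j)" for l
        unfolding R_def using gap(2)[of l j] 2 nonneg[of l j]
        by (cases "Q l j = 0") (auto intro!: divide_left_mono mult_pos_neg simp del: divide_minus_right)
      ultimately have "s j \<le> (\<Sum>l<N. Q l j / (- a j))"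
        unfolding s_def by (intro sum_mono) simp
      also have "\<dots> = (\<Sum>l<N. Q l j) / (- a j)" by (simp only: sum_divide_distrib)
      also have "\<dots> \<le> 1" using cols[OF j] 2 by (subst divide_le_eq) auto
      finally show ?thesis .
    next
      case 3
      have "R j l = 0" "R l j = 0" for l using supp[of j l] supp[of l j] 3 by (force simp: R_def)+
      then show ?thesis by (simp add: s_def)
    qed
  qed
  define D where "D j i = (if j = i then 1 - s j else 0) + (R j i + R i j)" for j i
  have D_nonneg: "0 \<le> D j i" if "j < N" for j i
    using s_le[OF that] R_nonneg[of j i] R_nonneg[of i j] by (auto simp: D_def)
  have D_rows: "(\<Sum>i<N. D j i) = 1" if "j < N" for j
    unfolding D_def sum.distrib[of "\<lambda>i. if j = i then 1 - s j else 0"]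
    using that by (simp flip: s_def)
  have D_sym: "D i j = D j i" for i j by (auto simp: D_def)
  have D_cols: "(\<Sum>j<N. D j i) = 1" if "i < N" for i
    using D_rows[OF that] by (simp add: D_sym)
  have Dy: "(\<Sum>i<N. D j i * y i) = y j + (\<Sum>w<N. Q j w) - (\<Sum>u<N. Q u j)" if "j < N" for j
  proof -
    have "(\<Sum>i<N. D j i * y i) = (\<Sum>i<N. D j i * (y i - y j)) + (\<Sum>i<N. D j i) * y j"
      by (simp add: sum_distrib_right flip: sum.distrib) (simp add: algebra_simps)
    also have "(\<Sum>i<N. D j i * (y i - y j)) = (\<Sum>i<N. Q j i - Q i j)"
      by (intro sum.cong refl) (auto simp: D_def algebra_simps simp flip: R_gap)
    finally show ?thesis using D_rows[OF that] by (simp add: sum_subtractf)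
  qed
  have abs_diff: "\<bar>x j - (\<Sum>i<N. D j i * y i)\<bar>
      = (max 0 (a j) - (\<Sum>w<N. Q j w)) + (max 0 (- a j) - (\<Sum>u<N. Q u j))" if j: "j < N" for j
  proof -
    have "(\<Sum>u<N. Q u j) = 0" if "0 \<le> a j"
      using supp[of _ j] that by (intro sum.neutral) force
    moreover have "(\<Sum>w<N. Q j w) = 0" if "a j \<le> 0"
      using supp[of j] that by (intro sum.neutral) force
    ultimately show ?thesis
      using rows[OF j] cols[OF j] Dy[OF j] by (auto simp: a_def max_def abs_if split: if_splits)
  qed
  have "(\<Sum>j<N. \<bar>x j - (\<Sum>i<N. D j i * y i)\<bar>) =
      (\<Sum>j<N. max 0 (a j) - (\<Sum>w<N. Q j w)) + (\<Sum>j<N. max 0 (- a j) - (\<Sum>u<N. Q u j))"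
    by (simp add: abs_diff sum.distrib)
  also have "(\<Sum>j<N. max 0 (- a j) - (\<Sum>u<N. Q u j))
      = (\<Sum>j<N. (max 0 (a j) - a j)) - (\<Sum>w<N. \<Sum>u<N. Q u w)"
    unfolding sum_subtractf by (simp add: max_def flip: sum_subtractf) (auto intro!: sum.cong)
  also have "\<dots> = (\<Sum>j<N. max 0 (a j) - (\<Sum>w<N. Q j w)) - (\<Sum>j<N. a j)"
    unfolding sum_subtractf by (subst sum.swap) simp
  also have "(\<Sum>j<N. a j) = (\<Sum>j<k. a j) + (\<Sum>j=k..<N. a j)"
    using k by (simp add: lessThan_atLeast0 sum.atLeastLessThan_concat)
  finally have "(\<Sum>j<N. \<bar>x j - (\<Sum>i<N. D j i * y i)\<bar>) = (\<Sum>j=k..<N. a j) - (\<Sum>j<k. a j)"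
    using res by simp
  also have "\<dots> = (\<Sum>j=k..<N. x j - y j) + (\<Sum>j<k. y j - x j)"
    by (simp add: a_def sum_subtractf)
  finally show ?thesis using that[OF k, of D] D_nonneg D_rows D_cols by blast
qed

section \<open>Couplings given by densities\<close>

text \<open>A density \<open>q\<close> with respect to the product measure makes the disintegration explicit: the conditional law
at \<open>x\<close> has density \<open>q x\<close> with respect to \<open>\<theta>\<close>.\<close>

lemma weak_cost_le_of_coupling_density:
  fixes q :: "real \<Rightarrow> real \<Rightarrow> real"
  assumes \<mu>: "\<mu> \<in> meas1" and \<theta>: "\<theta> \<in> meas1"
    and q[measurable]: "case_prod q \<in> borel_measurable (borel \<Otimes>\<^sub>M borel)"
    and nonneg: "\<And>x y. 0 \<le> q x y"
    and rows: "\<And>x. (\<integral>\<^sup>+ y. ennreal (q x y) \<partial>\<theta>) = 1"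
    and cols: "\<And>y. (\<integral>\<^sup>+ x. ennreal (q x y) \<partial>\<mu>) = 1"
  shows "weak_cost \<mu> \<theta> \<le> (\<integral>\<^sup>+ x. ennreal \<bar>x - (\<integral>y. q x y * y \<partial>\<theta>)\<bar> \<partial>\<mu>)"
proof -
  note [measurable_cong] = meas1_finite_measure(2)[OF \<mu>] meas1_finite_measure(2)[OF \<theta>]
  interpret \<mu>: finite_measure \<mu> by (rule meas1_finite_measure[OF \<mu>])
  interpret \<theta>: finite_measure \<theta> by (rule meas1_finite_measure[OF \<theta>])
  interpret pair_sigma_finite \<mu> \<theta> ..
  note sp[simp] = meas1_finite_measure(3)[OF \<mu>] meas1_finite_measure(3)[OF \<theta>]
  note st[simp] = meas1_finite_measure(2)[OF \<mu>] meas1_finite_measure(2)[OF \<theta>]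
  have q1[measurable]: "q x \<in> borel_measurable borel" for x
    using measurable_Pair2[OF q, of x] by simp
  define \<pi> where "\<pi> = density (\<mu> \<Otimes>\<^sub>M \<theta>) (\<lambda>z. ennreal (case_prod q z))"
  define K where "K x = density \<theta> (\<lambda>y. ennreal (q x y))" for x
  have sets_pair: "sets (\<mu> \<Otimes>\<^sub>M \<theta>) = sets (borel \<Otimes>\<^sub>M borel)"
    by (rule sets_pair_measure_cong) auto
  have sets_\<pi>: "sets \<pi> = sets (borel \<Otimes>\<^sub>M borel)" by (simp add: \<pi>_def sets_pair)
  have space_\<pi>: "space \<pi> = UNIV" by (simp add: \<pi>_def space_pair_measure)
  have K_eq: "emeasure (K x) B = (\<integral>\<^sup>+ y. ennreal (q x y) * indicator B y \<partial>\<theta>)" if "B \<in> sets borel" for x B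
    unfolding K_def using that by (subst emeasure_density) auto
  have rect: "emeasure \<pi> (A \<times> B) = (\<integral>\<^sup>+ x. \<integral>\<^sup>+ y. ennreal (q x y) * (indicator A x * indicator B y) \<partial>\<theta> \<partial>\<mu>)"
    if [measurable]: "A \<in> sets borel" "B \<in> sets borel" for A B
  proof -
    have "emeasure \<pi> (A \<times> B) = (\<integral>\<^sup>+ z. ennreal (case_prod q z) * indicator (A \<times> B) z \<partial>(\<mu> \<Otimes>\<^sub>M \<theta>))"
      unfolding \<pi>_def by (rule emeasure_density) auto
    also have "\<dots> = (\<integral>\<^sup>+ x. \<integral>\<^sup>+ y. ennreal (q x y) * indicator (A \<times> B) (x, y) \<partial>\<theta> \<partial>\<mu>)"
      by (subst \<theta>.nn_integral_fst[symmetric]) auto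
    finally show ?thesis by (simp add: indicator_times)
  qed
  have \<pi>_rect: "emeasure \<pi> (A \<times> B) = (\<integral>\<^sup>+ x \<in> A. emeasure (K x) B \<partial>\<mu>)"
    if [measurable]: "A \<in> sets borel" "B \<in> sets borel" for A B
  proof -
    have "(\<integral>\<^sup>+ y. ennreal (q x y) * (indicator A x * indicator B y) \<partial>\<theta>) = emeasure (K x) B * indicator A x" for x
      unfolding K_eq[OF that(2)] by (subst nn_integral_multc[symmetric]) (auto simp: mult_ac)
    then show ?thesis by (simp add: rect[OF that])
  qed
  have K_prob: "prob_space (K x)" for x
    by (rule prob_spaceI) (use K_eq[of UNIV x] rows[of x] in \<open>simp add: K_def\<close>)
  have K_meas: "K \<in> borel \<rightarrow>\<^sub>M prob_algebra borel"
  proof (rule measurable_prob_algebraI[OF K_prob], rule measurable_subprob_algebra)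
    show "subprob_space (K x)" for x by (rule prob_space_imp_subprob_space[OF K_prob])
    show "sets (K x) = sets borel" for x by (simp add: K_def)
    show "(\<lambda>x. emeasure (K x) B) \<in> borel_measurable borel" if [measurable]: "B \<in> sets borel" for B
      unfolding K_eq[OF that] by measurable
  qed
  have disint: "disintegration \<mu> \<pi> K"
    using K_meas \<pi>_rect by (simp add: disintegration_def)
  have "distr \<pi> borel fst = \<mu>"
  proof (rule measure_eqI)
    fix A assume "A \<in> sets (distr \<pi> borel fst)"
    then have [measurable]: "A \<in> sets borel" by simp
    have "emeasure (distr \<pi> borel fst) A = emeasure \<pi> (A \<times> UNIV)"
      by (subst emeasure_distr) (auto simp: space_\<pi> measurable_cong_sets[OF sets_\<pi> refl] intro!: arg_cong[where f = "emeasure \<pi>"])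
    also have "\<dots> = emeasure \<mu> A"
      using prob_space.emeasure_space_1[OF K_prob] by (simp add: \<pi>_rect K_def)
    finally show "emeasure (distr \<pi> borel fst) A = emeasure \<mu> A" .
  qed simp
  moreover have "distr \<pi> borel snd = \<theta>"
  proof (rule measure_eqI)
    fix B assume "B \<in> sets (distr \<pi> borel snd)"
    then have [measurable]: "B \<in> sets borel" by simp
    have "emeasure (distr \<pi> borel snd) B = emeasure \<pi> (UNIV \<times> B)"
      by (subst emeasure_distr) (auto simp: space_\<pi> measurable_cong_sets[OF sets_\<pi> refl] intro!: arg_cong[where f = "emeasure \<pi>"])
    also have "\<dots> = (\<integral>\<^sup>+ y. \<integral>\<^sup>+ x. ennreal (q x y) * indicator B y \<partial>\<mu> \<partial>\<theta>)"
      by (subst rect) (auto intro!: Fubini'[symmetric])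
    also have "\<dots> = (\<integral>\<^sup>+ y. indicator B y \<partial>\<theta>)"
      by (subst nn_integral_multc) (auto simp: cols)
    finally show "emeasure (distr \<pi> borel snd) B = emeasure \<theta> B" by simp
  qed simp
  ultimately have "\<pi> \<in> couplings \<mu> \<theta>" by (simp add: couplings_def sets_\<pi>)
  then have "weak_cost \<mu> \<theta> \<le> (\<integral>\<^sup>+ x. ennreal \<bar>x - (\<integral>y. y \<partial>K x)\<bar> \<partial>\<mu>)"
    unfolding weak_cost_def using disint by (intro Inf_lower) blast
  moreover have "(\<integral>y. y \<partial>K x) = (\<integral>y. q x y * y \<partial>\<theta>)" for x
    unfolding K_def by (subst integral_density) (auto simp: nonneg)
  ultimately show ?thesis by simp
qed

text \<open>The functions \<open>h j\<close> and \<open>t i\<close> divide \<open>\<mu>\<close> and \<open>\<theta>\<close> into pieces of mass \<open>\<delta>\<close>, and the coupling sends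
the fraction \<open>D j i\<close> of piece \<open>j\<close> to piece \<open>i\<close>, independently inside the pieces.  The conditional mean at
\<open>x\<close> is a convex combination of the mean targets of the pieces at \<open>x\<close>, so the cost is at most the sum of the
costs of the pieces.\<close>

lemma weak_cost_le_partition:
  fixes h t :: "nat \<Rightarrow> real \<Rightarrow> real" and D :: "nat \<Rightarrow> nat \<Rightarrow> real"
  assumes \<mu>: "\<mu> \<in> meas1" and \<theta>: "\<theta> \<in> meas1" and \<delta>: "0 < \<delta>"
    and h: "\<And>j. h j \<in> borel_measurable borel" "\<And>j x. 0 \<le> h j x" "\<And>x. (\<Sum>j<N. h j x) = 1"
      "\<And>j. j < N \<Longrightarrow> (\<integral>x. h j x \<partial>\<mu>) = \<delta>"
    and t: "\<And>j. t j \<in> borel_measurable borel" "\<And>j x. 0 \<le> t j x" "\<And>x. (\<Sum>j<N. t j x) = 1"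
      "\<And>j. j < N \<Longrightarrow> (\<integral>x. t j x \<partial>\<theta>) = \<delta>"
    and D: "\<And>j i. j < N \<Longrightarrow> i < N \<Longrightarrow> 0 \<le> D j i"
      "\<And>j. j < N \<Longrightarrow> (\<Sum>i<N. D j i) = 1" "\<And>i. i < N \<Longrightarrow> (\<Sum>j<N. D j i) = 1"
  defines "yb \<equiv> \<lambda>i. (\<integral>y. t i y * y \<partial>\<theta>) / \<delta>"
  shows "weak_cost \<mu> \<theta> \<le> ennreal (\<Sum>j<N. \<integral>x. h j x * \<bar>x - (\<Sum>i<N. D j i * yb i)\<bar> \<partial>\<mu>)"
proof -
  note [measurable] = h(1) t(1)
  have h_le: "h j x \<le> 1" if "j < N" for j x
    using member_le_sum[of j "{..<N}" "\<lambda>j. h j x"] that h(2,3) by auto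
  have t_le: "t j x \<le> 1" if "j < N" for j x
    using member_le_sum[of j "{..<N}" "\<lambda>j. t j x"] that t(2,3) by auto
  have int_h: "integrable \<mu> (h j)" if "j < N" for j
    by (rule meas1_integrable[OF \<mu>, of _ 1 0]) (use h_le[OF that] h(2) in auto)
  have int_t: "integrable \<theta> (t j)" if "j < N" for j
    by (rule meas1_integrable[OF \<theta>, of _ 1 0]) (use t_le[OF that] t(2) in auto)
  have int_ty: "integrable \<theta> (\<lambda>y. t j y * y)" if "j < N" for j
    by (rule meas1_integrable[OF \<theta>, of _ 0 1])
       (use t_le[OF that] t(2)[of j] in \<open>auto simp: abs_mult intro!: mult_left_le_one_le\<close>)
  have int_hx: "integrable \<mu> (\<lambda>x. h j x * \<bar>x - z\<bar>)" if "j < N" for j z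
  proof (rule meas1_integrable[OF \<mu>, of _ "\<bar>z\<bar>" 1])
    fix x
    have "h j x * \<bar>x - z\<bar> \<le> \<bar>x - z\<bar>" using h_le[OF that, of x] h(2)[of j x] by (intro mult_left_le_one_le) auto
    then show "\<bar>h j x * \<bar>x - z\<bar>\<bar> \<le> \<bar>z\<bar> + 1 * \<bar>x\<bar>" using h(2)[of j x] by (simp add: abs_mult)
  qed measurable
  define g where "g i x = (\<Sum>j<N. h j x * D j i)" for i x
  have g_nonneg: "0 \<le> g i x" if "i < N" for i x
    unfolding g_def using that h(2) D(1) by (intro sum_nonneg mult_nonneg_nonneg) auto
  have g_sum: "(\<Sum>i<N. g i x) = 1" for x
  proof -
    have "(\<Sum>i<N. g i x) = (\<Sum>j<N. h j x * (\<Sum>i<N. D j i))"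
      unfolding g_def by (subst sum.swap) (simp add: sum_distrib_left)
    then show ?thesis using D(2) h(3) by simp
  qed
  have [measurable]: "g i \<in> borel_measurable borel" for i unfolding g_def by measurable
  have int_g: "integrable \<mu> (g i)" for i
    unfolding g_def by (intro Bochner_Integration.integrable_sum integrable_mult_left int_h) auto
  have g_int: "(\<integral>x. g i x \<partial>\<mu>) = \<delta>" if "i < N" for i
    unfolding g_def using int_h D(3)[OF that] h(4)
    by (subst Bochner_Integration.integral_sum) (auto simp flip: sum_distrib_left)
  define q where "q x y = (\<Sum>i<N. g i x * t i y) / \<delta>" for x y
  have q_nonneg: "0 \<le> q x y" for x y
    unfolding q_def using g_nonneg t(2) \<delta> by (intro divide_nonneg_pos sum_nonneg mult_nonneg_nonneg) auto
  have q_meas: "case_prod q \<in> borel_measurable (borel \<Otimes>\<^sub>M borel)"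
    unfolding q_def by measurable
  have "(\<integral>\<^sup>+ y. ennreal (q x y) \<partial>\<theta>) = 1" for x
  proof -
    have "integrable \<theta> (q x)" unfolding q_def
      by (intro integrable_divide Bochner_Integration.integrable_sum integrable_mult_right int_t) auto
    moreover have "(\<integral>y. q x y \<partial>\<theta>) = 1"
      unfolding q_def using int_t t(4) \<delta> g_sum[of x] by (simp add: Bochner_Integration.integral_sum flip: sum_distrib_right)
    ultimately show ?thesis using q_nonneg by (simp add: nn_integral_eq_integral)
  qed
  moreover have "(\<integral>\<^sup>+ x. ennreal (q x y) \<partial>\<mu>) = 1" for y
  proof -
    have "integrable \<mu> (\<lambda>x. q x y)" unfolding q_def
      by (intro integrable_divide Bochner_Integration.integrable_sum integrable_mult_left int_g)
    moreover have "(\<integral>x. q x y \<partial>\<mu>) = 1"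
      unfolding q_def using int_g g_int \<delta> t(3)[of y] by (simp add: Bochner_Integration.integral_sum flip: sum_distrib_left)
    ultimately show ?thesis using q_nonneg by (simp add: nn_integral_eq_integral)
  qed
  ultimately have "weak_cost \<mu> \<theta> \<le> (\<integral>\<^sup>+ x. ennreal \<bar>x - (\<integral>y. q x y * y \<partial>\<theta>)\<bar> \<partial>\<mu>)"
    by (intro weak_cost_le_of_coupling_density \<mu> \<theta> q_meas q_nonneg)
  also have "\<dots> \<le> (\<integral>\<^sup>+ x. ennreal (\<Sum>j<N. h j x * \<bar>x - (\<Sum>i<N. D j i * yb i)\<bar>) \<partial>\<mu>)"
  proof (intro nn_integral_mono ennreal_leI)
    fix x
    have "(\<integral>y. q x y * y \<partial>\<theta>) = (\<integral>y. (\<Sum>i<N. (g i x / \<delta>) * (t i y * y)) \<partial>\<theta>)"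
      unfolding q_def sum_divide_distrib sum_distrib_right by (simp add: mult_ac)
    also have "\<dots> = (\<Sum>i<N. g i x * yb i)"
      using int_ty by (subst Bochner_Integration.integral_sum) (auto simp: yb_def)
    also have "\<dots> = (\<Sum>j<N. h j x * (\<Sum>i<N. D j i * yb i))"
      unfolding g_def sum_distrib_right sum_distrib_left by (subst sum.swap) (simp add: mult_ac)
    finally have "x - (\<integral>y. q x y * y \<partial>\<theta>) = (\<Sum>j<N. h j x) * x - (\<Sum>j<N. h j x * (\<Sum>i<N. D j i * yb i))"
      using h(3) by simp
    also have "\<dots> = (\<Sum>j<N. h j x * (x - (\<Sum>i<N. D j i * yb i)))"
      by (simp add: sum_distrib_right right_diff_distrib sum_subtractf)
    also have "\<bar>\<dots>\<bar> \<le> (\<Sum>j<N. h j x * \<bar>x - (\<Sum>i<N. D j i * yb i)\<bar>)"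
      using h(2) by (intro order_trans[OF sum_abs]) (simp add: abs_mult)
    finally show "\<bar>x - (\<integral>y. q x y * y \<partial>\<theta>)\<bar> \<le> (\<Sum>j<N. h j x * \<bar>x - (\<Sum>i<N. D j i * yb i)\<bar>)" .
  qed
  also have "\<dots> = ennreal (\<integral>x. (\<Sum>j<N. h j x * \<bar>x - (\<Sum>i<N. D j i * yb i)\<bar>) \<partial>\<mu>)"
    using int_hx h(2) by (intro nn_integral_eq_integral) (auto intro!: sum_nonneg always_eventually)
  also have "\<dots> = ennreal (\<Sum>j<N. \<integral>x. h j x * \<bar>x - (\<Sum>i<N. D j i * yb i)\<bar> \<partial>\<mu>)"
    using int_hx by (subst Bochner_Integration.integral_sum) auto
  finally show ?thesis .
qed

text \<open>A partition of the domain of \<open>X\<close> need not be of the form \<open>X\<^sup>-\<^sup>1(A)\<close>: an atom of the law of \<open>X\<close> may be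
spread over several cells.  The weight \<open>h j x\<close> is the conditional probability of cell \<open>j\<close> given \<open>X = x\<close>,
obtained as a Radon-Nikodym derivative and corrected on a null set so that the weights sum to \<open>1\<close>
everywhere.\<close>

lemma partition_of_unity_from_cells:
  fixes X :: "'a \<Rightarrow> real"
  assumes L: "finite_measure L" and X[measurable]: "X \<in> borel_measurable L"
    and C: "\<And>j. j < N \<Longrightarrow> C j \<in> sets L"
    and part: "\<And>u. u \<in> space L \<Longrightarrow> (\<Sum>j<N. indicator (C j) u) = (1 :: ennreal)" and N: "0 < N"
  obtains h :: "nat \<Rightarrow> real \<Rightarrow> real" where "\<And>j. h j \<in> borel_measurable borel" "\<And>j x. 0 \<le> h j x"
    "\<And>x. (\<Sum>j<N. h j x) = 1"
    "\<And>j. j < N \<Longrightarrow> density (distr L borel X) (\<lambda>x. ennreal (h j x)) = distr (density L (indicator (C j))) borel X"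
proof -
  interpret L: finite_measure L by (rule L)
  define \<mu> where "\<mu> = distr L borel X"
  interpret \<mu>: finite_measure \<mu> unfolding \<mu>_def by (rule L.finite_measure_distr) simp
  define M where "M j = distr (density L (indicator (C j))) borel X" for j
  have em_M: "emeasure (M j) A = (\<integral>\<^sup>+ u. indicator (C j) u * indicator A (X u) \<partial>L)"
    if j: "j < N" and [measurable]: "A \<in> sets borel" for j A
  proof -
    have [measurable]: "C j \<in> sets L" by (rule C[OF j])
    have "emeasure (M j) A = emeasure (density L (indicator (C j))) (X -` A \<inter> space L)"
      unfolding M_def by (subst emeasure_distr) auto
    also have "\<dots> = (\<integral>\<^sup>+ u. indicator (C j) u * indicator (X -` A \<inter> space L) u \<partial>L)"
      by (subst emeasure_density) auto
    finally show ?thesis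
      by (simp add: indicator_def cong: nn_integral_cong_simp)
  qed
  have em_\<mu>: "emeasure \<mu> A = (\<integral>\<^sup>+ u. indicator A (X u) \<partial>L)" if [measurable]: "A \<in> sets borel" for A
  proof -
    have "emeasure \<mu> A = (\<integral>\<^sup>+ x. indicator A x \<partial>\<mu>)" by (simp add: \<mu>_def)
    then show ?thesis unfolding \<mu>_def by (subst (asm) nn_integral_distr) auto
  qed
  have M_le: "emeasure (M j) A \<le> emeasure \<mu> A" if "j < N" "A \<in> sets borel" for j A
    unfolding em_M[OF that] em_\<mu>[OF that(2)] by (intro nn_integral_mono) (auto simp: indicator_def)
  have "\<exists>r \<in> borel_measurable \<mu>. density \<mu> r = M j" if j: "j < N" for j
  proof (rule \<mu>.Radon_Nikodym_finite_measure)
    have "emeasure (M j) UNIV \<le> emeasure \<mu> UNIV" using M_le[OF j, of UNIV] by simp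
    also have "\<dots> < \<infinity>" using \<mu>.emeasure_finite[of UNIV] by (simp add: less_top[symmetric])
    finally show "finite_measure (M j)" by (intro finite_measureI) (simp add: M_def)
    show "sets (M j) = sets \<mu>" by (simp add: M_def \<mu>_def)
    show "absolutely_continuous \<mu> (M j)"
    proof (unfold absolutely_continuous_def, rule subsetI)
      fix A assume A: "A \<in> null_sets \<mu>"
      then have "A \<in> sets borel" by (auto simp: null_sets_def \<mu>_def)
      with A M_le[OF j this] show "A \<in> null_sets (M j)"
        by (auto simp: null_sets_def M_def)
    qed
  qed
  then have "\<exists>r \<in> borel_measurable borel. density \<mu> r = M j" if "j < N" for j
    using that by (simp add: \<mu>_def)
  then obtain r where r[measurable]: "\<And>j. j < N \<Longrightarrow> r j \<in> borel_measurable borel"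
    and dens: "\<And>j. j < N \<Longrightarrow> density \<mu> (r j) = M j" by metis
  define s where "s x = (\<Sum>j<N. r j x)" for x
  have s_meas[measurable]: "s \<in> borel_measurable borel" unfolding s_def by (intro borel_measurable_sum) auto
  have "density \<mu> s = density \<mu> (\<lambda>_. 1)"
  proof (rule measure_eqI)
    fix A assume "A \<in> sets (density \<mu> s)"
    then have A[measurable]: "A \<in> sets borel" by (simp add: \<mu>_def)
    have [measurable_cong]: "sets \<mu> = sets borel" by (simp add: \<mu>_def)
    have "emeasure (density \<mu> s) A = (\<integral>\<^sup>+ x. (\<Sum>j<N. r j x * indicator A x) \<partial>\<mu>)"
      by (subst emeasure_density) (auto simp: s_def sum_distrib_right)
    also have "\<dots> = (\<Sum>j<N. \<integral>\<^sup>+ x. r j x * indicator A x \<partial>\<mu>)"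
      by (rule nn_integral_sum) auto
    also have "\<dots> = (\<Sum>j<N. emeasure (M j) A)"
      by (intro sum.cong refl) (auto simp flip: dens simp: emeasure_density)
    also have "\<dots> = (\<Sum>j<N. \<integral>\<^sup>+ u. indicator (C j) u * indicator A (X u) \<partial>L)"
      by (intro sum.cong refl em_M) auto
    also have "\<dots> = (\<integral>\<^sup>+ u. (\<Sum>j<N. indicator (C j) u * indicator A (X u)) \<partial>L)"
      using C by (intro nn_integral_sum[symmetric]) auto
    also have "\<dots> = (\<integral>\<^sup>+ u. indicator A (X u) \<partial>L)"
      by (intro nn_integral_cong) (simp add: part flip: sum_distrib_right)
    finally show "emeasure (density \<mu> s) A = emeasure (density \<mu> (\<lambda>_. 1)) A"
      by (simp add: em_\<mu> density_1)
  qed simp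
  then have s_1: "AE x in \<mu>. s x = 1"
    by (subst (asm) \<mu>.density_unique_iff) (auto simp: \<mu>_def)
  \<comment> \<open>On the null set where the derivatives do not sum to \<open>1\<close>, all weight goes to cell \<open>0\<close>.\<close>
  define h where "h j x = (if s x = 1 \<and> j < N then enn2real (r j x) else if j = 0 then 1 else 0)" for j x
  show ?thesis
  proof (rule that[of h])
    show "h j \<in> borel_measurable borel" for j
    proof (cases "j < N")
      case True
      then show ?thesis unfolding h_def[abs_def] by measurable
    next
      case False
      then show ?thesis by (simp add: h_def[abs_def])
    qed
    show "0 \<le> h j x" for j x by (simp add: h_def)
    have fin: "r j x < top" if "s x = 1" "j < N" for j x
    proof -
      have "r j x \<le> s x" unfolding s_def using that by (intro member_le_sum) auto
      then show ?thesis using that by (metis ennreal_one_less_top le_less_trans)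
    qed
    show "(\<Sum>j<N. h j x) = 1" for x
    proof (cases "s x = 1")
      case True
      then have "(\<Sum>j<N. h j x) = (\<Sum>j<N. enn2real (r j x))" by (simp add: h_def)
      also have "\<dots> = enn2real (s x)"
        unfolding s_def using fin[OF True] by (subst enn2real_sum) auto
      finally show ?thesis using True by simp
    next
      case False
      then have "(\<Sum>j<N. h j x) = (\<Sum>j<N. if j = 0 then 1 else 0)" by (simp add: h_def)
      then show ?thesis using N by simp
    qed
    show "density (distr L borel X) (\<lambda>x. ennreal (h j x)) = distr (density L (indicator (C j))) borel X" if j: "j < N" for j
    proof -
      have "AE x in \<mu>. ennreal (h j x) = r j x"
        using s_1 by eventually_elim (use fin j in \<open>auto simp: h_def\<close>)
      then have "density \<mu> (\<lambda>x. ennreal (h j x)) = density \<mu> (r j)"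
        using j by (intro density_cong) (auto simp: \<mu>_def h_def)
      then show ?thesis using dens[OF j] by (simp add: \<mu>_def M_def)
    qed
  qed
qed

section \<open>Equal cells of quantile levels\<close>

abbreviation levels :: "real \<Rightarrow> real measure" where
  "levels m \<equiv> restrict_space lborel {0<..<m}"

lemma finite_measure_levels: "finite_measure (levels m)"
  by (cases "0 \<le> m"; rule finite_measureI) (simp_all add: emeasure_restrict_space space_restrict_space)

lemma space_levels [simp]: "space (levels m) = {0<..<m}"
  by (simp add: space_restrict_space)

lemma quantile_function:
  assumes \<eta>: "\<eta> \<in> meas1" and m: "measure \<eta> UNIV = m" "0 < m"
  obtains X where "X \<in> borel_measurable (levels m)" "mono_on {0<..<m} X" "distr (levels m) borel X = \<eta>"
proof -
  interpret \<eta>: finite_borel_measure \<eta> by (rule meas1_finite_measure[OF \<eta>])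
  note sp = meas1_finite_measure(3)[OF \<eta>]
  interpret Q: right_continuous_mono "cdf \<eta>" 0 m
    using \<eta>.cdf_nondecreasing \<eta>.cdf_is_right_cont \<eta>.cdf_lim_at_bot \<eta>.cdf_lim_at_top
    by unfold_locales (auto simp: m sp intro: monoI)
  have meas: "Q.I \<in> borel_measurable (levels m)"
    using borel_measurable_mono_on_fnc[OF Q.mono_I]
    by (subst measurable_cong_sets[OF sets_restrict_space_cong[OF sets_lborel] refl])
  have "distr (levels m) borel Q.I = \<eta>"
  proof (rule cdf_unique')
    show "finite_borel_measure (distr (levels m) borel Q.I)"
      using finite_measure.finite_measure_distr[OF finite_measure_levels meas]
      by (simp add: finite_borel_measure_def finite_borel_measure_axioms_def)
    show "finite_borel_measure \<eta>" ..
    show "cdf (distr (levels m) borel Q.I) = cdf \<eta>"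
    proof
      fix x
      have bounds: "0 \<le> cdf \<eta> x" "cdf \<eta> x \<le> m"
        using \<eta>.cdf_nonneg \<eta>.cdf_bounded[of x] by (auto simp: sp m)
      have "cdf (distr (levels m) borel Q.I) x = measure lborel {u \<in> {0<..<m}. u \<le> cdf \<eta> x}"
      proof -
        have "cdf (distr (levels m) borel Q.I) x = measure (levels m) (Q.I -` {..x} \<inter> space (levels m))"
          by (rule trans[OF cdf_def2 measure_distr[OF meas]]) simp
        also have "Q.I -` {..x} \<inter> space (levels m) = {u \<in> {0<..<m}. u \<le> cdf \<eta> x}"
          unfolding space_levels using Q.pseudoinverse by (simp add: set_eq_iff) blast
        also have "measure (levels m) \<dots> = measure lborel {u \<in> {0<..<m}. u \<le> cdf \<eta> x}"
          by (rule measure_restrict_space) auto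
        finally show ?thesis .
      qed
      also have "\<dots> = measure lborel {0<..<cdf \<eta> x}"
        unfolding measure_def
      proof (intro arg_cong[where f = enn2real] emeasure_eq_AE)
        show "AE u in lborel. u \<in> {u \<in> {0<..<m}. u \<le> cdf \<eta> x} \<longleftrightarrow> u \<in> {0<..<cdf \<eta> x}"
          using AE_lborel_singleton[of "cdf \<eta> x"] by eventually_elim (use bounds in auto)
      qed auto
      finally show "cdf (distr (levels m) borel Q.I) x = cdf \<eta> x" using bounds by simp
    qed
  qed
  with meas Q.mono_I show ?thesis by (rule that)
qed

context
  fixes \<mu> \<theta> :: "real measure" and m p c :: real and X Y :: "real \<Rightarrow> real"
  assumes \<mu>: "\<mu> \<in> meas1" and \<theta>: "\<theta> \<in> meas1"
    and mass: "measure \<mu> UNIV = m" "measure \<theta> UNIV = m" and m: "0 < m"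
    and put_le: "\<And>k. put_fun \<mu> k - put_fun \<theta> k \<le> p" and call_le: "\<And>k. call_fun \<mu> k - call_fun \<theta> k \<le> c"
    and X: "X \<in> borel_measurable (levels m)" "mono_on {0<..<m} X" "distr (levels m) borel X = \<mu>"
    and Y: "Y \<in> borel_measurable (levels m)" "mono_on {0<..<m} Y" "distr (levels m) borel Y = \<theta>"
begin

lemma integral_quantile:
  fixes g :: "real \<Rightarrow> real"
  assumes [measurable]: "g \<in> borel_measurable borel"
  shows "(\<integral>x. g x \<partial>\<mu>) = (\<integral>u. g (X u) \<partial>levels m)" "(\<integral>x. g x \<partial>\<theta>) = (\<integral>u. g (Y u) \<partial>levels m)"
    "integrable \<mu> g \<longleftrightarrow> integrable (levels m) (\<lambda>u. g (X u))"
    "integrable \<theta> g \<longleftrightarrow> integrable (levels m) (\<lambda>u. g (Y u))"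
  using X(1) Y(1) by (simp_all add: X(3)[symmetric] Y(3)[symmetric] integral_distr integrable_distr_eq)

lemma quantiles_integrable: "integrable (levels m) X" "integrable (levels m) Y"
proof -
  have id: "(\<lambda>x. x) \<in> borel_measurable (borel :: real measure)" by simp
  show "integrable (levels m) X"
    by (rule iffD1[OF integral_quantile(3)[OF id] meas1_integrable_id[OF \<mu>]])
  show "integrable (levels m) Y"
    by (rule iffD1[OF integral_quantile(4)[OF id] meas1_integrable_id[OF \<theta>]])
qed

lemma mean_quantile: "mean \<mu> = (\<integral>u. X u \<partial>levels m)" "mean \<theta> = (\<integral>u. Y u \<partial>levels m)"
  unfolding mean_def by (rule integral_quantile(1,2)[of "\<lambda>x. x"], simp)+

text \<open>Limits of the two hypotheses at \<open>-\<infinity>\<close> and \<open>\<infinity>\<close>, where put functions, respectively call functions, vanish.\<close>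

lemma gap_bounds: "0 \<le> p" "0 \<le> c" "mean \<theta> - mean \<mu> \<le> p" "mean \<mu> - mean \<theta> \<le> c"
proof -
  have bot: "((\<lambda>k. put_fun \<mu> k - put_fun \<theta> k) \<longlongrightarrow> 0 - 0) at_bot"
    by (intro tendsto_diff put_fun_at_bot \<mu> \<theta>)
  have top: "((\<lambda>k. call_fun \<mu> k - call_fun \<theta> k) \<longlongrightarrow> 0 - 0) at_top"
    by (intro tendsto_diff call_fun_at_top \<mu> \<theta>)
  have parity: "call_fun \<mu> k - call_fun \<theta> k = put_fun \<mu> k - put_fun \<theta> k + (mean \<mu> - mean \<theta>)" for k
    using put_call_parity[OF \<mu>, of k] put_call_parity[OF \<theta>, of k] by (simp add: mass)
  show "0 \<le> p" using tendsto_upperbound[OF bot] put_le by simp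
  show "0 \<le> c" using tendsto_upperbound[OF top] call_le by simp
  have "put_fun \<mu> k - put_fun \<theta> k \<le> c - (mean \<mu> - mean \<theta>)" for k
    using call_le[of k] parity[of k] by simp
  from tendsto_upperbound[OF bot always_eventually[OF allI[OF this]]]
  show "mean \<mu> - mean \<theta> \<le> c" by simp
  have "call_fun \<mu> k - call_fun \<theta> k \<le> p + (mean \<mu> - mean \<theta>)" for k
    using put_le[of k] parity[of k] by simp
  from tendsto_upperbound[OF top always_eventually[OF allI[OF this]]]
  show "mean \<theta> - mean \<mu> \<le> p" by simp
qed

lemma integrable_indicator_times:
  fixes g :: "real \<Rightarrow> real"
  assumes g: "integrable (levels m) g" and [measurable]: "A \<in> sets borel"
  shows "integrable (levels m) (\<lambda>u. indicator A u * g u)"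
proof (rule Bochner_Integration.integrable_bound[OF g])
  have "(indicator A :: real \<Rightarrow> real) \<in> borel_measurable (levels m)"
    by (rule measurable_restrict_space1) simp
  then show "(\<lambda>u. indicator A u * g u) \<in> borel_measurable (levels m)"
    using borel_measurable_integrable[OF g] by (rule borel_measurable_times)
  show "AE u in levels m. norm (indicator A u * g u) \<le> norm (g u)"
    by (rule AE_I2) (simp add: indicator_def)
qed

lemma levels_const_integrable: "integrable (levels m) (\<lambda>u. k :: real)"
  using finite_measure.integrable_const[OF finite_measure_levels] .

text \<open>At the strike \<open>k = Y v\<close> the put on \<open>Y\<close> is exercised exactly below level \<open>v\<close>, while exercising the put on
\<open>X\<close> there may be suboptimal.  The two extreme cases of \<open>v\<close> are differences of means.\<close>

lemma lower_quantile_gap: "(\<integral>u. indicator {..<v} u * (Y u - X u) \<partial>levels m) \<le> p"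
proof -
  note int = quantiles_integrable and const = levels_const_integrable
  consider "v \<le> 0" | "m \<le> v" | "0 < v" "v < m" by linarith
  then show ?thesis
  proof cases
    case 1
    then have "(\<integral>u. indicator {..<v} u * (Y u - X u) \<partial>levels m) = (\<integral>u. 0 \<partial>levels m)"
      by (intro Bochner_Integration.integral_cong) auto
    then show ?thesis using gap_bounds by simp
  next
    case 2
    then have "(\<integral>u. indicator {..<v} u * (Y u - X u) \<partial>levels m) = (\<integral>u. Y u - X u \<partial>levels m)"
      by (intro Bochner_Integration.integral_cong) auto
    then show ?thesis using gap_bounds int by (simp add: mean_quantile)
  next
    case 3
    define k where "k = Y v"
    have Yv: "Y u \<le> k" if "u \<in> {0<..<m}" "u < v" for u
      using mono_onD[OF Y(2), of u v] that 3 by (auto simp: k_def)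
    have Yv': "k \<le> Y u" if "u \<in> {0<..<m}" "v \<le> u" for u
      using mono_onD[OF Y(2), of v u] that 3 by (auto simp: k_def)
    have "put_fun \<theta> k = (\<integral>u. max 0 (k - Y u) \<partial>levels m)"
      unfolding put_fun_def by (rule integral_quantile) simp
    also have "\<dots> = (\<integral>u. indicator {..<v} u * (k - Y u) \<partial>levels m)"
      using Yv Yv' by (intro Bochner_Integration.integral_cong) (auto simp: indicator_def max_def not_less antisym)
    finally have \<theta>_eq: "put_fun \<theta> k = (\<integral>u. indicator {..<v} u * (k - Y u) \<partial>levels m)" .
    have "(\<integral>u. indicator {..<v} u * (k - X u) \<partial>levels m) \<le> (\<integral>u. max 0 (k - X u) \<partial>levels m)"
    proof (intro integral_mono integrable_indicator_times)
      show "integrable (levels m) (\<lambda>u. max 0 (k - X u))"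
        using integral_quantile(3)[of "\<lambda>x. max 0 (k - x)"] integrable_put[OF \<mu>] by simp
    qed (use int const in \<open>auto simp: indicator_def\<close>)
    also have "\<dots> = put_fun \<mu> k" unfolding put_fun_def by (rule integral_quantile(1)[symmetric]) simp
    finally have "(\<integral>u. indicator {..<v} u * (k - X u) \<partial>levels m) - (\<integral>u. indicator {..<v} u * (k - Y u) \<partial>levels m) \<le> p"
      using put_le[of k] \<theta>_eq by simp
    also have "(\<integral>u. indicator {..<v} u * (k - X u) \<partial>levels m) - (\<integral>u. indicator {..<v} u * (k - Y u) \<partial>levels m)
        = (\<integral>u. indicator {..<v} u * (k - X u) - indicator {..<v} u * (k - Y u) \<partial>levels m)"
      using int const by (intro Bochner_Integration.integral_diff[symmetric] integrable_indicator_times) auto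
    finally show ?thesis by (simp add: algebra_simps)
  qed
qed

text \<open>The same comparison for calls, which at the strike \<open>Y v\<close> are exercised above level \<open>v\<close>.\<close>

lemma upper_quantile_gap: "(\<integral>u. indicator {v..} u * (X u - Y u) \<partial>levels m) \<le> c"
proof -
  note int = quantiles_integrable and const = levels_const_integrable
  consider "v \<le> 0" | "m \<le> v" | "0 < v" "v < m" by linarith
  then show ?thesis
  proof cases
    case 2
    then have "(\<integral>u. indicator {v..} u * (X u - Y u) \<partial>levels m) = (\<integral>u. 0 \<partial>levels m)"
      by (intro Bochner_Integration.integral_cong) auto
    then show ?thesis using gap_bounds by simp
  next
    case 1
    then have "(\<integral>u. indicator {v..} u * (X u - Y u) \<partial>levels m) = (\<integral>u. X u - Y u \<partial>levels m)"
      by (intro Bochner_Integration.integral_cong) auto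
    then show ?thesis using gap_bounds int by (simp add: mean_quantile)
  next
    case 3
    define k where "k = Y v"
    have Yv: "Y u \<le> k" if "u \<in> {0<..<m}" "u < v" for u
      using mono_onD[OF Y(2), of u v] that 3 by (auto simp: k_def)
    have Yv': "k \<le> Y u" if "u \<in> {0<..<m}" "v \<le> u" for u
      using mono_onD[OF Y(2), of v u] that 3 by (auto simp: k_def)
    have "call_fun \<theta> k = (\<integral>u. max 0 (Y u - k) \<partial>levels m)"
      unfolding call_fun_def by (rule integral_quantile) simp
    also have "\<dots> = (\<integral>u. indicator {v..} u * (Y u - k) \<partial>levels m)"
      using Yv Yv' by (intro Bochner_Integration.integral_cong) (auto simp: indicator_def max_def not_le antisym)
    finally have \<theta>_eq: "call_fun \<theta> k = (\<integral>u. indicator {v..} u * (Y u - k) \<partial>levels m)" .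
    have "(\<integral>u. indicator {v..} u * (X u - k) \<partial>levels m) \<le> (\<integral>u. max 0 (X u - k) \<partial>levels m)"
    proof (intro integral_mono integrable_indicator_times)
      show "integrable (levels m) (\<lambda>u. max 0 (X u - k))"
        using integral_quantile(3)[of "\<lambda>x. max 0 (x - k)"] integrable_call[OF \<mu>] by simp
    qed (use int const in \<open>auto simp: indicator_def\<close>)
    also have "\<dots> = call_fun \<mu> k" unfolding call_fun_def by (rule integral_quantile(1)[symmetric]) simp
    finally have "(\<integral>u. indicator {v..} u * (X u - k) \<partial>levels m) - (\<integral>u. indicator {v..} u * (Y u - k) \<partial>levels m) \<le> c"
      using call_le[of k] \<theta>_eq by simp
    also have "(\<integral>u. indicator {v..} u * (X u - k) \<partial>levels m) - (\<integral>u. indicator {v..} u * (Y u - k) \<partial>levels m)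
        = (\<integral>u. indicator {v..} u * (X u - k) - indicator {v..} u * (Y u - k) \<partial>levels m)"
      using int const by (intro Bochner_Integration.integral_diff[symmetric] integrable_indicator_times) auto
    finally show ?thesis by (simp add: algebra_simps)
  qed
qed

definition cell :: "nat \<Rightarrow> nat \<Rightarrow> real set" where
  "cell N j = {real j * (m / real N) ..< real (Suc j) * (m / real N)} \<inter> {0<..<m}"

definition cell_mean :: "nat \<Rightarrow> (real \<Rightarrow> real) \<Rightarrow> nat \<Rightarrow> real" where
  "cell_mean N Z j = (\<integral>u. indicator (cell N j) u * Z u \<partial>levels m) / (m / real N)"

lemma cell_sets: "cell N j \<in> sets borel" "cell N j \<in> sets (levels m)"
  by (auto simp: cell_def sets_restrict_space)

lemma cells_below:
  assumes "0 < N" "u \<in> {0<..<m}"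
  shows "(\<Sum>j<k. indicator (cell N j) u) = (indicator {..<real k * (m / real N)} u :: 'b :: semiring_1)"
proof (induction k)
  case 0
  then show ?case using assms by (simp add: indicator_def)
next
  case (Suc k)
  have "real k * (m / real N) \<le> real (Suc k) * (m / real N)"
    using m assms by (intro mult_right_mono) auto
  then have "indicator {..<real k * (m / real N)} u + indicator (cell N k) u
      = (indicator {..<real (Suc k) * (m / real N)} u :: 'b)"
    using assms by (auto simp: indicator_def cell_def simp del: of_nat_Suc)
  then show ?case unfolding sum.lessThan_Suc Suc.IH .
qed

lemma cells_partition:
  assumes "0 < N" "u \<in> {0<..<m}"
  shows "(\<Sum>j<N. indicator (cell N j) u) = (1 :: 'b :: semiring_1)"
  using cells_below[OF assms, of N] assms by simp

lemma cells_above: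
  assumes "0 < N" "u \<in> {0<..<m}" "k \<le> N"
  shows "(\<Sum>j=k..<N. indicator (cell N j) u) = (indicator {real k * (m / real N)..} u :: real)"
proof -
  define S where "S = (\<Sum>j=k..<N. indicator (cell N j) u :: real)"
  have "(\<Sum>j<k. indicator (cell N j) u) + S = (\<Sum>j<N. indicator (cell N j) u)"
    unfolding S_def lessThan_atLeast0 by (rule sum.atLeastLessThan_concat) (use assms(3) in auto)
  also have "\<dots> = 1" by (rule cells_partition[OF assms(1,2)])
  finally have "indicator {..<real k * (m / real N)} u + S = 1"
    unfolding cells_below[OF assms(1,2)] .
  then have "S = indicator {real k * (m / real N)..} u"
    by (cases "real k * (m / real N) \<le> u") (auto simp: indicator_def)
  then show ?thesis by (simp only: S_def)
qed

lemma cell_mass: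
  assumes "j < N"
  shows "(\<integral>u. indicator (cell N j) u \<partial>levels m) = m / real N"
proof -
  have le: "real (Suc j) * (m / real N) \<le> real N * (m / real N)"
    using m assms by (intro mult_right_mono) auto
  have ge: "0 \<le> real j * (m / real N)" using m by simp
  have N: "real N * (m / real N) = m" using assms by simp
  have mem: "u \<in> cell N j \<longleftrightarrow> u \<in> {real j * (m / real N) ..< real (Suc j) * (m / real N)}" if "u \<noteq> 0" for u
    using that le ge unfolding N cell_def by (auto simp del: of_nat_Suc)
  have "(\<integral>u. indicator (cell N j) u \<partial>levels m) = measure (levels m) (cell N j)"
    using cell_sets(2)[of N j] by (simp add: cell_def Int_absorb2)
  also have "\<dots> = measure lborel (cell N j)"
    by (subst measure_restrict_space) (auto simp: cell_def)
  also have "\<dots> = measure lborel {real j * (m / real N) ..< real (Suc j) * (m / real N)}"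
    unfolding measure_def
  proof (intro arg_cong[where f = enn2real] emeasure_eq_AE)
    show "AE u in lborel. u \<in> cell N j \<longleftrightarrow> u \<in> {real j * (m / real N) ..< real (Suc j) * (m / real N)}"
      using AE_lborel_singleton[of "0 :: real"] by eventually_elim (rule mem)
  qed (use cell_sets in auto)
  also have "\<dots> = m / real N"
    using m by (simp add: divide_right_mono algebra_simps add_divide_distrib)
  finally show ?thesis .
qed

lemma cell_mean_integral:
  assumes "0 < N"
  shows "m / real N * cell_mean N Z j = (\<integral>u. indicator (cell N j) u * Z u \<partial>levels m)"
  using m assms by (simp add: cell_mean_def)

lemma cell_mean_X_mono:
  assumes ij: "i < j" and j: "j < N"
  shows "cell_mean N X i \<le> cell_mean N X j"
proof -
  define \<delta> where "\<delta> = m / real N"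
  have \<delta>: "0 < \<delta>" and N: "real N * \<delta> = m" using m j by (auto simp: \<delta>_def)
  define v where "v = real j * \<delta>"
  have "0 < v" using ij \<delta> by (simp add: v_def)
  have "v < real N * \<delta>" unfolding v_def using j \<delta> by (intro mult_strict_right_mono) auto
  then have v: "v \<in> {0<..<m}" using \<open>0 < v\<close> by (simp add: N)
  have "real (Suc i) * \<delta> \<le> v" unfolding v_def using ij \<delta> by (intro mult_right_mono) auto
  then have below: "X u \<le> X v" if "u \<in> cell N i" for u
    using mono_onD[OF X(2), of u v] that v by (auto simp: cell_def \<delta>_def simp del: of_nat_Suc)
  have above: "X v \<le> X u" if "u \<in> cell N j" for u
    using mono_onD[OF X(2), of v u] that v by (auto simp: cell_def \<delta>_def v_def simp del: of_nat_Suc)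
  have const: "(\<integral>u. indicator (cell N l) u * X v \<partial>levels m) = \<delta> * X v" if "l < N" for l
    using cell_mass[OF that] by (simp add: \<delta>_def)
  note int = integrable_indicator_times[OF _ cell_sets(1)]
  have "\<delta> * cell_mean N X i = (\<integral>u. indicator (cell N i) u * X u \<partial>levels m)"
    unfolding \<delta>_def by (rule cell_mean_integral) (use j in simp)
  also have "\<dots> \<le> (\<integral>u. indicator (cell N i) u * X v \<partial>levels m)"
  proof (intro integral_mono int quantiles_integrable levels_const_integrable)
    show "indicator (cell N i) u * X u \<le> indicator (cell N i) u * X v" for u
      using below[of u] by (cases "u \<in> cell N i") simp_all
  qed
  also have "\<dots> = \<delta> * X v" by (rule const) (use ij j in simp)
  also have "\<dots> = (\<integral>u. indicator (cell N j) u * X v \<partial>levels m)" by (rule const[OF j, symmetric])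
  also have "\<dots> \<le> (\<integral>u. indicator (cell N j) u * X u \<partial>levels m)"
  proof (intro integral_mono int quantiles_integrable levels_const_integrable)
    show "indicator (cell N j) u * X v \<le> indicator (cell N j) u * X u" for u
      using above[of u] by (cases "u \<in> cell N j") simp_all
  qed
  also have "\<dots> = \<delta> * cell_mean N X j"
    unfolding \<delta>_def by (rule cell_mean_integral[symmetric]) (use j in simp)
  finally show ?thesis using \<delta> by simp
qed

text \<open>Truncate \<open>X\<close> at a large height \<open>M\<close>.  The truncation error is small in mean, and the truncated function is
monotone and bounded, so its oscillations over all cells add up to at most \<open>2M\<close>, each weighted by the cell
length.  Replacing the best constant on a cell by the cell average costs a factor of \<open>2\<close>.\<close>

lemma small_oscillation:
  assumes \<epsilon>: "0 < \<epsilon>"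
  obtains N where "0 < N" "(\<Sum>j<N. \<integral>u. indicator (cell N j) u * \<bar>X u - cell_mean N X j\<bar> \<partial>levels m) \<le> \<epsilon>"
proof -
  note [measurable] = X(1) and intX = quantiles_integrable(1)
  define clamp where "clamp M u = max (- real M) (min (real M) (X u))" for M :: nat and u
  have "(\<lambda>M. \<integral>u. \<bar>X u - clamp M u\<bar> \<partial>levels m) \<longlonglongrightarrow> (\<integral>u. 0 \<partial>levels m)"
  proof (rule integral_dominated_convergence[where w = "\<lambda>u. \<bar>X u\<bar>"])
    show "integrable (levels m) (\<lambda>u. \<bar>X u\<bar>)" using intX by simp
    show "AE u in levels m. (\<lambda>M. \<bar>X u - clamp M u\<bar>) \<longlonglongrightarrow> 0"
    proof (rule AE_I2, rule tendsto_eventually)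
      fix u
      show "\<forall>\<^sub>F M in sequentially. \<bar>X u - clamp M u\<bar> = 0"
        using eventually_ge_at_top[of "nat \<lceil>\<bar>X u\<bar>\<rceil>"]
      proof eventually_elim
        case (elim M)
        then have "\<bar>X u\<bar> \<le> real M" by linarith
        then show ?case by (auto simp: clamp_def)
      qed
    qed
    show "AE u in levels m. norm \<bar>X u - clamp M u\<bar> \<le> \<bar>X u\<bar>" for M
      by (rule AE_I2) (auto simp: clamp_def max_def min_def)
  qed (unfold clamp_def, measurable)
  then have "\<forall>\<^sub>F M in sequentially. (\<integral>u. \<bar>X u - clamp M u\<bar> \<partial>levels m) < \<epsilon> / 4"
    using \<epsilon> by (intro order_tendstoD) auto
  then obtain M where M: "(\<integral>u. \<bar>X u - clamp M u\<bar> \<partial>levels m) < \<epsilon> / 4"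
    by (auto dest: eventually_happens)
  obtain N :: nat where N: "8 * real M * m / \<epsilon> < real N" using reals_Archimedean2 by blast
  then have "0 < real N" using m \<epsilon> by (intro le_less_trans[OF _ N]) auto
  then have N0: "0 < N" by simp
  define \<delta> where "\<delta> = m / real N"
  have \<delta>: "0 < \<delta>" and N\<delta>: "real N * \<delta> = m" using m N0 by (auto simp: \<delta>_def)
  have \<delta>_small: "4 * real M * \<delta> \<le> \<epsilon> / 2"
    using N \<epsilon> \<open>0 < real N\<close> by (simp add: \<delta>_def field_simps)
  have clamp_meas[measurable]: "clamp M \<in> borel_measurable (levels m)"
    unfolding clamp_def[abs_def] by measurable
  have int_clamp: "integrable (levels m) (clamp M)"
    by (rule Bochner_Integration.integrable_bound[OF levels_const_integrable[of "real M"]])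
       (auto simp: clamp_def)
  \<comment> \<open>The values of the truncated function at the cell boundaries; at the two ends, where
    \<open>X\<close> has no value, the truncation levels take their place.\<close>
  define v where "v j = (if j = 0 then - real M else if j < N then clamp M (real j * \<delta>) else real M)" for j
  have cell_bounds: "v j \<le> clamp M u \<and> clamp M u \<le> v (Suc j)" if u: "u \<in> cell N j" and j: "j < N" for u j
  proof
    have um: "u \<in> {0<..<m}" "real j * \<delta> \<le> u" "u < real (Suc j) * \<delta>"
      using u by (auto simp: cell_def \<delta>_def)
    show "v j \<le> clamp M u"
    proof (cases "j = 0")
      case False
      then have "0 < real j * \<delta>" using \<delta> by simp
      then have "X (real j * \<delta>) \<le> X u" using um by (intro mono_onD[OF X(2)]) auto
      then show ?thesis using False j by (auto simp: v_def clamp_def)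
    qed (auto simp: v_def clamp_def)
    show "clamp M u \<le> v (Suc j)"
    proof (cases "Suc j < N")
      case True
      then have "real (Suc j) * \<delta> < real N * \<delta>" using \<delta> by (intro mult_strict_right_mono) auto
      then have "X u \<le> X (real (Suc j) * \<delta>)" using um by (intro mono_onD[OF X(2)]) (auto simp: N\<delta> simp del: of_nat_Suc)
      then show ?thesis using True by (auto simp: v_def clamp_def simp del: of_nat_Suc)
    qed (auto simp: v_def clamp_def)
  qed
  note int = integrable_indicator_times[OF _ cell_sets(1)]
  have intXz: "integrable (levels m) (\<lambda>u. \<bar>X u - z\<bar>)" for z
    using intX levels_const_integrable by auto
  have intXc: "integrable (levels m) (\<lambda>u. \<bar>X u - clamp M u\<bar>)" using intX int_clamp by auto
  have osc: "(\<integral>u. indicator (cell N j) u * \<bar>X u - cell_mean N X j\<bar> \<partial>levels m)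
      \<le> 2 * ((\<integral>u. indicator (cell N j) u * \<bar>X u - clamp M u\<bar> \<partial>levels m) + \<delta> * (v (Suc j) - v j))"
    if j: "j < N" for j
  proof -
    define z where "z = v j"
    define A where "A = (\<integral>u. indicator (cell N j) u * \<bar>X u - z\<bar> \<partial>levels m)"
    have mass: "(\<integral>u. indicator (cell N j) u * w \<partial>levels m) = \<delta> * w" for w :: real
      using cell_mass[OF j] by (simp add: \<delta>_def)
    have "\<delta> * (cell_mean N X j - z) = (\<integral>u. indicator (cell N j) u * X u \<partial>levels m) - (\<integral>u. indicator (cell N j) u * z \<partial>levels m)"
      unfolding mass using cell_mean_integral[OF N0, of X j] by (simp add: right_diff_distrib \<delta>_def)
    also have "\<dots> = (\<integral>u. indicator (cell N j) u * (X u - z) \<partial>levels m)"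
      unfolding right_diff_distrib
      by (intro Bochner_Integration.integral_diff[symmetric] int intX levels_const_integrable)
    finally have "\<bar>\<delta> * (cell_mean N X j - z)\<bar> \<le> (\<integral>u. \<bar>indicator (cell N j) u * (X u - z)\<bar> \<partial>levels m)"
      by (simp only: integral_abs_bound)
    then have mean_z: "\<delta> * \<bar>cell_mean N X j - z\<bar> \<le> A"
      using \<delta> by (simp add: abs_mult A_def)
    have "(\<integral>u. indicator (cell N j) u * \<bar>X u - cell_mean N X j\<bar> \<partial>levels m)
      \<le> (\<integral>u. indicator (cell N j) u * \<bar>X u - z\<bar> + indicator (cell N j) u * \<bar>cell_mean N X j - z\<bar> \<partial>levels m)"
      by (intro integral_mono Bochner_Integration.integrable_add int intXz levels_const_integrable)
         (auto simp: indicator_def)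
    also have "\<dots> = A + \<delta> * \<bar>cell_mean N X j - z\<bar>"
      unfolding A_def mass[symmetric]
      by (intro Bochner_Integration.integral_add int intXz levels_const_integrable)
    also have "\<dots> \<le> 2 * A" using mean_z by simp
    also have "A \<le> (\<integral>u. indicator (cell N j) u * \<bar>X u - clamp M u\<bar> + indicator (cell N j) u * (v (Suc j) - v j) \<partial>levels m)"
      unfolding A_def z_def
    proof (intro integral_mono Bochner_Integration.integrable_add int intXz intXc levels_const_integrable)
      fix u
      show "indicator (cell N j) u * \<bar>X u - v j\<bar>
          \<le> indicator (cell N j) u * \<bar>X u - clamp M u\<bar> + indicator (cell N j) u * (v (Suc j) - v j)"
        using cell_bounds[OF _ j, of u] by (auto simp: indicator_def)
    qed
    also have "\<dots> = (\<integral>u. indicator (cell N j) u * \<bar>X u - clamp M u\<bar> \<partial>levels m) + \<delta> * (v (Suc j) - v j)"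
      unfolding mass[symmetric]
      by (intro Bochner_Integration.integral_add int intXc levels_const_integrable)
    finally show ?thesis by simp
  qed
  have "(\<Sum>j<N. \<integral>u. indicator (cell N j) u * \<bar>X u - cell_mean N X j\<bar> \<partial>levels m)
      \<le> (\<Sum>j<N. 2 * ((\<integral>u. indicator (cell N j) u * \<bar>X u - clamp M u\<bar> \<partial>levels m) + \<delta> * (v (Suc j) - v j)))"
    by (intro sum_mono osc) simp
  also have "\<dots> = 2 * ((\<Sum>j<N. \<integral>u. indicator (cell N j) u * \<bar>X u - clamp M u\<bar> \<partial>levels m) + \<delta> * (\<Sum>j<N. v (Suc j) - v j))"
    by (simp only: sum_distrib_left[symmetric] sum.distrib)
  also have "(\<Sum>j<N. v (Suc j) - v j) = 2 * real M"
    by (simp only: sum_lessThan_telescope) (use N0 in \<open>simp add: v_def\<close>)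
  also have "(\<Sum>j<N. \<integral>u. indicator (cell N j) u * \<bar>X u - clamp M u\<bar> \<partial>levels m)
      = (\<integral>u. (\<Sum>j<N. indicator (cell N j) u * \<bar>X u - clamp M u\<bar>) \<partial>levels m)"
    by (intro Bochner_Integration.integral_sum[symmetric] int intXc)
  also have "\<dots> = (\<integral>u. \<bar>X u - clamp M u\<bar> \<partial>levels m)"
    by (intro Bochner_Integration.integral_cong refl)
       (simp only: space_levels cells_partition[OF N0] mult_1 flip: sum_distrib_right)
  also have "2 * ((\<integral>u. \<bar>X u - clamp M u\<bar> \<partial>levels m) + \<delta> * (2 * real M)) \<le> \<epsilon>"
    using M \<delta>_small by (simp add: algebra_simps)
  finally show ?thesis by (rule that[OF N0])
qed

lemma cell_weights:
  fixes Z :: "real \<Rightarrow> real"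
  assumes N: "0 < N" and Z: "Z \<in> borel_measurable (levels m)"
  obtains w :: "nat \<Rightarrow> real \<Rightarrow> real" where "\<And>j. w j \<in> borel_measurable borel" "\<And>j x. 0 \<le> w j x"
    "\<And>x. (\<Sum>j<N. w j x) = 1"
    "\<And>j. j < N \<Longrightarrow> density (distr (levels m) borel Z) (\<lambda>x. ennreal (w j x))
      = distr (density (levels m) (indicator (cell N j))) borel Z"
proof (rule partition_of_unity_from_cells[OF finite_measure_levels[of m] Z, of N "cell N"])
  show "cell N j \<in> sets (levels m)" for j by (rule cell_sets)
  show "(\<Sum>j<N. indicator (cell N j) u) = (1 :: ennreal)" if "u \<in> space (levels m)" for u
    using that unfolding space_levels by (rule cells_partition[OF N])
  show "0 < N" by (rule N)
qed (rule that; assumption)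

lemma transfer_to_cell:
  fixes w g Z :: "real \<Rightarrow> real"
  assumes [measurable]: "w \<in> borel_measurable borel" "g \<in> borel_measurable borel" "Z \<in> borel_measurable (levels m)"
    and \<eta>: "\<eta> \<in> meas1" and w: "\<And>x. 0 \<le> w x"
    and dens: "density \<eta> (\<lambda>x. ennreal (w x)) = distr (density (levels m) (indicator (cell N j))) borel Z"
  shows "(\<integral>x. w x * g x \<partial>\<eta>) = (\<integral>u. indicator (cell N j) u * g (Z u) \<partial>levels m)"
proof -
  have [measurable_cong]: "sets \<eta> = sets borel" by (rule meas1_finite_measure(2)[OF \<eta>])
  have [measurable]: "cell N j \<in> sets (levels m)" by (rule cell_sets)
  have "(\<integral>x. w x * g x \<partial>\<eta>) = (\<integral>x. g x \<partial>density \<eta> (\<lambda>x. ennreal (w x)))"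
    by (subst integral_density) (auto simp: w)
  also have "\<dots> = (\<integral>u. g (Z u) \<partial>density (levels m) (indicator (cell N j)))"
    unfolding dens by (rule integral_distr) measurable
  also have "\<dots> = (\<integral>u. g (Z u) \<partial>density (levels m) (\<lambda>u. ennreal (indicator (cell N j) u)))"
    by (simp add: ennreal_indicator)
  also have "\<dots> = (\<integral>u. indicator (cell N j) u *\<^sub>R g (Z u) \<partial>levels m)"
    by (rule integral_density) auto
  finally show ?thesis by (simp only: real_scaleR_def)
qed

text \<open>The matrix for the two sequences of cell averages provides the coupling.  Its residual cost is an integral of
\<open>X - Y\<close> over the levels above some \<open>v\<close> plus one of \<open>Y - X\<close> over the levels below \<open>v\<close>.\<close>

lemma weak_cost_le_quantiles:
  assumes \<epsilon>: "0 < \<epsilon>"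
  shows "weak_cost \<mu> \<theta> \<le> ennreal (p + c + \<epsilon>)"
proof -
  obtain N where N: "0 < N"
    and osc: "(\<Sum>j<N. \<integral>u. indicator (cell N j) u * \<bar>X u - cell_mean N X j\<bar> \<partial>levels m) \<le> \<epsilon>"
    using small_oscillation[OF \<epsilon>] by blast
  define \<delta> where "\<delta> = m / real N"
  have \<delta>: "0 < \<delta>" using m N by (simp add: \<delta>_def)
  obtain h where h: "\<And>j. h j \<in> borel_measurable borel" "\<And>j x. 0 \<le> h j x" "\<And>x. (\<Sum>j<N. h j x) = 1"
    "\<And>j. j < N \<Longrightarrow> density \<mu> (\<lambda>x. ennreal (h j x)) = distr (density (levels m) (indicator (cell N j))) borel X"
    by (rule cell_weights[OF N X(1), unfolded X(3)]) (rule that; assumption)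
  obtain t where t: "\<And>j. t j \<in> borel_measurable borel" "\<And>j x. 0 \<le> t j x" "\<And>x. (\<Sum>j<N. t j x) = 1"
    "\<And>j. j < N \<Longrightarrow> density \<theta> (\<lambda>x. ennreal (t j x)) = distr (density (levels m) (indicator (cell N j))) borel Y"
    by (rule cell_weights[OF N Y(1), unfolded Y(3)]) (rule that; assumption)
  note transfer_h = transfer_to_cell[OF h(1) _ X(1) \<mu> h(2) h(4)] and transfer_t = transfer_to_cell[OF t(1) _ Y(1) \<theta> t(2) t(4)]
  obtain D k where k: "k \<le> N" and D: "\<And>j i. j < N \<Longrightarrow> i < N \<Longrightarrow> 0 \<le> D j i"
      "\<And>j. j < N \<Longrightarrow> (\<Sum>i<N. D j i) = 1" "\<And>i. i < N \<Longrightarrow> (\<Sum>j<N. D j i) = 1"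
    and cost: "(\<Sum>j<N. \<bar>cell_mean N X j - (\<Sum>i<N. D j i * cell_mean N Y i)\<bar>)
      = (\<Sum>j=k..<N. cell_mean N X j - cell_mean N Y j) + (\<Sum>j<k. cell_mean N Y j - cell_mean N X j)"
    by (rule doubly_stochastic_approximation[of N "cell_mean N X" "cell_mean N Y", OF cell_mean_X_mono])
      (assumption, assumption, (rule that; assumption))
  define z where "z j = (\<Sum>i<N. D j i * cell_mean N Y i)" for j
  have h_mass: "(\<integral>x. h j x \<partial>\<mu>) = \<delta>" if "j < N" for j
    using transfer_h[OF _ that, of "\<lambda>_. 1"] cell_mass[OF that] by (simp add: \<delta>_def)
  have t_mass: "(\<integral>x. t j x \<partial>\<theta>) = \<delta>" if "j < N" for j
    using transfer_t[OF _ that, of "\<lambda>_. 1"] cell_mass[OF that] by (simp add: \<delta>_def)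
  have yb: "(\<integral>y. t i y * y \<partial>\<theta>) / \<delta> = cell_mean N Y i" if "i < N" for i
    using transfer_t[OF _ that, of "\<lambda>y. y"] by (simp add: cell_mean_def \<delta>_def)
  note int = integrable_indicator_times[OF _ cell_sets(1)]
  note intX = quantiles_integrable(1) and intY = quantiles_integrable(2)
  have "weak_cost \<mu> \<theta> \<le> ennreal (\<Sum>j<N. \<integral>x. h j x * \<bar>x - (\<Sum>i<N. D j i * ((\<integral>y. t i y * y \<partial>\<theta>) / \<delta>))\<bar> \<partial>\<mu>)"
    by (rule weak_cost_le_partition[OF \<mu> \<theta> \<delta> h(1-3) h_mass t(1-3) t_mass D])
  also have "(\<Sum>j<N. \<integral>x. h j x * \<bar>x - (\<Sum>i<N. D j i * ((\<integral>y. t i y * y \<partial>\<theta>) / \<delta>))\<bar> \<partial>\<mu>)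
      = (\<Sum>j<N. \<integral>x. h j x * \<bar>x - z j\<bar> \<partial>\<mu>)"
    by (simp add: yb z_def)
  also have "\<dots> = (\<Sum>j<N. \<integral>u. indicator (cell N j) u * \<bar>X u - z j\<bar> \<partial>levels m)"
  proof (rule sum.cong[OF refl])
    fix j assume "j \<in> {..<N}"
    then have j: "j < N" by simp
    show "(\<integral>x. h j x * \<bar>x - z j\<bar> \<partial>\<mu>) = (\<integral>u. indicator (cell N j) u * \<bar>X u - z j\<bar> \<partial>levels m)"
      by (rule transfer_h[OF _ j]) measurable
  qed
  also have "\<dots> \<le> (\<Sum>j<N. (\<integral>u. indicator (cell N j) u * \<bar>X u - cell_mean N X j\<bar> \<partial>levels m)
      + \<delta> * \<bar>cell_mean N X j - z j\<bar>)"
  proof (rule sum_mono)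
    fix j assume "j \<in> {..<N}"
    then have mass: "(\<integral>u. indicator (cell N j) u * w \<partial>levels m) = \<delta> * w" for w :: real
      using cell_mass[of j N] by (simp add: \<delta>_def)
    have i: "integrable (levels m) (\<lambda>u. \<bar>X u - w\<bar>)" for w
      using intX levels_const_integrable by auto
    have "(\<integral>u. indicator (cell N j) u * \<bar>X u - z j\<bar> \<partial>levels m)
      \<le> (\<integral>u. indicator (cell N j) u * \<bar>X u - cell_mean N X j\<bar> + indicator (cell N j) u * \<bar>cell_mean N X j - z j\<bar> \<partial>levels m)"
      by (intro integral_mono Bochner_Integration.integrable_add int i levels_const_integrable)
         (auto simp: indicator_def)
    also have "\<dots> = (\<integral>u. indicator (cell N j) u * \<bar>X u - cell_mean N X j\<bar> \<partial>levels m) + \<delta> * \<bar>cell_mean N X j - z j\<bar>"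
      unfolding mass[symmetric]
      by (intro Bochner_Integration.integral_add int i levels_const_integrable)
    finally show "(\<integral>u. indicator (cell N j) u * \<bar>X u - z j\<bar> \<partial>levels m)
      \<le> (\<integral>u. indicator (cell N j) u * \<bar>X u - cell_mean N X j\<bar> \<partial>levels m) + \<delta> * \<bar>cell_mean N X j - z j\<bar>" .
  qed
  also have "\<dots> \<le> \<epsilon> + \<delta> * (\<Sum>j<N. \<bar>cell_mean N X j - z j\<bar>)"
    unfolding sum.distrib sum_distrib_left using osc by simp
  also have "\<delta> * (\<Sum>j<N. \<bar>cell_mean N X j - z j\<bar>)
      = (\<Sum>j=k..<N. \<delta> * cell_mean N X j - \<delta> * cell_mean N Y j) + (\<Sum>j<k. \<delta> * cell_mean N Y j - \<delta> * cell_mean N X j)"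
    unfolding z_def cost by (simp only: distrib_left sum_distrib_left right_diff_distrib)
  also have "(\<Sum>j=k..<N. \<delta> * cell_mean N X j - \<delta> * cell_mean N Y j)
      = (\<Sum>j=k..<N. \<integral>u. indicator (cell N j) u * (X u - Y u) \<partial>levels m)"
    unfolding \<delta>_def cell_mean_integral[OF N] right_diff_distrib
    by (intro sum.cong refl Bochner_Integration.integral_diff[symmetric] int intX intY)
  also have "\<dots> = (\<integral>u. (\<Sum>j=k..<N. indicator (cell N j) u * (X u - Y u)) \<partial>levels m)"
    by (intro Bochner_Integration.integral_sum[symmetric] int Bochner_Integration.integrable_diff intX intY)
  also have "\<dots> = (\<integral>u. indicator {real k * (m / real N)..} u * (X u - Y u) \<partial>levels m)"
    by (intro Bochner_Integration.integral_cong refl)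
       (simp only: space_levels cells_above[OF N _ k] flip: sum_distrib_right)
  also have "(\<Sum>j<k. \<delta> * cell_mean N Y j - \<delta> * cell_mean N X j)
      = (\<Sum>j<k. \<integral>u. indicator (cell N j) u * (Y u - X u) \<partial>levels m)"
    unfolding \<delta>_def cell_mean_integral[OF N] right_diff_distrib
    by (intro sum.cong refl Bochner_Integration.integral_diff[symmetric] int intX intY)
  also have "\<dots> = (\<integral>u. (\<Sum>j<k. indicator (cell N j) u * (Y u - X u)) \<partial>levels m)"
    by (intro Bochner_Integration.integral_sum[symmetric] int Bochner_Integration.integrable_diff intX intY)
  also have "\<dots> = (\<integral>u. indicator {..<real k * (m / real N)} u * (Y u - X u) \<partial>levels m)"
    by (intro Bochner_Integration.integral_cong refl)
       (simp only: space_levels cells_below[OF N] flip: sum_distrib_right)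
  also have "\<epsilon> + ((\<integral>u. indicator {real k * (m / real N)..} u * (X u - Y u) \<partial>levels m)
      + (\<integral>u. indicator {..<real k * (m / real N)} u * (Y u - X u) \<partial>levels m)) \<le> p + c + \<epsilon>"
    using lower_quantile_gap[of "real k * (m / real N)"] upper_quantile_gap[of "real k * (m / real N)"] by simp
  finally show ?thesis by (simp add: ennreal_leI)
qed

end

section \<open>Optimal targets and the convex order\<close>

text \<open>Without mass there are no quantile functions, but then the null measure is a coupling.\<close>

lemma weak_cost_null:
  assumes \<mu>: "\<mu> \<in> meas1" and \<theta>: "\<theta> \<in> meas1"
    and mass: "emeasure \<mu> UNIV = 0" "emeasure \<theta> UNIV = 0"
  shows "weak_cost \<mu> \<theta> = 0"
proof -
  note fm = meas1_finite_measure[OF \<mu>] meas1_finite_measure[OF \<theta>]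
  define \<pi> :: "(real \<times> real) measure" where "\<pi> = null_measure (borel \<Otimes>\<^sub>M borel)"
  define K :: "real \<Rightarrow> real measure" where "K x = return borel 0" for x
  have sets_\<pi>: "sets \<pi> = sets (borel \<Otimes>\<^sub>M borel)" by (simp add: \<pi>_def)
  have null_\<pi>: "emeasure \<pi> A = 0" for A by (simp add: \<pi>_def)
  have zero: "emeasure \<mu> A = 0" "emeasure \<theta> A = 0" for A
    using mass emeasure_space[of \<mu> A] emeasure_space[of \<theta> A] fm by auto
  have "\<mu> = null_measure \<mu>" by (rule measure_eqI) (auto simp: zero)
  then have int0: "(\<integral>\<^sup>+ x. g x \<partial>\<mu>) = 0" for g by (metis nn_integral_null_measure)
  have "distr \<pi> borel fst = \<mu>" "distr \<pi> borel snd = \<theta>"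
    by (rule measure_eqI; simp add: fm zero emeasure_distr measurable_cong_sets[OF sets_\<pi> refl] null_\<pi>)+
  then have "\<pi> \<in> couplings \<mu> \<theta>" using sets_\<pi> by (simp add: couplings_def)
  moreover have "disintegration \<mu> \<pi> K"
    unfolding disintegration_def K_def by (auto simp: null_\<pi> int0 space_prob_algebra prob_space_return)
  ultimately have "weak_cost \<mu> \<theta> \<le> (\<integral>\<^sup>+ x. ennreal \<bar>x - (\<integral> y. y \<partial>(K x))\<bar> \<partial>\<mu>)"
    unfolding weak_cost_def by (intro Inf_lower) blast
  then show ?thesis by (simp add: int0)
qed

lemma weak_cost_le_put_call_gaps:
  assumes \<mu>: "\<mu> \<in> meas1" and \<theta>: "\<theta> \<in> meas1"
    and mass: "measure \<mu> UNIV = measure \<theta> UNIV"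
    and put_le: "\<And>k. put_fun \<mu> k - put_fun \<theta> k \<le> p"
    and call_le: "\<And>k. call_fun \<mu> k - call_fun \<theta> k \<le> c"
  shows "weak_cost \<mu> \<theta> \<le> ennreal (p + c)"
proof (cases "measure \<mu> UNIV = 0")
  case True
  then show ?thesis
    using weak_cost_null[OF \<mu> \<theta>] mass measure_meas1[OF \<mu>] measure_meas1[OF \<theta>] by simp
next
  case False
  define m where "m = measure \<mu> UNIV"
  have m: "0 < m" using False by (simp add: m_def zero_less_measure_iff)
  obtain X where X: "X \<in> borel_measurable (levels m)" "mono_on {0<..<m} X" "distr (levels m) borel X = \<mu>"
    by (rule quantile_function[OF \<mu> m_def[symmetric] m])
  obtain Y where Y: "Y \<in> borel_measurable (levels m)" "mono_on {0<..<m} Y" "distr (levels m) borel Y = \<theta>"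
    by (rule quantile_function[OF \<theta> _ m]) (auto simp: m_def mass)
  have mass': "measure \<theta> UNIV = m" by (simp add: m_def mass)
  note ctx = \<mu> \<theta> m_def[symmetric] mass' m put_le call_le X Y
  have nonneg: "0 \<le> p + c" using gap_bounds(1,2)[OF ctx] by simp
  show ?thesis
  proof (rule ennreal_le_epsilon)
    fix e :: real assume e: "0 < e"
    have "weak_cost \<mu> \<theta> \<le> ennreal (p + c + e)" by (rule weak_cost_le_quantiles[OF ctx e])
    also have "\<dots> = ennreal (p + c) + ennreal e" using nonneg e by (subst ennreal_plus) auto
    finally show "weak_cost \<mu> \<theta> \<le> ennreal (p + c) + ennreal e" .
  qed
qed

text \<open>Minimisers are studied through couplings whose cost is arbitrarily close to the infimum.\<close>

lemma weak_cost_near_optimal: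
  assumes \<mu>: "\<mu> \<in> meas1" and \<theta>: "\<theta> \<in> meas1" and less: "weak_cost \<mu> \<theta> < ennreal r"
  obtains \<pi> K where "\<pi> \<in> couplings \<mu> \<theta>" "disintegration \<mu> \<pi> K" "up_cost \<mu> K + down_cost \<mu> K < r"
proof -
  obtain \<pi> K where 1: "\<pi> \<in> couplings \<mu> \<theta>" "disintegration \<mu> \<pi> K"
    and "(\<integral>\<^sup>+ x. ennreal \<bar>x - (\<integral> y. y \<partial>(K x))\<bar> \<partial>\<mu>) < ennreal r"
    using less unfolding weak_cost_def Inf_less_iff by blast
  then have "ennreal (up_cost \<mu> K + down_cost \<mu> K) < ennreal r"
    using cost_eq[OF \<mu> \<theta> 1] by simp
  then have "up_cost \<mu> K + down_cost \<mu> K < r"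
    by (rule contrapos_pp) (simp add: not_less ennreal_leI)
  with 1 show ?thesis by (rule that)
qed

lemma affine_integrable:
  assumes "\<eta> \<in> meas1"
  shows "integrable \<eta> (\<lambda>x. b + s * x)" "(\<integral>x. b + s * x \<partial>\<eta>) = b * measure \<eta> UNIV + s * mean \<eta>"
  using meas1_integrable_id[OF assms] meas1_integrable_const[OF assms, of b] meas1_finite_measure(3)[OF assms]
  by (simp_all add: mean_def mult.commute)

text \<open>An integrable minorant \<open>a\<close> reduces the extended integral of \<open>f\<close> to an integral of a nonnegative function,
which may be infinite.\<close>

lemma ext_integral_split:
  fixes f a :: "real \<Rightarrow> real"
  assumes \<eta>: "\<eta> \<in> meas1" and [measurable]: "f \<in> borel_measurable borel" "a \<in> borel_measurable borel"
    and a: "integrable \<eta> a" and le: "\<And>x. a x \<le> f x"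
  shows "ext_integral \<eta> f = enn2ereal (\<integral>\<^sup>+ x. ennreal (f x - a x) \<partial>\<eta>) + ereal (\<integral>x. a x \<partial>\<eta>)"
proof -
  note [measurable_cong] = meas1_finite_measure(2)[OF \<eta>]
  define I where "I g = (\<integral>\<^sup>+ x. ennreal (g x) \<partial>\<eta>)" for g :: "real \<Rightarrow> real"
  have ap: "integrable \<eta> (\<lambda>x. max 0 (a x))" and am: "integrable \<eta> (\<lambda>x. max 0 (- a x))"
    using a meas1_integrable_const[OF \<eta>, of 0] by auto
  have fm: "integrable \<eta> (\<lambda>x. max 0 (- f x))"
  proof (rule Bochner_Integration.integrable_bound[OF am])
    show "(\<lambda>x. max 0 (- f x)) \<in> borel_measurable \<eta>" by measurable
    show "AE x in \<eta>. norm (max 0 (- f x)) \<le> norm (max 0 (- a x))"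
    proof (rule AE_I2)
      show "norm (max 0 (- f x)) \<le> norm (max 0 (- a x))" for x using le[of x] by simp
    qed
  qed
  have I_real: "I g = ennreal (\<integral>x. max 0 (g x) \<partial>\<eta>)" if "integrable \<eta> (\<lambda>x. max 0 (g x))" for g
  proof -
    have "I g = (\<integral>\<^sup>+ x. ennreal (max 0 (g x)) \<partial>\<eta>)"
      unfolding I_def by (intro nn_integral_cong) (simp add: max_def ennreal_neg)
    then show ?thesis using that by (simp add: nn_integral_eq_integral del: ennreal_max_0 ennreal_max_0')
  qed
  have "I f + I (\<lambda>x. - a x) = (\<integral>\<^sup>+ x. ennreal (f x) + ennreal (- a x) \<partial>\<eta>)"
    unfolding I_def by (rule nn_integral_add[symmetric]) measurable
  also have "\<dots> = (\<integral>\<^sup>+ x. (ennreal (f x - a x) + ennreal (a x)) + ennreal (- f x) \<partial>\<eta>)"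
  proof (rule nn_integral_cong)
    fix x
    have "ennreal (max 0 (f x) + max 0 (- a x)) = ennreal ((f x - a x) + max 0 (a x) + max 0 (- f x))"
      by (rule arg_cong[where f = ennreal]) auto
    then show "ennreal (f x) + ennreal (- a x) = (ennreal (f x - a x) + ennreal (a x)) + ennreal (- f x)"
      using le[of x] by (simp add: ennreal_plus)
  qed
  also have "\<dots> = (I (\<lambda>x. f x - a x) + I a) + I (\<lambda>x. - f x)"
    unfolding I_def by (subst nn_integral_add, measurable, subst nn_integral_add, measurable)
  finally have eq: "I f + I (\<lambda>x. - a x) = (I (\<lambda>x. f x - a x) + I a) + I (\<lambda>x. - f x)" .
  define A B C where "A = (\<integral>x. max 0 (a x) \<partial>\<eta>)" and "B = (\<integral>x. max 0 (- a x) \<partial>\<eta>)" and "C = (\<integral>x. max 0 (- f x) \<partial>\<eta>)"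
  have ABC: "0 \<le> A" "0 \<le> B" "0 \<le> C" by (simp_all add: A_def B_def C_def)
  have int_a: "(\<integral>x. a x \<partial>\<eta>) = A - B"
  proof -
    have "(\<integral>x. a x \<partial>\<eta>) = (\<integral>x. max 0 (a x) - max 0 (- a x) \<partial>\<eta>)"
      by (rule Bochner_Integration.integral_cong) auto
    then show ?thesis using ap am by (simp add: A_def B_def)
  qed
  have eq': "I f + ennreal B = I (\<lambda>x. f x - a x) + ennreal A + ennreal C"
    using eq I_real[OF ap] I_real[of "\<lambda>x. - a x"] am I_real[of "\<lambda>x. - f x"] fm by (simp add: A_def B_def C_def)
  have "enn2ereal (I f) + ereal B = enn2ereal (I (\<lambda>x. f x - a x)) + ereal A + ereal C"
    using arg_cong[OF eq', of enn2ereal] ABC by (simp add: plus_ennreal.rep_eq)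
  then have "enn2ereal (I f) - ereal C = enn2ereal (I (\<lambda>x. f x - a x)) + ereal (A - B)"
    by (cases "enn2ereal (I f)"; cases "enn2ereal (I (\<lambda>x. f x - a x))") auto
  moreover have "enn2ereal (I (\<lambda>x. - f x)) = ereal C"
    using I_real[of "\<lambda>x. - f x"] fm ABC by (simp add: C_def)
  ultimately show ?thesis by (simp add: ext_integral_def I_def int_a)
qed

text \<open>By put-call parity the call functions are ordered too, so the weak cost is \<open>0\<close> and some couplings have conditional
means \<open>b\<^sub>n\<close> with \<open>b\<^sub>n(x) \<rightarrow> x\<close> in mean, and almost everywhere along a subsequence.  After subtracting a
supporting line, \<open>f\<close> is nonnegative; Fatou bounds \<open>\<integral>f d\<eta>\<close> by the lower limit of \<open>\<integral>f(b\<^sub>n) d\<eta>\<close>, and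
Jensen bounds each of these by \<open>\<integral>f d\<theta>\<close>.\<close>

lemma convex_le_if_put_fun_le:
  assumes \<eta>: "\<eta> \<in> meas1" and \<theta>: "\<theta> \<in> meas1" and mass: "measure \<eta> UNIV = measure \<theta> UNIV"
    and mean: "mean \<eta> = mean \<theta>" and put_le: "\<And>k. put_fun \<eta> k \<le> put_fun \<theta> k"
  shows "\<eta> \<le>\<^sub>c \<theta>"
  unfolding convex_le_def
proof (intro allI impI)
  fix f :: "real \<Rightarrow> real" assume f: "convex_on UNIV f"
  note [measurable_cong] = meas1_finite_measure(2)[OF \<eta>] meas1_finite_measure(2)[OF \<theta>]
  have cont: "continuous_on UNIV f" by (rule convex_on_UNIV_continuous[OF f])
  define s where "s = right_deriv f 0"
  define a where "a x = f 0 + s * x" for x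
  have le: "a x \<le> f x" for x using right_deriv_subgradient[OF f, of 0 x] by (simp add: a_def s_def)
  define g where "g x = f x - a x" for x
  have g_nonneg: "0 \<le> g x" for x using le by (simp add: g_def)
  have g_convex: "convex_on UNIV g"
  proof (rule convex_on_three_pointI)
    fix x y z :: real assume "x < y" "y < z"
    then show "(z - x) * g y \<le> (z - y) * g x + (y - x) * g z"
      using convex_on_three_pointD[OF f, of x y z] by (simp add: g_def a_def algebra_simps)
  qed
  have g_cont: "isCont g x" for x
    using convex_on_UNIV_continuous[OF g_convex, of UNIV] by (simp add: continuous_on_eq_continuous_at)
  have [measurable]: "f \<in> borel_measurable borel" "a \<in> borel_measurable borel" "g \<in> borel_measurable borel"
    using convex_on_UNIV_continuous[OF g_convex, of UNIV] cont
    by (auto intro!: borel_measurable_continuous_onI simp: a_def[abs_def])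
  have cost0: "weak_cost \<eta> \<theta> \<le> ennreal (0 + 0)"
    using put_le put_call_parity[OF \<eta>] put_call_parity[OF \<theta>] mass mean by (intro weak_cost_le_put_call_gaps \<eta> \<theta>) auto
  have "\<exists>K \<pi>. \<pi> \<in> couplings \<eta> \<theta> \<and> disintegration \<eta> \<pi> K \<and> up_cost \<eta> K + down_cost \<eta> K < inverse (real (Suc n))" for n
  proof -
    have "weak_cost \<eta> \<theta> < ennreal (inverse (real (Suc n)))"
      by (rule le_less_trans[OF cost0]) (simp del: of_nat_Suc)
    then show ?thesis by (rule weak_cost_near_optimal[OF \<eta> \<theta>]) blast
  qed
  then obtain K \<pi> where K: "\<And>n. \<pi> n \<in> couplings \<eta> \<theta>" "\<And>n. disintegration \<eta> (\<pi> n) (K n)"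
    "\<And>n. up_cost \<eta> (K n) + down_cost \<eta> (K n) < inverse (real (Suc n))"
    by metis
  define b where "b n x = mean (K n x)" for n x
  have [measurable]: "b n \<in> borel_measurable borel" for n
    unfolding b_def by (rule mean_kernel_measurable[OF \<eta> \<theta> K(1,2)])
  have int: "integrable \<eta> (\<lambda>x. x - b n x)" for n
    using mean_kernel_integrable[OF \<eta> \<theta> K(1,2), of n] meas1_integrable_id[OF \<eta>] by (simp add: b_def)
  have L1: "(\<integral>x. norm (x - b n x) \<partial>\<eta>) = up_cost \<eta> (K n) + down_cost \<eta> (K n)" for n
  proof -
    have "(\<integral>x. norm (x - b n x) \<partial>\<eta>) = (\<integral>x. max 0 (b n x - x) + max 0 (x - b n x) \<partial>\<eta>)"
      by (rule Bochner_Integration.integral_cong) auto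
    then show ?thesis
      using cost_integrable[OF \<eta> \<theta> K(1,2), of n] by (simp add: b_def up_cost_def[OF \<eta> \<theta> K(1,2)] down_cost_def[OF \<eta> \<theta> K(1,2)])
  qed
  have "(\<lambda>n. \<integral>x. norm (x - b n x) \<partial>\<eta>) \<longlonglongrightarrow> 0"
    by (rule tendsto_sandwich[OF _ _ tendsto_const LIMSEQ_inverse_real_of_nat])
       (use K(3) in \<open>auto intro!: always_eventually less_imp_le simp: L1[symmetric] simp del: of_nat_Suc\<close>)
  from tendsto_L1_AE_subseq[OF int this] obtain r
    where r: "AE x in \<eta>. (\<lambda>n. x - b (r n) x) \<longlonglongrightarrow> 0" by blast
  have "AE x in \<eta>. ennreal (g x) = liminf (\<lambda>n. ennreal (g (b (r n) x)))"
    using r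
  proof eventually_elim
    case (elim x)
    then have "(\<lambda>n. x - (x - b (r n) x)) \<longlonglongrightarrow> x - 0" by (intro tendsto_intros)
    then have "(\<lambda>n. ennreal (g (b (r n) x))) \<longlonglongrightarrow> ennreal (g x)"
      by (intro tendsto_ennrealI isCont_tendsto_compose[OF g_cont]) simp
    then show ?case by (simp add: lim_imp_Liminf)
  qed
  then have "(\<integral>\<^sup>+ x. ennreal (g x) \<partial>\<eta>) = (\<integral>\<^sup>+ x. liminf (\<lambda>n. ennreal (g (b (r n) x))) \<partial>\<eta>)"
    by (rule nn_integral_cong_AE)
  also have "\<dots> \<le> liminf (\<lambda>n. \<integral>\<^sup>+ x. ennreal (g (b (r n) x)) \<partial>\<eta>)"
    by (rule nn_integral_liminf) measurable
  also have "\<dots> \<le> liminf (\<lambda>n. \<integral>\<^sup>+ y. ennreal (g y) \<partial>\<theta>)"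
    using jensen_kernel[OF \<eta> \<theta> K(1,2) g_convex g_nonneg] by (intro Liminf_mono always_eventually) (simp add: b_def)
  also have "\<dots> = (\<integral>\<^sup>+ y. ennreal (g y) \<partial>\<theta>)" by (simp add: Liminf_const)
  finally have "enn2ereal (\<integral>\<^sup>+ x. ennreal (f x - a x) \<partial>\<eta>) \<le> enn2ereal (\<integral>\<^sup>+ x. ennreal (f x - a x) \<partial>\<theta>)"
    by (simp add: g_def less_eq_ennreal.rep_eq)
  moreover have a_int: "integrable \<eta> a" "integrable \<theta> a" "(\<integral>x. a x \<partial>\<eta>) = (\<integral>x. a x \<partial>\<theta>)"
    using affine_integrable[OF \<eta>, of "f 0" s] affine_integrable[OF \<theta>, of "f 0" s] mass mean
    by (auto simp: a_def[abs_def])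
  ultimately show "ext_integral \<eta> f \<le> ext_integral \<theta> f"
    by (simp add: ext_integral_split[where a = a] \<eta> \<theta> le add_right_mono)
qed

lemma put_fun_le_if_convex_le:
  assumes \<eta>: "\<eta> \<in> meas1" and \<theta>: "\<theta> \<in> meas1" and le: "\<eta> \<le>\<^sub>c \<theta>"
  shows "put_fun \<eta> k \<le> put_fun \<theta> k"
proof -
  have eq: "ext_integral \<zeta> (\<lambda>x. max 0 (k - x)) = ereal (put_fun \<zeta> k)" if "\<zeta> \<in> meas1" for \<zeta>
  proof -
    have "ext_integral \<zeta> (\<lambda>x. max 0 (k - x))
        = enn2ereal (\<integral>\<^sup>+ x. ennreal (max 0 (k - x) - 0) \<partial>\<zeta>) + ereal (\<integral>x. 0 \<partial>\<zeta>)"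
      by (rule ext_integral_split[OF that]) auto
    moreover have "(\<integral>\<^sup>+ x. ennreal (max 0 (k - x) - 0) \<partial>\<zeta>) = ennreal (put_fun \<zeta> k)"
      unfolding put_fun_def diff_zero by (rule nn_integral_eq_integral[OF integrable_put[OF that]]) simp
    ultimately show ?thesis using put_fun_nonneg[of \<zeta> k] by simp
  qed
  have "convex_on UNIV (\<lambda>y :: real. max 0 (k - y))"
    using convex_on_positive_part[of "- 1" k] by simp
  with le have "ext_integral \<eta> (\<lambda>x. max 0 (k - x)) \<le> ext_integral \<theta> (\<lambda>x. max 0 (k - x))"
    by (simp add: convex_le_def)
  then show ?thesis by (simp add: eq \<eta> \<theta>)
qed

definition call_gap :: "real measure \<Rightarrow> real measure \<Rightarrow> real" where
  "call_gap \<mu> \<nu> = (SUP k. call_fun \<mu> k - call_fun \<nu> k)"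

lemma submeasures_put_call_le:
  assumes \<nu>: "\<nu> \<in> meas1" and \<theta>: "\<theta> \<in> submeasures \<mu> \<nu>"
  shows "put_fun \<theta> k \<le> put_fun \<nu> k" "call_fun \<theta> k \<le> call_fun \<nu> k"
proof -
  have \<theta>1: "\<theta> \<in> meas1" and le: "\<And>A. A \<in> sets borel \<Longrightarrow> emeasure \<theta> A \<le> emeasure \<nu> A"
    using \<theta> by (auto simp: submeasures_def)
  note [measurable_cong] = meas1_finite_measure(2)[OF \<theta>1] meas1_finite_measure(2)[OF \<nu>]
  have "\<theta> \<le> \<nu>"
    using le meas1_finite_measure(2)[OF \<nu>] meas1_finite_measure(2)[OF \<theta>1] by (simp add: le_measure)
  then have mono: "(\<integral>x. g x \<partial>\<theta>) \<le> (\<integral>x. g x \<partial>\<nu>)" if "integrable \<theta> g" "integrable \<nu> g" "\<And>x. 0 \<le> g x" for g :: "real \<Rightarrow> real"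
    using nn_integral_mono_measure[of \<theta> \<nu> "\<lambda>x. ennreal (g x)"] that
      meas1_finite_measure(2)[OF \<nu>] meas1_finite_measure(2)[OF \<theta>1]
    by (simp add: nn_integral_eq_integral integral_nonneg)
  show "put_fun \<theta> k \<le> put_fun \<nu> k" "call_fun \<theta> k \<le> call_fun \<nu> k"
    unfolding put_fun_def call_fun_def by (intro mono integrable_put integrable_call \<theta>1 \<nu>; simp)+
qed

context
  fixes \<mu> \<nu> :: "real measure"
  assumes \<mu>: "\<mu> \<in> meas1" and \<nu>: "\<nu> \<in> meas1" and mass_le: "emeasure \<mu> UNIV \<le> emeasure \<nu> UNIV"
begin

lemma call_gap_upper: "call_fun \<mu> k - call_fun \<nu> k \<le> call_gap \<mu> \<nu>"
  unfolding call_gap_def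
  using call_diff_bounded[OF \<mu> \<nu> mass_le] by (intro cSUP_upper) (auto simp: bdd_above_def)

lemma call_gap_least: "(\<And>k. call_fun \<mu> k - call_fun \<nu> k \<le> c) \<Longrightarrow> call_gap \<mu> \<nu> \<le> c"
  unfolding call_gap_def by (rule cSUP_least) auto

lemma submeasures_mass:
  assumes "\<theta> \<in> submeasures \<mu> \<nu>"
  shows "\<theta> \<in> meas1" "measure \<theta> UNIV = measure \<mu> UNIV"
  using assms by (auto simp: submeasures_def measure_def)

lemma gaps_le_costs:
  assumes \<theta>: "\<theta> \<in> submeasures \<mu> \<nu>" and K: "\<pi> \<in> couplings \<mu> \<theta>" "disintegration \<mu> \<pi> K"
  shows "put_gap \<mu> \<nu> \<le> up_cost \<mu> K" "call_gap \<mu> \<nu> \<le> down_cost \<mu> K"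
proof -
  note \<theta>1 = submeasures_mass(1)[OF \<theta>]
  show "put_gap \<mu> \<nu> \<le> up_cost \<mu> K"
  proof (rule put_gap_least[OF \<mu> \<nu> mass_le])
    show "put_fun \<mu> k - put_fun \<nu> k \<le> up_cost \<mu> K" for k
      using put_diff_le_up_cost[OF \<mu> \<theta>1 K, of k] submeasures_put_call_le(1)[OF \<nu> \<theta>, of k] by simp
  qed
  show "call_gap \<mu> \<nu> \<le> down_cost \<mu> K"
  proof (rule call_gap_least)
    show "call_fun \<mu> k - call_fun \<nu> k \<le> down_cost \<mu> K" for k
      using call_diff_le_down_cost[OF \<mu> \<theta>1 K, of k] submeasures_put_call_le(2)[OF \<nu> \<theta>, of k] by simp
  qed
qed

lemma weak_cost_ge_gaps:
  assumes \<theta>: "\<theta> \<in> submeasures \<mu> \<nu>"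
  shows "ennreal (put_gap \<mu> \<nu> + call_gap \<mu> \<nu>) \<le> weak_cost \<mu> \<theta>"
  unfolding weak_cost_def
proof (rule Inf_greatest, clarify)
  fix \<pi> K assume K: "\<pi> \<in> couplings \<mu> \<theta>" "disintegration \<mu> \<pi> K"
  show "ennreal (put_gap \<mu> \<nu> + call_gap \<mu> \<nu>) \<le> (\<integral>\<^sup>+ x. ennreal \<bar>x - (\<integral> y. y \<partial>(K x))\<bar> \<partial>\<mu>)"
    unfolding cost_eq[OF \<mu> submeasures_mass(1)[OF \<theta>] K]
    using gaps_le_costs[OF \<theta> K] by (intro ennreal_leI) simp
qed

text \<open>The bound for puts says that the minorant lies below \<open>P\<^sub>\<nu> - P\<^sub>\<mu>\<close>.  For calls, parity reduces the claim to a
lower bound on the mean of the shadow, which is read off from the affine minorant as \<open>k \<rightarrow> \<infinity>\<close>.\<close>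

lemma shadow_weak_cost_le: "weak_cost \<mu> (shadow \<nu> \<mu>) \<le> ennreal (put_gap \<mu> \<nu> + call_gap \<mu> \<nu>)"
proof -
  define S where "S = shadow \<nu> \<mu>"
  have sub: "S \<in> submeasures \<mu> \<nu>"
    and put_S: "put_fun S k = put_fun \<nu> k - gap_minorant \<mu> \<nu> k - put_gap \<mu> \<nu>" for k
    using shadow_properties[OF \<mu> \<nu> mass_le] by (auto simp: S_def)
  note S1 = submeasures_mass(1)[OF sub] and mass = submeasures_mass(2)[OF sub]
  have put: "put_fun \<mu> k - put_fun S k \<le> put_gap \<mu> \<nu>" for k
    using gap_minorant_le[OF \<mu> \<nu> mass_le, of k] put_S[of k] by simp
  have "mean \<mu> - call_gap \<mu> \<nu> + put_gap \<mu> \<nu> - mean S \<le> call_fun \<nu> k" for k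
  proof -
    have "put_fun S k \<le> put_fun \<nu> k - ((measure \<nu> UNIV - measure \<mu> UNIV) * k - (mean \<nu> - mean \<mu> + call_gap \<mu> \<nu>)) - put_gap \<mu> \<nu>"
      using gap_minorant_affine_lower[OF \<mu> \<nu> mass_le call_gap_upper, of k] put_S[of k] by simp
    moreover have "0 \<le> call_fun S k" by (simp add: call_fun_def)
    ultimately show ?thesis
      using put_call_parity[OF S1, of k] put_call_parity[OF \<nu>, of k] mass by (simp add: algebra_simps)
  qed
  then have "mean \<mu> - call_gap \<mu> \<nu> + put_gap \<mu> \<nu> - mean S \<le> 0"
    by (intro tendsto_lowerbound[OF call_fun_at_top[OF \<nu>]]) auto
  then have call: "call_fun \<mu> k - call_fun S k \<le> call_gap \<mu> \<nu>" for k
    using put[of k] put_call_parity[OF S1, of k] put_call_parity[OF \<mu>, of k] mass by simp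
  show ?thesis
    unfolding S_def[symmetric] by (rule weak_cost_le_put_call_gaps[OF \<mu> S1 mass[symmetric] put call])
qed

lemma shadow_in_argmin: "shadow \<nu> \<mu> \<in> cost_argmin \<mu> \<nu>"
  using shadow_properties(1)[OF \<mu> \<nu> mass_le] shadow_weak_cost_le weak_cost_ge_gaps
  by (auto simp: cost_argmin_def is_arg_min_def not_less intro: order_trans)

text \<open>An almost optimal coupling for \<open>\<theta>\<close> has total cost close to \<open>p + c\<close>, while its two parts are at least \<open>p\<close>
and \<open>c\<close>; so each part is close to its bound.\<close>

lemma argmin_properties:
  assumes \<theta>: "\<theta> \<in> cost_argmin \<mu> \<nu>"
  shows "\<theta> \<in> submeasures \<mu> \<nu>" "mean \<theta> = mean \<mu> + put_gap \<mu> \<nu> - call_gap \<mu> \<nu>"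
    "put_fun \<mu> k - put_fun \<theta> k \<le> put_gap \<mu> \<nu>"
proof -
  show sub: "\<theta> \<in> submeasures \<mu> \<nu>" using \<theta> by (simp add: cost_argmin_def is_arg_min_def)
  note \<theta>1 = submeasures_mass(1)[OF sub]
  have "weak_cost \<mu> \<theta> \<le> weak_cost \<mu> (shadow \<nu> \<mu>)"
    using \<theta> shadow_properties(1)[OF \<mu> \<nu> mass_le] by (auto simp: cost_argmin_def is_arg_min_def not_less)
  also note shadow_weak_cost_le
  finally have le: "weak_cost \<mu> \<theta> \<le> ennreal (put_gap \<mu> \<nu> + call_gap \<mu> \<nu>)" .
  have "((\<lambda>k. call_fun \<mu> k - call_fun \<nu> k) \<longlongrightarrow> 0 - 0) at_top"
    by (intro tendsto_diff call_fun_at_top \<mu> \<nu>)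
  from tendsto_upperbound[OF this always_eventually[OF allI[OF call_gap_upper]]]
  have c: "0 \<le> call_gap \<mu> \<nu>" by simp
  have p: "0 \<le> put_gap \<mu> \<nu>" by (rule put_gap_nonneg[OF \<mu> \<nu> mass_le])
  have approx: "\<bar>mean \<theta> - (mean \<mu> + put_gap \<mu> \<nu> - call_gap \<mu> \<nu>)\<bar> \<le> e \<and>
      put_fun \<mu> k - put_fun \<theta> k \<le> put_gap \<mu> \<nu> + e" if e: "0 < e" for e
  proof -
    have "weak_cost \<mu> \<theta> < ennreal (put_gap \<mu> \<nu> + call_gap \<mu> \<nu> + e)"
      using p c e by (intro le_less_trans[OF le] ennreal_lessI) auto
    then obtain \<pi> K where K: "\<pi> \<in> couplings \<mu> \<theta>" "disintegration \<mu> \<pi> K"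
      and less: "up_cost \<mu> K + down_cost \<mu> K < put_gap \<mu> \<nu> + call_gap \<mu> \<nu> + e"
      by (rule weak_cost_near_optimal[OF \<mu> \<theta>1])
    show ?thesis
      using gaps_le_costs[OF sub K] less mean_diff_eq[OF \<mu> \<theta>1 K] put_diff_le_up_cost[OF \<mu> \<theta>1 K, of k]
      by linarith
  qed
  have "\<bar>mean \<theta> - (mean \<mu> + put_gap \<mu> \<nu> - call_gap \<mu> \<nu>)\<bar> \<le> 0"
  proof (rule field_le_epsilon)
    show "\<bar>mean \<theta> - (mean \<mu> + put_gap \<mu> \<nu> - call_gap \<mu> \<nu>)\<bar> \<le> 0 + e" if "0 < e" for e
      using approx[OF that] by simp
  qed
  then show "mean \<theta> = mean \<mu> + put_gap \<mu> \<nu> - call_gap \<mu> \<nu>" by simp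
  show "put_fun \<mu> k - put_fun \<theta> k \<le> put_gap \<mu> \<nu>"
  proof (rule field_le_epsilon)
    show "put_fun \<mu> k - put_fun \<theta> k \<le> put_gap \<mu> \<nu> + e" if "0 < e" for e
      using approx[OF that] by simp
  qed
qed

text \<open>\<open>P\<^sub>\<nu> - P\<^sub>\<theta> - p\<close> is a convex minorant of \<open>P\<^sub>\<nu> - P\<^sub>\<mu>\<close>, hence below the greatest one, which is
\<open>P\<^sub>\<nu> - P\<^sub>S - p\<close> for the shadow \<open>S\<close>.\<close>

lemma put_fun_shadow_le:
  assumes \<theta>: "\<theta> \<in> cost_argmin \<mu> \<nu>"
  shows "put_fun (shadow \<nu> \<mu>) k \<le> put_fun \<theta> k"
proof -
  note sub = argmin_properties(1)[OF \<theta>]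
  have convex: "convex_on UNIV (\<lambda>k. put_fun \<nu> k - put_fun \<theta> k)"
    using sub by (intro convex_on_put_fun_diff \<nu>) (auto simp: submeasures_def)
  have "put_fun \<nu> k - put_fun \<theta> k - put_gap \<mu> \<nu> \<le> gap_minorant \<mu> \<nu> k"
  proof (rule gap_minorant_greatest[OF \<mu> \<nu> mass_le])
    show "convex_on UNIV (\<lambda>k. put_fun \<nu> k - put_fun \<theta> k - put_gap \<mu> \<nu>)"
    proof (rule convex_on_three_pointI)
      fix a b c :: real assume "a < b" "b < c"
      then show "(c - a) * (put_fun \<nu> b - put_fun \<theta> b - put_gap \<mu> \<nu>)
        \<le> (c - b) * (put_fun \<nu> a - put_fun \<theta> a - put_gap \<mu> \<nu>) + (b - a) * (put_fun \<nu> c - put_fun \<theta> c - put_gap \<mu> \<nu>)"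
        using convex_on_three_pointD[OF convex, of a b c] by (simp add: algebra_simps)
    qed
    show "put_fun \<nu> u - put_fun \<theta> u - put_gap \<mu> \<nu> \<le> put_fun \<nu> u - put_fun \<mu> u" for u
      using argmin_properties(3)[OF \<theta>, of u] by simp
  qed
  then show ?thesis using shadow_properties(2)[OF \<mu> \<nu> mass_le, of k] by simp
qed

lemma shadow_convex_le:
  assumes \<theta>: "\<theta> \<in> cost_argmin \<mu> \<nu>"
  shows "shadow \<nu> \<mu> \<le>\<^sub>c \<theta>"
proof (rule convex_le_if_put_fun_le)
  note S = argmin_properties(1,2)[OF shadow_in_argmin] and T = argmin_properties(1,2)[OF \<theta>]
  show "shadow \<nu> \<mu> \<in> meas1" "\<theta> \<in> meas1" "measure (shadow \<nu> \<mu>) UNIV = measure \<theta> UNIV"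
    using submeasures_mass[OF S(1)] submeasures_mass[OF T(1)] by auto
  show "mean (shadow \<nu> \<mu>) = mean \<theta>" using S(2) T(2) by simp
  show "put_fun (shadow \<nu> \<mu>) k \<le> put_fun \<theta> k" for k by (rule put_fun_shadow_le[OF \<theta>])
qed

end

theorem theorem5p1:
  fixes \<mu> \<nu> :: "real measure"
  assumes "\<mu> \<in> meas1" and "\<nu> \<in> meas1"
    and "emeasure \<mu> UNIV \<le> emeasure \<nu> UNIV"
  shows "shadow \<nu> \<mu> \<in> submeasures \<mu> \<nu>
     \<and> shadow \<nu> \<mu> \<in> cost_argmin \<mu> \<nu>
     \<and> (\<forall>\<theta>' \<in> cost_argmin \<mu> \<nu>. shadow \<nu> \<mu> \<le>\<^sub>c \<theta>')
     \<and> (\<forall>\<theta> \<in> submeasures \<mu> \<nu>.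
          \<theta> \<in> cost_argmin \<mu> \<nu> \<and> (\<forall>\<theta>' \<in> cost_argmin \<mu> \<nu>. \<theta> \<le>\<^sub>c \<theta>')
            \<longrightarrow> \<theta> = shadow \<nu> \<mu>)"
proof (intro conjI ballI impI)
  show sub: "shadow \<nu> \<mu> \<in> submeasures \<mu> \<nu>" by (rule shadow_properties(1)[OF assms])
  show argmin: "shadow \<nu> \<mu> \<in> cost_argmin \<mu> \<nu>" by (rule shadow_in_argmin[OF assms])
  show "shadow \<nu> \<mu> \<le>\<^sub>c \<theta>'" if "\<theta>' \<in> cost_argmin \<mu> \<nu>" for \<theta>' by (rule shadow_convex_le[OF assms that])
  fix \<theta> assume "\<theta> \<in> submeasures \<mu> \<nu>"
    and "\<theta> \<in> cost_argmin \<mu> \<nu> \<and> (\<forall>\<theta>' \<in> cost_argmin \<mu> \<nu>. \<theta> \<le>\<^sub>c \<theta>')"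
  then have \<theta>: "\<theta> \<in> meas1" "\<theta> \<in> cost_argmin \<mu> \<nu>" "\<theta> \<le>\<^sub>c shadow \<nu> \<mu>"
    using argmin by (auto simp: submeasures_def)
  have S: "shadow \<nu> \<mu> \<in> meas1" using sub by (simp add: submeasures_def)
  show "\<theta> = shadow \<nu> \<mu>"
    using put_fun_le_if_convex_le[OF \<theta>(1) S \<theta>(3)] put_fun_shadow_le[OF assms \<theta>(2)]
    by (intro put_fun_inject \<theta>(1) S antisym)
qed

end
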